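(* Let $C$ be a binary completely regular code of length $m$ (i.e. a subset of the vertex set $\mathbb{F}_2^m$ of the binary Hamming graph $\Gamma_m$) with minimum distance $\delta$. (a) If $(m,\delta)=(16,6)$, then $C$ is equivalent to the Nordstrom-Robinson code $\mathcal{NR}$. (b) If $(m,\delta)=(15,5)$, then $C$ is equivalent to the punctured Nordstrom-Robinson code $\mathcal{PN}$. Moreover, the codes $C$ in (a) and (b) are completely transitive.
   Context: The binary Hamming graph $\Gamma_m$ has vertex set $\mathbb{F}_2^m$, two vertices adjacent iff they differ in exactly one coordinate; $d(\alpha,\beta)$ is the Hamming distance and $\Gamma_{m,k}(\alpha)$ the set of vertices at distance $k$ from $\alpha$. $\mathrm{Aut}(\Gamma_m)=T\rtimes L$, where $T$ is the group of translations $\beta\mapsto\beta+\alpha$ of $\mathbb{F}_2^m$ and $L\cong S_m$ is the group of coordinate permutations. Two codes $C,C'\subseteq\mathbb{F}_2^m$ are equivalent if $C^x=C'$ for some $x\in\mathrm{Aut}(\Gamma_m)$. For a code $C$, $d(\gamma,C)=\min_{\beta\in C}d(\gamma,\beta)$, the covering radius $\rho$ is the maximum of $d(\gamma,C)$ over $\gamma\in\mathbb{F}_2^m$, and $C_i=\{\gamma: d(\gamma,C)=i\}$; $\{C=C_0,C_1,\dots,C_\rho\}$ is the distance partition. $C$ is completely regular if for every $i$ and $k$ the number $|\Gamma_{m,k}(\gamma)\cap C|$ is the same for all $\gamma\in C_i$. $C$ is completely transitive if there is a subgroup $X\le\mathrm{Aut}(\Gamma_m)$ such that each $C_i$ is an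 $X$-orbit. The minimum distance is the least distance between distinct codewords. Nordstrom-Robinson code: let $\mathcal{G}$ be the $[24,12,8]$ extended binary Golay code in $\mathbb{F}_2^{24}$, chosen so that $(1^8,0^{16})\in\mathcal{G}$. Let $J^*=\{1,\dots,8\}$ and $J=\{9,\dots,24\}$. Let $\mathcal{D}^0=\{\alpha\in\mathcal{G}:\mathrm{supp}(\alpha)\cap J^*=\emptyset\}$ and, for $1\le i\le 7$, $\mathcal{D}^i=\{\alpha\in\mathcal{G}:\mathrm{supp}(\alpha)\cap J^*=\{i,8\}\}$. Let $\mathcal{B}=\bigcup_{i=0}^7\mathcal{D}^i$. Then $\mathcal{NR}\subseteq\mathbb{F}_2^{16}$ is the set of restrictions of the vectors in $\mathcal{B}$ to the coordinates in $J$ (a $(16,256,6)$ code). The punctured Nordstrom-Robinson code $\mathcal{PN}\subseteq\mathbb{F}_2^{15}$ is obtained from $\mathcal{NR}$ by deleting the first coordinate of every codeword. *)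

theory Defs
  imports "HOL-Combinatorics.Permutations"
begin

text \<open>A vector of F_2^m is identified with its support, a subset of {..<m}
  (coordinates are numbered 0,...,m-1).  Vector addition is symmetric difference.\<close>

definition vectors :: "nat \<Rightarrow> nat set set" where
  "vectors m = {x. x \<subseteq> {..<m}}"

definition vadd :: "nat set \<Rightarrow> nat set \<Rightarrow> nat set" where
  "vadd x y = (x - y) \<union> (y - x)"

definition hdist :: "nat set \<Rightarrow> nat set \<Rightarrow> nat" where
  "hdist x y = card (vadd x y)"

definition sphere :: "nat \<Rightarrow> nat \<Rightarrow> nat set \<Rightarrow> nat set set" where
  "sphere m k a = {b \<in> vectors m. hdist a b = k}"

text \<open>Automorphism group of the Hamming graph: T \<rtimes> L, maps x \<mapsto> sigma(x) + a.\<close>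
definition Aut :: "nat \<Rightarrow> (nat set \<Rightarrow> nat set) set" where
  "Aut m = {(\<lambda>x. vadd (\<sigma> ` x) a) | \<sigma> a. \<sigma> permutes {..<m} \<and> a \<in> vectors m}"

definition equivalent_codes :: "nat \<Rightarrow> nat set set \<Rightarrow> nat set set \<Rightarrow> bool" where
  "equivalent_codes m C C' \<longleftrightarrow> (\<exists>x \<in> Aut m. x ` C = C')"

definition dist_code :: "nat set \<Rightarrow> nat set set \<Rightarrow> nat" where
  "dist_code g C = Min ((\<lambda>b. hdist g b) ` C)"

definition covering_radius :: "nat \<Rightarrow> nat set set \<Rightarrow> nat" where
  "covering_radius m C = Max ((\<lambda>g. dist_code g C) ` vectors m)"

definition dist_part :: "nat \<Rightarrow> nat set set \<Rightarrow> nat \<Rightarrow> nat set set" where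
  "dist_part m C i = {g \<in> vectors m. dist_code g C = i}"

definition completely_regular :: "nat \<Rightarrow> nat set set \<Rightarrow> bool" where
  "completely_regular m C \<longleftrightarrow>
     (\<forall>i k. \<forall>g \<in> dist_part m C i. \<forall>g' \<in> dist_part m C i.
        card (sphere m k g \<inter> C) = card (sphere m k g' \<inter> C))"

definition is_subgroup_Aut :: "nat \<Rightarrow> (nat set \<Rightarrow> nat set) set \<Rightarrow> bool" where
  "is_subgroup_Aut m X \<longleftrightarrow> X \<subseteq> Aut m \<and> id \<in> X \<and>
     (\<forall>f \<in> X. \<forall>g \<in> X. f \<circ> g \<in> X) \<and>
     (\<forall>f \<in> X. \<exists>g \<in> X. f \<circ> g = id \<and> g \<circ> f = id)"

definition orbit_of :: "(nat set \<Rightarrow> nat set) set \<Rightarrow> nat set \<Rightarrow> nat set set" where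
  "orbit_of X g = (\<lambda>f. f g) ` X"

definition completely_transitive :: "nat \<Rightarrow> nat set set \<Rightarrow> bool" where
  "completely_transitive m C \<longleftrightarrow>
     (\<exists>X. is_subgroup_Aut m X \<and>
        (\<forall>i \<le> covering_radius m C. \<exists>g. dist_part m C i = orbit_of X g))"

definition has_min_distance :: "nat set set \<Rightarrow> nat \<Rightarrow> bool" where
  "has_min_distance C \<delta> \<longleftrightarrow>
     (\<exists>a \<in> C. \<exists>b \<in> C. a \<noteq> b \<and> hdist a b = \<delta>) \<and>
     (\<forall>a \<in> C. \<forall>b \<in> C. a \<noteq> b \<longrightarrow> \<delta> \<le> hdist a b)"

definition xsum :: "nat set set \<Rightarrow> nat set" where
  "xsum S = {i. odd (card {r \<in> S. i \<in> r})}"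

text \<open>A generator matrix of an extended binary Golay code [24,12,8] with
  coordinates 0..23, containing (1^8,0^16) (second row).\<close>
definition golay_rows :: "nat set set" where
  "golay_rows = {
    {0..23},
    {0,1,2,3,4,5,6,7},
    {0,2,4,6,8,9,10,12},
    {2,4,5,6,10,11,13,14},
    {0,1,5,6,8,10,11,15},
    {0,3,4,6,8,11,13,16},
    {1,4,5,6,8,9,13,17},
    {1,3,4,6,9,10,11,18},
    {2,3,5,6,8,9,11,19},
    {0,1,2,3,4,5,8,9,10,11,13,20},
    {1,2,3,6,8,10,13,21},
    {0,3,5,6,9,10,13,22}}"

definition golay :: "nat set set" where
  "golay = xsum ` Pow golay_rows"

text \<open>J* = {0..7} (paper: 1..8), J = {8..23} (paper: 9..24).  D^0 and D^i with
  supp \<inter> J* = {i,7} for i = 0..6 (paper: {i,8}, i = 1..7).\<close>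
definition NR_B :: "nat set set" where
  "NR_B = {a \<in> golay. a \<inter> {0..7} = {} \<or> (\<exists>i \<in> {0..6}. a \<inter> {0..7} = {i, 7})}"

definition NR :: "nat set set" where
  "NR = (\<lambda>a. (\<lambda>j. j - 8) ` (a \<inter> {8..23})) ` NR_B"

definition PN :: "nat set set" where
  "PN = (\<lambda>a. (\<lambda>j. j - 1) ` (a - {0})) ` NR"

end

theory Submission
  imports Defs
begin

text \<open>Let N(k,g) be the number of codewords at distance k from g. Complete regularity makes N(k,g) a
  function of k and d(g,C), and counting codewords around the neighbours of g gives a
  three-term recursion for it. Integrality and nonnegativity then leave only card C = 256, and for m
  = 16 every edge of the Hamming graph changes the parity of d(g,C), so all distances in C are
  even. A code of length 15 is extended by a parity bit; after a translation both cases become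
  an even code D of length 16 with 256 words, minimum distance 6 and the zero word.\<close>

text \<open>For such D a counting bound is tight: each odd vector has one codeword at distance 1 or exactly
  five at distance 3. Hence the words of weight 6 form a 3-(16,6,4) design, the 4-sets in no
  such word ("quads") form a Steiner quadruple system, and the vectors meeting all quads evenly
  form a first-order Reed-Muller code R with D + R = D. Five points of a word of weight 6 are
  an affine frame, which identifies the coordinates with the points of a 4-dimensional space
  over F_2. Then D consists of eight cosets of R given by quadratic forms, and only two such
  codes exist, exchanged by swapping two frame points. Since the frame may start with any three
  coordinates, the same identification proves uniqueness and complete transitivity.\<close>

section \<open>The Hamming space\<close>

text \<open>Their substitute is a change of origin: the hypotheses of \<open>nr_code\<close> survive
  translation by a codeword \<open>c\<close>, so a statement about the weights in \<open>D\<close>,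
  applied to the translate, becomes one about the sums of \<open>c\<close> with codewords. That the
  all-one vector is a codeword, that \<open>R\<close> is orthogonal to \<open>D\<close>, and that
  adding words of \<open>R\<close> preserves \<open>D\<close> are all obtained in this way.

  Complete transitivity rests on a normal form. With a nearest codeword moved to zero, a vector at
  distance i becomes an i-set, and the identification with the standard code is chosen so that this
  set becomes {0, ..., i - 1}. Three labels can be prescribed freely. A fourth is possible only on a
  quad, where the fourth point is the affine sum of the other three; a 4-set at distance 4 from the
  code is always a quad. For length 15 the parity coordinate takes label 0, and a vector at distance
  3 supplies with it a quad in the extended code.\<close>

lemma in_vadd [simp]: "i \<in> vadd x y \<longleftrightarrow> (i \<in> x) \<noteq> (i \<in> y)"
  by (auto simp: vadd_def)

lemma vadd_commute: "vadd x y = vadd y x"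
  and vadd_assoc: "vadd (vadd x y) z = vadd x (vadd y z)"
  and vadd_left_commute: "vadd x (vadd y z) = vadd y (vadd x z)"
  by auto

lemmas vadd_ac = vadd_commute vadd_assoc vadd_left_commute

lemma vadd_empty [simp]: "vadd x {} = x" "vadd {} x = x"
  and vadd_self [simp]: "vadd x x = {}"
  and vadd_cancel [simp]: "vadd x (vadd x y) = y" 
  and vadd_cancel' [simp]: "vadd (vadd y x) x = y" "vadd (vadd x y) x = y" "vadd x (vadd y x) = y"
  and vadd_eq_empty [simp]: "vadd x y = {} \<longleftrightarrow> x = y"
  and vadd_left_inject [simp]: "vadd x y = vadd x z \<longleftrightarrow> y = z"
  and vadd_right_inject [simp]: "vadd y x = vadd z x \<longleftrightarrow> y = z"
  by auto

lemma inj_vadd [simp]: "inj_on (vadd a) X"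
  by (simp add: inj_on_def)

lemma vadd_image_vadd [simp]: "vadd a ` vadd a ` X = X"
  by (simp add: image_image)

lemma image_vadd: "inj \<sigma> \<Longrightarrow> \<sigma> ` vadd x y = vadd (\<sigma> ` x) (\<sigma> ` y)"
  by (auto simp: inj_image_mem_iff vadd_def inj_image_mem_iff dest: injD)

lemma vectors_iff: "x \<in> vectors m \<longleftrightarrow> x \<subseteq> {..<m}"
  by (simp add: vectors_def)

lemma vectors_lessD: "x \<in> vectors m \<Longrightarrow> i \<in> x \<Longrightarrow> i < m"
  by (auto simp: vectors_def)

lemma finite_vectors [simp]: "finite (vectors m)"
  by (simp add: vectors_def)

lemma card_vectors: "card (vectors m) = 2 ^ m"
  using card_Pow[of "{..<m}"] by (simp add: vectors_def Pow_def)

lemma finite_vector [simp]: "x \<in> vectors m \<Longrightarrow> finite x"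
  by (auto simp: vectors_def intro: finite_subset)

lemma vadd_vectors [simp]: "x \<in> vectors m \<Longrightarrow> y \<in> vectors m \<Longrightarrow> vadd x y \<in> vectors m"
  by (auto simp: vectors_def vadd_def)

lemma empty_vectors [simp]: "{} \<in> vectors m"
  by (simp add: vectors_def)

lemma singleton_vectors [simp]: "{p} \<in> vectors m \<longleftrightarrow> p < m"
  by (simp add: vectors_def)

lemma insert_vectors [simp]: "insert p x \<in> vectors m \<longleftrightarrow> p < m \<and> x \<in> vectors m"
  by (simp add: vectors_def)

lemma finite_vadd [simp]: "finite x \<Longrightarrow> finite y \<Longrightarrow> finite (vadd x y)"
  by (simp add: vadd_def)

lemma card_vadd:
  assumes "finite x" "finite y"
  shows "card (vadd x y) + 2 * card (x \<inter> y) = card x + card y"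
proof -
  have "card (vadd x y) = card (x - y) + card (y - x)"
    using assms unfolding vadd_def by (subst card_Un_disjoint) auto
  moreover have "card x = card (x - y) + card (x \<inter> y)"
    using assms by (metis add.commute card_Int_Diff)
  moreover have "card y = card (y - x) + card (x \<inter> y)"
    using assms by (metis add.commute card_Int_Diff Int_commute)
  ultimately show ?thesis by simp
qed

lemma hdist_commute: "hdist x y = hdist y x"
  by (simp add: hdist_def vadd_commute)

lemma hdist_empty [simp]: "hdist {} x = card x" "hdist x {} = card x"
  by (simp_all add: hdist_def)

lemma hdist_self [simp]: "hdist x x = 0"
  by (simp add: hdist_def)

lemma hdist_vadd [simp]: "hdist (vadd c x) (vadd c y) = hdist x y"
  by (simp add: hdist_def vadd_ac)

lemma hdist_triangle:
  assumes "x \<in> vectors m" "y \<in> vectors m" "z \<in> vectors m"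
  shows "hdist x z \<le> hdist x y + hdist y z"
proof -
  have "vadd x z \<subseteq> vadd x y \<union> vadd y z" by auto
  then have "card (vadd x z) \<le> card (vadd x y \<union> vadd y z)"
    using assms by (meson card_mono finite_UnI finite_vadd finite_vector)
  also have "\<dots> \<le> card (vadd x y) + card (vadd y z)" by (rule card_Un_le)
  finally show ?thesis by (simp add: hdist_def)
qed

lemma hdist_flip:
  assumes "x \<in> vectors m" "y \<in> vectors m"
  shows "p \<in> vadd x y \<Longrightarrow> Suc (hdist (vadd x {p}) y) = hdist x y"
    and "p \<notin> vadd x y \<Longrightarrow> hdist (vadd x {p}) y = Suc (hdist x y)"
proof -
  have fin: "finite (vadd x y)" using assms by (meson finite_vadd finite_vector)
  have eq: "vadd (vadd x {p}) y = vadd (vadd x y) {p}" by auto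
  show "Suc (hdist (vadd x {p}) y) = hdist x y" if "p \<in> vadd x y"
  proof -
    have "vadd (vadd x y) {p} = vadd x y - {p}" using that by auto
    then show ?thesis using that fin unfolding hdist_def eq by (metis card_Suc_Diff1)
  qed
  show "hdist (vadd x {p}) y = Suc (hdist x y)" if "p \<notin> vadd x y"
  proof -
    have "vadd (vadd x y) {p} = insert p (vadd x y)" using that by auto
    then show ?thesis using that fin unfolding hdist_def eq by simp
  qed
qed

section \<open>Distance to a code and double counts over all vectors\<close>

lemma dist_code_eq_iff:
  assumes "C \<subseteq> vectors m" "C \<noteq> {}"
  shows "dist_code g C = i \<longleftrightarrow> (\<exists>c\<in>C. hdist g c = i) \<and> (\<forall>c\<in>C. i \<le> hdist g c)"
proof -
  have "finite C" using assms by (meson finite_subset finite_vectors)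
  then show ?thesis unfolding dist_code_def
    using assms(2) by (subst Min_eq_iff) auto
qed

lemma dist_code_image:
  assumes "\<And>x y. hdist (f x) (f y) = hdist x y"
  shows "dist_code (f g) (f ` C) = dist_code g C"
  by (simp add: dist_code_def image_image assms)

definition dist_count :: "nat set set \<Rightarrow> nat \<Rightarrow> nat set \<Rightarrow> nat" where
  "dist_count C k g = card {c \<in> C. hdist g c = k}"

text \<open>Count the pairs (p, c) with \<open>c\<close> at distance \<open>Suc j\<close> from the
  neighbour of \<open>g\<close> in direction \<open>p\<close>. A flip changes the distance by
  exactly one, so a codeword at distance \<open>j + 2\<close> from \<open>g\<close> is paired with
  the \<open>j + 2\<close> coordinates where it differs from \<open>g\<close>, and one at distance
  \<open>j\<close> with the \<open>m - j\<close> coordinates where it agrees.\<close>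

lemma dist_count_neighbours:
  assumes C: "C \<subseteq> vectors m" and g: "g \<in> vectors m"
  shows "(\<Sum>p<m. dist_count C (Suc j) (vadd g {p}))
         = (j + 2) * dist_count C (j + 2) g + (m - j) * dist_count C j g"
proof -
  have fC: "finite C" using C by (meson finite_subset finite_vectors)
  have card: "card {p \<in> {..<m}. hdist (vadd g {p}) c = Suc j}
      = (j + 2) * of_bool (hdist g c = j + 2) + (m - j) * of_bool (hdist g c = j)"
    if "c \<in> C" for c
  proof -
    have c: "c \<in> vectors m" using that C by auto
    have s: "vadd g c \<subseteq> {..<m}" using c g by (simp flip: vectors_iff)
    have "{p \<in> {..<m}. hdist (vadd g {p}) c = Suc j}
      = (if hdist g c = j + 2 then vadd g c else if hdist g c = j then {..<m} - vadd g c else {})"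
    proof (rule set_eqI)
      fix p
      show "p \<in> {p \<in> {..<m}. hdist (vadd g {p}) c = Suc j} \<longleftrightarrow>
        p \<in> (if hdist g c = j + 2 then vadd g c else if hdist g c = j then {..<m} - vadd g c else {})"
        using hdist_flip[OF g c, of p] s by (cases "p \<in> vadd g c") (auto simp del: in_vadd)
    qed
    moreover have "card (vadd g c) = hdist g c" by (simp add: hdist_def)
    moreover have "card ({..<m} - vadd g c) = m - hdist g c"
      using s by (subst card_Diff_subset) (auto intro: finite_subset simp: hdist_def simp del: in_vadd)
    ultimately show ?thesis by auto
  qed
  have "(\<Sum>p<m. dist_count C (Suc j) (vadd g {p}))
      = (\<Sum>c\<in>C. card {p \<in> {..<m}. hdist (vadd g {p}) c = Suc j})"
    unfolding dist_count_def using fC by (intro sum_multicount_gen) auto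
  also have "\<dots> = (\<Sum>c\<in>C. (j + 2) * of_bool (hdist g c = j + 2) + (m - j) * of_bool (hdist g c = j))"
    by (intro sum.cong refl card)
  also have "\<dots> = (j + 2) * dist_count C (j + 2) g + (m - j) * dist_count C j g"
    using fC by (simp add: sum.distrib dist_count_def Int_def conj_commute flip: sum_distrib_left)
  finally show ?thesis .
qed

lemma card_k_sphere:
  assumes "c \<in> vectors m"
  shows "card {g \<in> vectors m. hdist g c = k} = m choose k"
proof -
  have "bij_betw (vadd c) {g \<in> vectors m. hdist g c = k} {s. s \<subseteq> {..<m} \<and> card s = k}"
    by (rule bij_betw_byWitness[where f' = "vadd c"])
      (use assms in \<open>auto simp: hdist_def vadd_commute[of c] simp flip: vectors_iff simp del: in_vadd\<close>)
  then show ?thesis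
    using n_subsets[of "{..<m}" k] by (simp add: bij_betw_same_card)
qed

lemma sum_wd:
  assumes C: "C \<subseteq> vectors m"
  shows "(\<Sum>g\<in>vectors m. dist_count C k g) = (m choose k) * card C"
  unfolding dist_count_def
proof (rule sum_multicount)
  show "finite C" using C finite_vectors by (rule finite_subset)
  show "\<forall>c\<in>C. card {g \<in> vectors m. hdist g c = k} = m choose k"
    using C card_k_sphere by blast
qed simp

lemma card_odd_vectors: "card {g \<in> vectors (Suc m). odd (card g)} = 2 ^ m"
proof -
  let ?V = "vectors (Suc m)"
  have par: "even (card (vadd {0} g)) \<longleftrightarrow> odd (card g)" if "g \<in> ?V" for g
  proof -
    have "card (vadd {0} g) + 2 * card ({0} \<inter> g) = 1 + card g"
      using card_vadd[of "{0}" g] that by simp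
    then have "even (card (vadd {0} g) + 2 * card ({0} \<inter> g)) = even (1 + card g)" by simp
    then show ?thesis by simp
  qed
  have "bij_betw (vadd {0}) {g \<in> ?V. odd (card g)} {g \<in> ?V. even (card g)}"
    by (rule bij_betw_byWitness[where f' = "vadd {0}"])
      (auto simp: par simp del: in_vadd)
  then have "card {g \<in> ?V. odd (card g)} = card {g \<in> ?V. even (card g)}"
    by (rule bij_betw_same_card)
  moreover have "card ({g \<in> ?V. odd (card g)} \<union> {g \<in> ?V. even (card g)})
      = card {g \<in> ?V. odd (card g)} + card {g \<in> ?V. even (card g)}"
    by (rule card_Un_disjoint) auto
  moreover have "{g \<in> ?V. odd (card g)} \<union> {g \<in> ?V. even (card g)} = ?V" by auto
  ultimately show ?thesis using card_vectors[of "Suc m"] by simp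
qed

lemma even_hdist:
  assumes "x \<in> vectors m" "y \<in> vectors m"
  shows "even (hdist x y) \<longleftrightarrow> (even (card x) \<longleftrightarrow> even (card y))"
proof -
  have "card (vadd x y) + 2 * card (x \<inter> y) = card x + card y"
    using assms by (intro card_vadd) auto
  then have "even (card (vadd x y) + 2 * card (x \<inter> y)) = even (card x + card y)" by simp
  then show ?thesis by (simp add: hdist_def)
qed

section \<open>The outer distribution of a completely regular code\<close>

locale code =
  fixes m :: nat and C :: "nat set set"
  assumes C: "C \<subseteq> vectors m" and nonempty: "C \<noteq> {}"
begin

abbreviation d :: "nat set \<Rightarrow> nat" where "d g \<equiv> dist_code g C"

lemma finite_C: "finite C"
  using C by (meson finite_subset finite_vectors)

lemma C_vectors: "c \<in> C \<Longrightarrow> c \<in> vectors m"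
  using C by auto

lemma d_le: "c \<in> C \<Longrightarrow> d g \<le> hdist g c"
  using dist_code_eq_iff[OF C nonempty] by blast

lemma d_attained: obtains c where "c \<in> C" "hdist g c = d g"
  using dist_code_eq_iff[OF C nonempty] by blast

lemma d_flip:
  assumes "g \<in> vectors m" "p < m"
  shows "d (vadd g {p}) \<le> Suc (d g)" "d g \<le> Suc (d (vadd g {p}))"
proof -
  have *: "d (vadd g {p}) \<le> Suc (d g)" if "g \<in> vectors m" for g
  proof -
    obtain c where c: "c \<in> C" "hdist g c = d g" by (rule d_attained)
    then have "hdist (vadd g {p}) c \<le> Suc (d g)"
      using hdist_flip[OF that C_vectors[OF c(1)], of p] by (cases "p \<in> vadd g c") auto
    then show ?thesis using d_le[OF c(1)] order.trans by blast
  qed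
  show "d (vadd g {p}) \<le> Suc (d g)" by (rule *) fact
  have "d (vadd (vadd g {p}) {p}) \<le> Suc (d (vadd g {p}))"
    using assms by (intro *) simp
  then show "d g \<le> Suc (d (vadd g {p}))" by simp
qed

lemma d_descend:
  assumes "g \<in> vectors m" "d g = Suc i"
  obtains p where "p < m" "d (vadd g {p}) = i"
proof -
  obtain c where c: "c \<in> C" "hdist g c = d g" by (rule d_attained)
  then have "vadd g c \<noteq> {}" using assms(2) unfolding hdist_def by force
  then obtain p where p: "p \<in> vadd g c" by blast
  then have "p < m" using assms(1) C_vectors[OF c(1)] by (auto dest: vectors_lessD)
  moreover have "hdist (vadd g {p}) c = i"
    using hdist_flip(1)[OF assms(1) C_vectors[OF c(1)] p] c assms(2) by simp
  then have "d (vadd g {p}) \<le> i" using d_le[OF c(1), of "vadd g {p}"] by simp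
  then have "d (vadd g {p}) = i" using d_flip(2)[OF assms(1) \<open>p < m\<close>] assms(2) by simp
  ultimately show thesis by (rule that)
qed

text \<open>Each step towards a nearest codeword lowers the distance by one. Bounding the distance
  thus reduces to excluding a single class.\<close>

lemma d_intermediate:
  assumes "g \<in> vectors m" "i \<le> d g"
  obtains g' where "g' \<in> vectors m" "d g' = i"
  using assms
proof (induction "d g - i" arbitrary: g thesis)
  case 0
  then show ?case by auto
next
  case (Suc n)
  have "d g = Suc (d g - 1)" using Suc.hyps(2) by simp
  with Suc.prems(2) obtain p where p: "p < m" "d (vadd g {p}) = d g - 1"
    by (rule d_descend)
  have "n = d (vadd g {p}) - i" "i \<le> d (vadd g {p})" using p Suc.hyps(2) by auto
  then show ?case using Suc.hyps(1)[of "vadd g {p}"] Suc.prems p(1) by auto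
qed

lemma dist_count_below: "k < d g \<Longrightarrow> dist_count C k g = 0"
proof -
  assume "k < d g"
  then have "{c \<in> C. hdist g c = k} = {}" using d_le[of _ g] by fastforce
  then show "dist_count C k g = 0" unfolding dist_count_def by (simp only: card.empty)
qed

text \<open>For a completely regular code these are the intersection numbers of the distance
  partition. They stay attached to the vector \<open>g\<close>, since complete regularity is stated
  through codeword counts only.\<close>

definition neighbours :: "nat set \<Rightarrow> nat \<Rightarrow> nat" where
  "neighbours g j = card {p \<in> {..<m}. d (vadd g {p}) = j}"

lemma sum_neighbours:
  fixes f :: "nat \<Rightarrow> nat"
  assumes "g \<in> vectors m"
  shows "(\<Sum>p<m. f (d (vadd g {p}))) = (\<Sum>j\<le>Suc (d g). neighbours g j * f j)"
proof -
  have "(\<Sum>p<m. f (d (vadd g {p})))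
      = (\<Sum>j\<le>Suc (d g). \<Sum>p | p \<in> {..<m} \<and> d (vadd g {p}) = j. f (d (vadd g {p})))"
    using d_flip(1)[OF assms] by (intro sum.group[symmetric]) auto
  also have "\<dots> = (\<Sum>j\<le>Suc (d g). neighbours g j * f j)"
    by (intro sum.cong refl) (simp add: neighbours_def)
  finally show ?thesis .
qed

lemma neighbours_total:
  assumes "g \<in> vectors m"
  shows "(\<Sum>j\<le>Suc (d g). neighbours g j) = m"
  using sum_neighbours[OF assms, of "\<lambda>_. 1"] by simp

lemma neighbours_eq_0: "neighbours g j = 0 \<longleftrightarrow> (\<forall>p<m. d (vadd g {p}) \<noteq> j)"
  by (auto simp: neighbours_def card_eq_0_iff)

lemma neighbours_below:
  assumes "g \<in> vectors m" "Suc j < d g"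
  shows "neighbours g j = 0"
  unfolding neighbours_eq_0
proof (intro allI impI)
  fix p assume "p < m"
  then show "d (vadd g {p}) \<noteq> j" using d_flip(2)[OF assms(1), of p] assms(2) by auto
qed

end

section \<open>Codes with a lower bound on the distances\<close>

locale distance_code = code +
  fixes \<delta> :: nat
  assumes min_distance: "\<lbrakk>a \<in> C; b \<in> C; a \<noteq> b\<rbrakk> \<Longrightarrow> \<delta> \<le> hdist a b"
begin

lemma codeword_unique:
  assumes "g \<in> vectors m" "a \<in> C" "b \<in> C" "hdist g a + hdist g b < \<delta>"
  shows "a = b"
proof (rule ccontr)
  assume "a \<noteq> b"
  then have "\<delta> \<le> hdist a b" using min_distance assms by blast
  also have "\<dots> \<le> hdist a g + hdist g b"
    using assms by (intro hdist_triangle) (auto intro: C_vectors)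
  finally show False using assms(4) by (simp add: hdist_commute)
qed

text \<open>Equality \<open>2 * hdist g c = \<delta>\<close> is allowed: another codeword may then
  be as near as \<open>c\<close>, but not nearer.\<close>

lemma d_eq:
  assumes "g \<in> vectors m" "c \<in> C" "2 * hdist g c \<le> \<delta>"
  shows "d g = hdist g c"
proof -
  have "hdist g c \<le> hdist g b" if "b \<in> C" for b
  proof (rule ccontr)
    assume "\<not> hdist g c \<le> hdist g b"
    then show False using codeword_unique[OF assms(1,2) that] assms(3) by auto
  qed
  then show ?thesis using dist_code_eq_iff[OF C nonempty] assms(2) by blast
qed

lemma dist_count_unique:
  assumes "g \<in> vectors m" "2 * d g < \<delta>"
  shows "dist_count C (d g) g = 1"
proof -
  obtain c where c: "c \<in> C" "hdist g c = d g" by (rule d_attained)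
  have "b = c" if "b \<in> C" "hdist g b = d g" for b
    using codeword_unique[OF assms(1) that(1) c(1)] that c assms(2) by simp
  then have "{c \<in> C. hdist g c = d g} = {c}" using c by blast
  then show ?thesis by (simp add: dist_count_def)
qed

lemma dist_count_zero:
  assumes "g \<in> vectors m" "d g + k < \<delta>" "k \<noteq> d g"
  shows "dist_count C k g = 0"
proof -
  obtain c where c: "c \<in> C" "hdist g c = d g" by (rule d_attained)
  have "hdist g b \<noteq> k" if "b \<in> C" for b
    using codeword_unique[OF assms(1) that c(1)] that c assms(2,3) by auto
  then have "{c \<in> C. hdist g c = k} = {}" by blast
  then show ?thesis unfolding dist_count_def by (simp only: card.empty)
qed

text \<open>A nearest codeword of \<open>g\<close> stays within half the minimum distance after one
  flip, so it remains nearest, and the distance to it changes by exactly one.\<close>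

lemma neighbours_near:
  assumes g: "g \<in> vectors m" and le: "2 * d g + 2 \<le> \<delta>" and p: "p < m"
  shows "d (vadd g {p}) = Suc (d g) \<or> Suc (d (vadd g {p})) = d g"
proof -
  obtain c where c: "c \<in> C" "hdist g c = d g" by (rule d_attained)
  show ?thesis
    using hdist_flip[OF g C_vectors[OF c(1)], of p] d_eq[of "vadd g {p}" c] c g p le
    by (cases "p \<in> vadd g c") auto
qed

text \<open>With \<open>c\<close> the nearest codeword of \<open>g\<close>, the coordinates in
  \<open>vadd g c\<close> lead one class down and all others one class up.\<close>

lemma neighbours_near_count:
  assumes g: "g \<in> vectors m" and le: "2 * d g + 2 \<le> \<delta>"
  shows "neighbours g (Suc (d g)) = m - d g" "neighbours g (d g) = 0"
    "d g = Suc i \<Longrightarrow> neighbours g i = Suc i"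
proof -
  obtain c where c: "c \<in> C" "hdist g c = d g" by (rule d_attained)
  have cv: "c \<in> vectors m" using c C_vectors by blast
  have sub: "vadd g c \<subseteq> {..<m}" using g cv by (simp flip: vectors_iff)
  have in_iff: "Suc (d (vadd g {p})) = d g" if "p \<in> vadd g c" for p
  proof -
    have "p < m" using that sub by auto
    then show ?thesis
      using hdist_flip(1)[OF g cv that] d_eq[of "vadd g {p}" c] c g le by auto
  qed
  have out_iff: "d (vadd g {p}) = Suc (d g)" if "p < m" "p \<notin> vadd g c" for p
    using hdist_flip(2)[OF g cv that(2)] d_eq[of "vadd g {p}" c] c g le that by auto
  show "neighbours g (d g) = 0"
    unfolding neighbours_eq_0 using neighbours_near[OF g le] by (metis n_not_Suc_n)
  have "{p \<in> {..<m}. d (vadd g {p}) = Suc (d g)} = {..<m} - vadd g c"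
  proof (rule set_eqI)
    fix p show "p \<in> {p \<in> {..<m}. d (vadd g {p}) = Suc (d g)} \<longleftrightarrow> p \<in> {..<m} - vadd g c"
      using in_iff[of p] out_iff[of p] by (cases "p \<in> vadd g c") (auto simp del: in_vadd)
  qed
  moreover have "card ({..<m} - vadd g c) = m - d g"
    using card_Diff_subset[OF finite_subset[OF sub] sub] c(2) by (simp add: hdist_def)
  ultimately show "neighbours g (Suc (d g)) = m - d g" by (simp add: neighbours_def)
  show "neighbours g i = Suc i" if "d g = Suc i"
  proof -
    have "{p \<in> {..<m}. d (vadd g {p}) = i} = vadd g c"
    proof (rule set_eqI)
      fix p show "p \<in> {p \<in> {..<m}. d (vadd g {p}) = i} \<longleftrightarrow> p \<in> vadd g c"
        using in_iff[of p] out_iff[of p] that sub by (cases "p \<in> vadd g c") (auto simp del: in_vadd)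
    qed
    then show ?thesis unfolding neighbours_def using c that by (simp add: hdist_def)
  qed
qed

end

section \<open>Complete regularity and the three-term recursion\<close>

locale cr_code = distance_code +
  assumes cr: "completely_regular m C" and attained: "\<exists>a\<in>C. \<exists>b\<in>C. a \<noteq> b \<and> hdist a b = \<delta>"
begin

text \<open>The value is 0 for an empty distance class.\<close>

definition \<beta> :: "nat \<Rightarrow> nat \<Rightarrow> nat" where
  "\<beta> i k = (if \<exists>g\<in>vectors m. d g = i then dist_count C k (SOME g. g \<in> vectors m \<and> d g = i) else 0)"

lemma dist_count_eq_\<beta>:
  assumes g: "g \<in> vectors m"
  shows "dist_count C k g = \<beta> (d g) k"
proof -
  define g' where "g' = (SOME g'. g' \<in> vectors m \<and> d g' = d g)"
  have g': "g' \<in> vectors m \<and> d g' = d g"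
    unfolding g'_def by (rule someI[of _ g]) (use g in simp)
  have sph: "sphere m k h \<inter> C = {c \<in> C. hdist h c = k}" for h k
    using C by (auto simp: sphere_def)
  have "dist_count C k g = dist_count C k g'"
    using cr[unfolded completely_regular_def, rule_format, of g "d g" g' k] g g'
    unfolding dist_part_def dist_count_def sph by simp
  moreover have "\<exists>h\<in>vectors m. d h = d g" using g by blast
  ultimately show ?thesis unfolding \<beta>_def g'_def by simp
qed

text \<open>The default 0 keeps this valid for empty classes, so a term such as
  \<open>\<beta> 5 3\<close> drops out of a recursion before anything is known about class
  5.\<close>

lemma \<beta>_below: "k < i \<Longrightarrow> \<beta> i k = 0"
proof (cases "\<exists>g\<in>vectors m. d g = i")
  case True
  then show "k < i \<Longrightarrow> \<beta> i k = 0" using dist_count_below dist_count_eq_\<beta> by metis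
qed (simp add: \<beta>_def)

lemma \<beta>_zero: "i + k < \<delta> \<Longrightarrow> k \<noteq> i \<Longrightarrow> \<beta> i k = 0"
proof (cases "\<exists>g\<in>vectors m. d g = i")
  case True
  then show "i + k < \<delta> \<Longrightarrow> k \<noteq> i \<Longrightarrow> \<beta> i k = 0" using dist_count_zero dist_count_eq_\<beta> by metis
qed (simp add: \<beta>_def)

lemma \<beta>_unique: "g \<in> vectors m \<Longrightarrow> d g = i \<Longrightarrow> 2 * i < \<delta> \<Longrightarrow> \<beta> i i = 1"
  using dist_count_unique[of g] dist_count_eq_\<beta>[of g "d g"] by simp

lemma \<beta>_recursion:
  assumes "g \<in> vectors m" "d g = i"
  shows "(\<Sum>j\<le>Suc i. neighbours g j * \<beta> j (Suc k)) = (k + 2) * \<beta> i (k + 2) + (m - k) * \<beta> i k"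
proof -
  have "(\<Sum>j\<le>Suc i. neighbours g j * \<beta> j (Suc k)) = (\<Sum>p<m. \<beta> (d (vadd g {p})) (Suc k))"
    using sum_neighbours[OF assms(1), of "\<lambda>j. \<beta> j (Suc k)"] assms(2) by (simp only:)
  also have "\<dots> = (\<Sum>p<m. dist_count C (Suc k) (vadd g {p}))"
    using assms(1) by (intro sum.cong refl dist_count_eq_\<beta>[symmetric]) auto
  finally show ?thesis using dist_count_neighbours[OF C assms(1), of k] dist_count_eq_\<beta>[OF assms(1)] assms(2) by simp
qed

text \<open>The one point where attainment of the minimum distance enters. It rules out degenerate
  solutions of the recursions: \<open>L = 1\<close> for length 16 and \<open>L = 0\<close> for
  length 15.\<close>

lemma \<beta>_\<delta>_pos: "0 < \<beta> 0 \<delta>"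
proof -
  obtain a b where ab: "a \<in> C" "b \<in> C" "hdist a b = \<delta>" using attained by blast
  have "d a = 0" using d_le[OF ab(1), of a] by simp
  then have "\<beta> 0 \<delta> = dist_count C \<delta> a" using dist_count_eq_\<beta>[of a] C_vectors[OF ab(1)] by simp
  moreover have "{c \<in> C. hdist a c = \<delta>} \<noteq> {}" using ab by blast
  then have "0 < dist_count C \<delta> a" using finite_C unfolding dist_count_def by (simp add: card_gt_0_iff)
  ultimately show ?thesis by simp
qed

lemma class_nonempty:
  assumes "2 * i \<le> \<delta>" "i \<le> m"
  obtains g where "g \<in> vectors m" "d g = i"
proof -
  obtain c where c: "c \<in> C" using nonempty by auto
  have v: "{..<i} \<in> vectors m" using assms(2) by (auto simp: vectors_iff)
  have h: "hdist (vadd c {..<i}) c = i" by (simp add: hdist_def vadd_commute)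
  have "d (vadd c {..<i}) = i"
    using d_eq[of "vadd c {..<i}" c] assms v c C_vectors[OF c] h by auto
  then show thesis using that[of "vadd c {..<i}"] v C_vectors[OF c] by auto
qed

text \<open>The indices are separate variables linked by equations, so that instances can be stated
  with numerals throughout.\<close>

lemma \<beta>_recursion3:
  assumes g: "g \<in> vectors m" "d g = i" and ind: "i = a + 1" "b = i + 1" "l = k + 1" "n = k + 2"
  shows "neighbours g a * \<beta> a l + neighbours g i * \<beta> i l + neighbours g b * \<beta> b l
         = n * \<beta> i n + (m - k) * \<beta> i k"
proof -
  have "(\<Sum>j\<le>Suc i. neighbours g j * \<beta> j l)
      = neighbours g a * \<beta> a l + neighbours g i * \<beta> i l + neighbours g b * \<beta> b l
        + (\<Sum>j<a. neighbours g j * \<beta> j l)"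
    by (simp add: ind atMost_Suc lessThan_Suc_atMost[symmetric])
  also have "(\<Sum>j<a. neighbours g j * \<beta> j l) = 0"
    using neighbours_below[OF g(1)] g(2) ind by (intro sum.neutral) auto
  finally show ?thesis using \<beta>_recursion[OF g, of k] ind by simp
qed

lemma neighbours_total3:
  assumes g: "g \<in> vectors m" "d g = i" and ind: "i = a + 1" "b = i + 1"
  shows "neighbours g a + neighbours g i + neighbours g b = m"
proof -
  have "(\<Sum>j\<le>Suc i. neighbours g j) = neighbours g a + neighbours g i + neighbours g b + (\<Sum>j<a. neighbours g j)"
    by (simp add: ind atMost_Suc lessThan_Suc_atMost[symmetric])
  also have "(\<Sum>j<a. neighbours g j) = 0"
    using neighbours_below[OF g(1)] g(2) ind by (intro sum.neutral) auto
  finally show ?thesis using neighbours_total[OF g(1)] g(2) by simp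
qed

text \<open>At \<open>i = 0\<close> the truncated \<open>i - 1\<close> is harmless, its term having
  coefficient 0.\<close>

lemma \<beta>_recursion_near:
  assumes "2 * i + 2 \<le> \<delta>" "i \<le> m" and ind: "h = i + 1" "l = k + 1" "n = k + 2"
  shows "i * \<beta> (i - 1) l + (m - i) * \<beta> h l = n * \<beta> i n + (m - k) * \<beta> i k"
proof -
  obtain g where g: "g \<in> vectors m" "d g = i" using class_nonempty[of i] assms by auto
  have n: "neighbours g h = m - i" "neighbours g i = 0"
    using neighbours_near_count[OF g(1)] g(2) assms by auto
  show ?thesis
  proof (cases i)
    case 0
    then show ?thesis using \<beta>_recursion[OF g, of k] n ind by simp
  next
    case (Suc j)
    then have "neighbours g j = i" using neighbours_near_count(3)[OF g(1)] g(2) assms by auto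
    then show ?thesis using \<beta>_recursion3[OF g, of j h l k n] n Suc ind by simp
  qed
qed

text \<open>Each codeword at distance 3 from \<open>g\<close> gives three directions into class 2,
  and a vector of class 2 has only one codeword at distance 2, so these directions are distinct.
  Formally this is the recursion with \<open>k = 1\<close>, where all other terms vanish.\<close>

lemma neighbours_3_2:
  assumes g: "g \<in> vectors m" "d g = 3" and "4 < \<delta>" "2 \<le> m"
  shows "neighbours g 2 = 3 * \<beta> 3 3"
proof -
  obtain h where "h \<in> vectors m" "d h = 2" using class_nonempty[of 2] assms by auto
  then have "\<beta> 2 2 = 1" using \<beta>_unique assms(3) by auto
  then show ?thesis
    using \<beta>_recursion3[OF g, of 2 4 2 1 3] \<beta>_below[of 2 3] \<beta>_below[of 2 4] \<beta>_below[of 1 3] by simp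
qed

lemma neighbour_unique:
  assumes "neighbours g j = 1" "p < m" "q < m" "d (vadd g {p}) = j" "d (vadd g {q}) = j"
  shows "p = q"
proof -
  obtain x where "{p \<in> {..<m}. d (vadd g {p}) = j} = {x}"
    using assms(1) unfolding neighbours_def by (rule card_1_singletonE)
  then have "p \<in> {x}" "q \<in> {x}" using assms(2-) by blast+
  then show ?thesis by simp
qed

section \<open>Length 16: parameters, parity and size\<close>

lemma outer_distribution_16:
  assumes m: "m = 16" and \<delta>: "\<delta> = 6"
  shows "\<beta> 3 3 = 5" "g \<in> vectors m \<Longrightarrow> d g = 3 \<Longrightarrow> neighbours g 3 = 0 \<and> neighbours g 4 = 1"
proof -
  have near: "i * \<beta> a l + r * \<beta> h l = n * \<beta> i n + s * \<beta> i k"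
    if "i \<le> 2" "h = i + 1" "l = k + 1" "n = k + 2" "a = i - 1" "r = 16 - i" "s = 16 - k" for i h l k n a r s
    using \<beta>_recursion_near[OF _ _ that(2-4)] that(1) that(5-7) m \<delta> by simp
  have rec: "neighbours g a * \<beta> a l + neighbours g i * \<beta> i l + neighbours g b * \<beta> b l
         = n * \<beta> i n + r * \<beta> i k"
    if "g \<in> vectors m" "d g = i" "i = a + 1" "b = i + 1" "l = k + 1" "n = k + 2" "r = 16 - k" for g i a b l k n r
    using \<beta>_recursion3[OF that(1-6)] that(7) m by simp
  obtain g3 where g3: "g3 \<in> vectors m" "d g3 = 3" using class_nonempty[of 3] m \<delta> by auto
  obtain g2 where g2: "g2 \<in> vectors m" "d g2 = 2" using class_nonempty[of 2] m \<delta> by auto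
  have b22: "\<beta> 2 2 = 1" using \<beta>_unique[OF g2] \<delta> by simp
  define L where "L = \<beta> 3 3"
  have z04: "\<beta> 0 4 = 0" by (rule \<beta>_zero) (simp_all add: \<delta>)
  have z13: "\<beta> 1 3 = 0" by (rule \<beta>_zero) (simp_all add: \<delta>)
  have z23: "\<beta> 2 3 = 0" by (rule \<beta>_zero) (simp_all add: \<delta>)
  have z32: "\<beta> 3 2 = 0" by (rule \<beta>_below) simp
  have z42: "\<beta> 4 2 = 0" by (rule \<beta>_below) simp
  have z43: "\<beta> 4 3 = 0" by (rule \<beta>_below) simp
  have z53: "\<beta> 5 3 = 0" by (rule \<beta>_below) simp
  have e1: "0 * \<beta> 0 5 + 16 * \<beta> 1 5 = 6 * \<beta> 0 6 + 12 * \<beta> 0 4"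
    by (rule near) simp_all
  have e2: "1 * \<beta> 0 4 + 15 * \<beta> 2 4 = 5 * \<beta> 1 5 + 13 * \<beta> 1 3"
    by (rule near) simp_all
  have e3: "2 * \<beta> 1 3 + 14 * \<beta> 3 3 = 4 * \<beta> 2 4 + 14 * \<beta> 2 2"
    by (rule near) simp_all
  note e = e1 e2 e3[folded L_def] z04 z13 b22
  have n2: "neighbours g 2 = 3 * L" if "g \<in> vectors m" "d g = 3" for g
    using neighbours_3_2[OF that] m \<delta> by (simp add: L_def)
  have ntot: "neighbours g 2 + neighbours g 3 + neighbours g 4 = 16" if "g \<in> vectors m" "d g = 3" for g
    using neighbours_total3[OF that, of 2 4] m by simp
  have L5: "L \<le> 5" using ntot[OF g3] n2[OF g3] by linarith
  have b06: "0 < \<beta> 0 6" using \<beta>_\<delta>_pos \<delta> by simp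
  \<comment> \<open>The equation is \<open>e3\<close>; positivity climbs from
    \<open>\<beta> 0 6\<close> through \<open>\<beta> 1 5\<close> to \<open>\<beta> 2 4\<close>. So
    \<open>L\<close> is odd and exceeds 1, and \<open>3 * L \<le> 16\<close> leaves 3 and 5.\<close>
  have "7 * L = 2 * \<beta> 2 4 + 7" "0 < \<beta> 2 4" using e b06 by linarith+
  then have "odd L" "1 < L" by presburger+
  then have L35: "L = 3 \<or> L = 5" using L5 by presburger
  \<comment> \<open>If g and its neighbour g + {p} were both at distance 3, the 3 L directions leading from each of them
      to distance 2 would be disjoint, because no two vectors at distance 2 are adjacent; so 6 L \<le> 15.\<close>
  have n3: "neighbours g 3 = 0" if g: "g \<in> vectors m" "d g = 3" for g
    unfolding neighbours_eq_0
  proof (intro allI impI notI)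
    fix p assume p: "p < m" and dp: "d (vadd g {p}) = 3"
    let ?U = "\<lambda>h. {q \<in> {..<m}. d (vadd h {q}) = 2}"
    have U: "card (?U h) = 3 * L" if "h \<in> vectors m" "d h = 3" for h
      using n2[OF that] by (simp add: neighbours_def)
    have gp: "vadd g {p} \<in> vectors m" using g p by simp
    have disj: "?U g \<inter> ?U (vadd g {p}) = {}"
    proof (rule ccontr)
      assume "?U g \<inter> ?U (vadd g {p}) \<noteq> {}"
      then obtain q where q: "q < m" "d (vadd g {q}) = 2" "d (vadd (vadd g {p}) {q}) = 2" by auto
      then show False
        using neighbours_near[of "vadd g {q}" p] g p \<delta> by (simp add: vadd_ac)
    qed
    have "?U g \<union> ?U (vadd g {p}) \<subseteq> {..<m} - {p}" using dp g by auto
    then have "card (?U g \<union> ?U (vadd g {p})) \<le> card ({..<m} - {p})" by (intro card_mono) auto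
    then have "6 * L \<le> 15" using disj U[OF g] U[OF gp dp] p m by (subst (asm) card_Un_disjoint) auto
    then show False using L35 by auto
  qed
  have n4: "neighbours g 4 = 16 - 3 * L" if "g \<in> vectors m" "d g = 3" for g
    using ntot[OF that] n2[OF that] n3[OF that] by simp
  \<comment> \<open>With \<open>L = 3\<close> a vector of class 3 has 16 - 9 = 7 neighbours in class
    4, so class 4 is nonempty and its recursion can be used.\<close>
  have "L \<noteq> 3"
  proof
    assume L: "L = 3"
    have r2: "neighbours g3 2 * \<beta> 2 3 + neighbours g3 3 * \<beta> 3 3 + neighbours g3 4 * \<beta> 4 3
      = 4 * \<beta> 3 4 + 14 * \<beta> 3 2"
      by (rule rec) (use g3 in simp_all)
    have r3: "neighbours g3 2 * \<beta> 2 4 + neighbours g3 3 * \<beta> 3 4 + neighbours g3 4 * \<beta> 4 4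
      = 5 * \<beta> 3 5 + 13 * \<beta> 3 3"
      by (rule rec) (use g3 in simp_all)
  have f2: "2 * \<beta> 1 5 + 14 * \<beta> 3 5 = 6 * \<beta> 2 6 + 12 * \<beta> 2 4"
    by (rule near) simp_all
  have f3: "1 * \<beta> 0 6 + 15 * \<beta> 2 6 = 7 * \<beta> 1 7 + 11 * \<beta> 1 5"
    by (rule near) simp_all
  have f4: "0 * \<beta> 0 7 + 16 * \<beta> 1 7 = 8 * \<beta> 0 8 + 10 * \<beta> 0 6"
    by (rule near) simp_all
    have n: "neighbours g3 2 = 9" "neighbours g3 3 = 0" "neighbours g3 4 = 7"
      using n2[OF g3] n3[OF g3] n4[OF g3] L by simp_all
    have b33: "\<beta> 3 3 = 3" using L by (simp add: L_def)
    have b34: "\<beta> 3 4 = 0" using r2[unfolded n z43 z23 z32] by simp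
    have f1: "9 * \<beta> 2 4 + 7 * \<beta> 4 4 = 5 * \<beta> 3 5 + 39" using r3[unfolded n b33] by simp
    have "neighbours g3 4 \<noteq> 0" using n by simp
    then obtain p where p: "p < m" "d (vadd g3 {p}) = 4" unfolding neighbours_eq_0 by blast
    obtain u where u: "u \<in> vectors m" "d u = 4"
      by (rule that[of "vadd g3 {p}"]) (use p g3 in auto)
    have ru: "neighbours u 3 * \<beta> 3 3 + neighbours u 4 * \<beta> 4 3 + neighbours u 5 * \<beta> 5 3
      = 4 * \<beta> 4 4 + 14 * \<beta> 4 2"
      by (rule rec) (use u in simp_all)
    have "neighbours u 3 * 3 = 4 * \<beta> 4 4" using ru[unfolded z43 z53 z42 b33] by simp
    moreover have "neighbours u 3 \<le> 16" using neighbours_total3[OF u, of 3 5] m by simp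
    \<comment> \<open>\<open>L = 3\<close> gives \<open>\<beta> 2 4 = 7\<close>,
      \<open>\<beta> 1 5 = 21\<close> and \<open>\<beta> 0 6 = 56\<close>. Then \<open>f4\<close>,
      \<open>f3\<close> and \<open>f2\<close> yield in turn \<open>\<beta> 1 7 \<ge> 35\<close>,
      \<open>\<beta> 2 6 \<ge> 28\<close> and \<open>\<beta> 3 5 \<ge> 15\<close>, and
      \<open>f1\<close> gives the lower bound 8.\<close>
    ultimately have "\<beta> 4 4 \<le> 12" "8 \<le> \<beta> 4 4" using f1 f2 f3 f4 e L by linarith+
    then have "\<beta> 4 4 = 8 \<or> \<beta> 4 4 = 9 \<or> \<beta> 4 4 = 10 \<or> \<beta> 4 4 = 11 \<or> \<beta> 4 4 = 12" by linarith
    then have "\<beta> 4 4 = 9 \<or> \<beta> 4 4 = 12" using \<open>neighbours u 3 * 3 = 4 * \<beta> 4 4\<close> by presburger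
    \<comment> \<open>For 9 and 12 the left side is 87 and 108, neither a multiple of 5.\<close>
    moreover have "24 + 7 * \<beta> 4 4 = 5 * \<beta> 3 5" using f1 e L by linarith
    ultimately show False by presburger
  qed
  then have L: "L = 5" using L35 by simp
  then show "\<beta> 3 3 = 5" by (simp add: L_def)
  show "neighbours g 3 = 0 \<and> neighbours g 4 = 1" if "g \<in> vectors m" "d g = 3"
    using n3[OF that] n4[OF that] L by simp
qed

text \<open>The new case is class 4. Let \<open>u\<close> lie there and let \<open>q\<close> lead to
  \<open>g\<close> in class 3. From \<open>g\<close> the only way back into class 4 is
  \<open>q\<close>, so any other \<open>p\<close> leads from \<open>g\<close> to class 2, and hence
  from \<open>u\<close> to class 3. All neighbours of class 4 thus lie in class 3, which also
  excludes class 5.\<close>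

lemma d_parity_16:
  assumes m: "m = 16" and \<delta>: "\<delta> = 6" and g: "g \<in> vectors m" and p: "p < m"
  shows "odd (d (vadd g {p})) \<longleftrightarrow> even (d g)" "d g \<le> 4"
proof -
  have two: "d (vadd g {p}) = Suc (d g) \<or> Suc (d (vadd g {p})) = d g"
    if "d g \<le> 2" "g \<in> vectors m" "p < m" for g p
    using neighbours_near[OF that(2) _ that(3)] that(1) \<delta> by simp
  have three: "d (vadd g {p}) = 2 \<or> d (vadd g {p}) = 4" if "d g = 3" "g \<in> vectors m" "p < m" for g p
  proof -
    have "d (vadd g {p}) \<noteq> 3" using outer_distribution_16(2)[OF m \<delta> that(2,1)] that(3) by (auto simp: neighbours_eq_0)
    then show ?thesis using d_flip[OF that(2,3)] that(1) by linarith
  qed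
  have four: "d (vadd u {p}) = 3" if u: "d u = 4" "u \<in> vectors m" and p: "p < m" for u p
  proof -
    obtain q where q: "q < m" "d (vadd u {q}) = 3" using d_descend[of u 3] u by auto
    define g where "g = vadd u {q}"
    have g: "g \<in> vectors m" "d g = 3" "d (vadd g {q}) = 4"
      using q u by (auto simp: g_def)
    show ?thesis
    proof (cases "p = q")
      case False
      then have "d (vadd g {p}) \<noteq> 4"
        using neighbour_unique[of g 4 p q] outer_distribution_16(2)[OF m \<delta> g(1,2)] g(3) p q by auto
      then have "d (vadd g {p}) = 2" using three[OF g(2,1) p] by simp
      then have "d (vadd (vadd g {p}) {q}) \<le> 3" using d_flip(1)[of "vadd g {p}" q] g p q by simp
      moreover have "vadd (vadd g {p}) {q} = vadd u {p}" by (auto simp: g_def)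
      ultimately show ?thesis using d_flip(2)[OF u(2) p] u(1) by simp
    qed (use q in simp)
  qed
  have le4: "d g \<le> 4" if gv: "g \<in> vectors m" for g
  proof (rule ccontr)
    assume "\<not> d g \<le> 4"
    then have "5 \<le> d g" by simp
    then obtain h where h: "h \<in> vectors m" "d h = 5" using d_intermediate[OF gv] by blast
    then obtain q where "q < m" "d (vadd h {q}) = 4" using d_descend[of h 4] by auto
    then show False using four[of "vadd h {q}" q] h by simp
  qed
  then show "d g \<le> 4" using g by simp
  then consider "d g \<le> 2" | "d g = 3" | "d g = 4" by linarith
  then show "odd (d (vadd g {p})) \<longleftrightarrow> even (d g)"
  proof cases
    case 1
    then show ?thesis using two[OF 1 g p] by (metis even_Suc)
  qed (use three[OF _ g p] four[OF _ g p] in auto)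
qed

lemma d_parity_16':
  assumes m: "m = 16" and \<delta>: "\<delta> = 6" and c: "c \<in> C" and s: "s \<in> vectors m"
  shows "even (d (vadd c s)) \<longleftrightarrow> even (card s)"
proof -
  have "finite s" using s by simp
  then show ?thesis using s
  proof induction
    case empty
    then show ?case using d_le[OF c, of c] by simp
  next
    case (insert p s)
    have "vadd c (insert p s) = vadd (vadd c s) {p}" using insert(2) by auto
    then show ?case
      using d_parity_16(1)[OF m \<delta>, of "vadd c s" p] insert C_vectors[OF c] by auto
  qed
qed

lemma even_16:
  assumes m: "m = 16" and \<delta>: "\<delta> = 6" and "c \<in> C" "c' \<in> C"
  shows "even (hdist c c')"
proof -
  have "vadd c c' \<in> vectors m" using assms C_vectors by simp
  from d_parity_16'[OF m \<delta> assms(3) this] show ?thesis using d_le[OF assms(4), of c'] by (simp add: hdist_def)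
qed

text \<open>Weight 5 for a codeword at distance 1 and weight 1 for one at distance 3 give total 5
  around every vector of an odd class and 0 around the others. Half of all vectors lie in odd
  classes, so (5 * 16 + 560) * \<open>card C\<close> = 5 * 2^15.\<close>

lemma card_16:
  assumes m: "m = 16" and \<delta>: "\<delta> = 6"
  shows "card C = 256"
proof -
  obtain c where c: "c \<in> C" using nonempty by auto
  have ev: "dist_count C k g = 0" if g: "g \<in> vectors m" "even (d g) \<noteq> even k" for g k
  proof -
    have "hdist g b \<noteq> k" if b: "b \<in> C" for b
    proof -
      have bv: "b \<in> vectors m" using b C_vectors by blast
      have "even (d g) \<longleftrightarrow> even (hdist b g)"
        using d_parity_16'[OF m \<delta> b, of "vadd b g"] g bv by (simp add: hdist_def)
      then show ?thesis using g(2) by (auto simp: hdist_commute)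
    qed
    then have "{c \<in> C. hdist g c = k} = {}" by blast
    then show ?thesis unfolding dist_count_def by (simp only: card.empty)
  qed
  have "5 * dist_count C 1 g + dist_count C 3 g = 5 * of_bool (odd (d g))" if g: "g \<in> vectors m" for g
  proof (cases "odd (d g)")
    case True
    then have "d g = 1 \<or> d g = 3" using d_parity_16(2)[OF m \<delta> g, of 0] m by presburger
    then show ?thesis
    proof
      assume dg: "d g = 1"
      then show ?thesis
        using dist_count_unique[OF g] dist_count_zero[OF g, of 3] \<delta> by simp
    next
      assume dg: "d g = 3"
      then show ?thesis
        using outer_distribution_16(1)[OF m \<delta>] dist_count_eq_\<beta>[OF g] \<beta>_below[of 1 3] by simp
    qed
  next
    case False
    then show ?thesis using ev[OF g, of 1] ev[OF g, of 3] by simp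
  qed
  then have "(\<Sum>g\<in>vectors m. 5 * dist_count C 1 g + dist_count C 3 g) = (\<Sum>g\<in>vectors m. 5 * of_bool (odd (d g)))"
    by simp
  also have "\<dots> = 5 * card {g \<in> vectors m. odd (d g)}"
    by (simp add: Int_def flip: sum_distrib_left)
  also have "card {g \<in> vectors m. odd (d g)} = card {g \<in> vectors m. odd (card g)}"
  proof -
    have par: "even (d (vadd c s)) \<longleftrightarrow> even (card s)" if "s \<in> vectors m" for s
      using d_parity_16'[OF m \<delta> c that] by simp
    have par': "even (card (vadd c g)) \<longleftrightarrow> even (d g)" if "g \<in> vectors m" for g
      using par[of "vadd c g"] that C_vectors[OF c] by simp
    have "bij_betw (vadd c) {g \<in> vectors m. odd (card g)} {g \<in> vectors m. odd (d g)}"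
      by (rule bij_betw_byWitness[where f' = "vadd c"])
        (use C_vectors[OF c] in \<open>auto simp: par par' simp del: in_vadd\<close>)
    then show ?thesis by (simp add: bij_betw_same_card)
  qed
  also have "\<dots> = 2 ^ 15" using card_odd_vectors[of 15] m by simp
  finally have "5 * (16 choose 1) * card C + (16 choose 3) * card C = 5 * 2 ^ 15"
    using sum_wd[OF C] m by (simp add: sum.distrib flip: sum_distrib_left)
  moreover have "16 choose 3 = (560::nat)" by code_simp
  ultimately show ?thesis by simp
qed

section \<open>Length 15: parameters and size\<close>

lemma outer_distribution_15:
  assumes m: "m = 15" and \<delta>: "\<delta> = 5"
  shows "\<beta> 2 3 = 4" "\<beta> 3 3 = 5" "g \<in> vectors m \<Longrightarrow> d g \<le> 3"
proof -
  have near: "i * \<beta> a l + r * \<beta> h l = n * \<beta> i n + s * \<beta> i k"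
    if "i \<le> 1" "h = i + 1" "l = k + 1" "n = k + 2" "a = i - 1" "r = 15 - i" "s = 15 - k" for i h l k n a r s
    using \<beta>_recursion_near[OF _ _ that(2-4)] that(1) that(5-7) m \<delta> by simp
  have rec: "neighbours g a * \<beta> a l + neighbours g i * \<beta> i l + neighbours g b * \<beta> b l
         = n * \<beta> i n + r * \<beta> i k"
    if "g \<in> vectors m" "d g = i" "i = a + 1" "b = i + 1" "l = k + 1" "n = k + 2" "r = 15 - k" for g i a b l k n r
    using \<beta>_recursion3[OF that(1-6)] that(7) m by simp
  obtain g2 where g2: "g2 \<in> vectors m" "d g2 = 2" using class_nonempty[of 2] m \<delta> by auto
  obtain g1 where g1: "g1 \<in> vectors m" "d g1 = 1" using class_nonempty[of 1] m \<delta> by auto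
  have b22: "\<beta> 2 2 = 1" using \<beta>_unique[OF g2] \<delta> by simp
  have b11: "\<beta> 1 1 = 1" using \<beta>_unique[OF g1] \<delta> by simp
  define L where "L = \<beta> 2 3"
  define M where "M = \<beta> 3 3"
  have z03: "\<beta> 0 3 = 0" by (rule \<beta>_zero) (simp_all add: \<delta>)
  have z04: "\<beta> 0 4 = 0" by (rule \<beta>_zero) (simp_all add: \<delta>)
  have z12: "\<beta> 1 2 = 0" by (rule \<beta>_zero) (simp_all add: \<delta>)
  have z13: "\<beta> 1 3 = 0" by (rule \<beta>_zero) (simp_all add: \<delta>)
  have z20: "\<beta> 2 0 = 0" by (rule \<beta>_below) simp
  have z21: "\<beta> 2 1 = 0" by (rule \<beta>_below) simp
  have z31: "\<beta> 3 1 = 0" by (rule \<beta>_below) simp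
  have z32: "\<beta> 3 2 = 0" by (rule \<beta>_below) simp
  have z43: "\<beta> 4 3 = 0" by (rule \<beta>_below) simp
  \<comment> \<open>Class 2 is beyond the reach of \<open>neighbours_near_count\<close>, because 2 *
    2 + 2 exceeds 5. Its neighbour counts are read off the recursions with \<open>k = 0\<close> and
    \<open>k = 1\<close>.\<close>
  have r1: "neighbours g2 1 * \<beta> 1 1 + neighbours g2 2 * \<beta> 2 1 + neighbours g2 3 * \<beta> 3 1
      = 2 * \<beta> 2 2 + 15 * \<beta> 2 0"
    by (rule rec) (use g2 in simp_all)
  have r2: "neighbours g2 1 * \<beta> 1 2 + neighbours g2 2 * \<beta> 2 2 + neighbours g2 3 * \<beta> 3 2
      = 3 * \<beta> 2 3 + 14 * \<beta> 2 1"
    by (rule rec) (use g2 in simp_all)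
  have r3: "neighbours g2 1 * \<beta> 1 3 + neighbours g2 2 * \<beta> 2 3 + neighbours g2 3 * \<beta> 3 3
      = 4 * \<beta> 2 4 + 13 * \<beta> 2 2"
    by (rule rec) (use g2 in simp_all)
  have r4: "neighbours g2 1 * \<beta> 1 4 + neighbours g2 2 * \<beta> 2 4 + neighbours g2 3 * \<beta> 3 4
      = 5 * \<beta> 2 5 + 12 * \<beta> 2 3"
    by (rule rec) (use g2 in simp_all)
  have n21: "neighbours g2 1 = 2" using r1[unfolded b11 z21 z31 z20 b22] by simp
  have n22: "neighbours g2 2 = 3 * L" using r2[unfolded z12 z32 z21 b22] by (simp add: L_def)
  have n23: "neighbours g2 3 = 13 - 3 * L" "3 * L \<le> 13"
    using neighbours_total3[OF g2, of 1 3] n21 n22 m by simp_all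
  have e1: "0 * \<beta> 0 4 + 15 * \<beta> 1 4 = 5 * \<beta> 0 5 + 12 * \<beta> 0 3"
    by (rule near) simp_all
  have e2: "1 * \<beta> 0 3 + 14 * \<beta> 2 3 = 4 * \<beta> 1 4 + 13 * \<beta> 1 2"
    by (rule near) simp_all
  have e3: "1 * \<beta> 0 4 + 14 * \<beta> 2 4 = 5 * \<beta> 1 5 + 12 * \<beta> 1 3"
    by (rule near) simp_all
  have b05: "0 < \<beta> 0 5" using \<beta>_\<delta>_pos \<delta> by simp
  have L24: "L = 2 \<or> L = 4" 
  proof -
    have "2 * \<beta> 1 4 = 7 * L" "0 < \<beta> 1 4" using e1 e2[folded L_def] z03 z12 b05 by linarith+
    then have "even L" "0 < L" by presburger+
    then show ?thesis using n23(2) by presburger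
  qed
  \<comment> \<open>The count 13 - 3 * \<open>L\<close> is 7 or 1, so class 3 is nonempty.\<close>
  have "neighbours g2 3 \<noteq> 0" using n23 L24 by auto
  then obtain p where p: "p < m" "d (vadd g2 {p}) = 3" unfolding neighbours_eq_0 by blast
  obtain g3 where g3: "g3 \<in> vectors m" "d g3 = 3"
    by (rule that[of "vadd g2 {p}"]) (use p g2 in auto)
  have n32: "neighbours g 2 = 3 * M" if "g \<in> vectors m" "d g = 3" for g
    using neighbours_3_2[OF that] m \<delta> by (simp add: M_def)
  have n33: "3 * M + neighbours g 3 + neighbours g 4 = 15" if "g \<in> vectors m" "d g = 3" for g
    using neighbours_total3[OF that, of 2 4] n32[OF that] m by simp
  have r6: "neighbours g3 2 * \<beta> 2 3 + neighbours g3 3 * \<beta> 3 3 + neighbours g3 4 * \<beta> 4 3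
      = 4 * \<beta> 3 4 + 13 * \<beta> 3 2"
    by (rule rec) (use g3 in simp_all)
  have e4: "3 * L * L + (13 - 3 * L) * M = 4 * \<beta> 2 4 + 13"
    using r3[unfolded n21 n22 n23 z13 b22] by (simp add: L_def M_def)
  have e5: "2 * \<beta> 1 4 + 3 * L * \<beta> 2 4 + (13 - 3 * L) * \<beta> 3 4 = 5 * \<beta> 2 5 + 12 * L"
    using r4[unfolded n21 n22 n23] by (simp add: L_def)
  have e6: "3 * M * L + neighbours g3 3 * M = 4 * \<beta> 3 4"
    using r6[unfolded n32[OF g3] z43 z32] by (simp add: L_def M_def)
  have M: "M = 1 \<or> M = 2 \<or> M = 3 \<or> M = 4 \<or> M = 5 \<or> M = 0" using n33[OF g3] by linarith
  have b14: "2 * \<beta> 1 4 = 7 * L" using e1 e2[folded L_def] z03 z12 by linarith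
  \<comment> \<open>\<open>L = 2\<close> forces \<open>M = 3\<close>. Then the recursion at
    \<open>g3\<close> leaves only 6 and 9 for \<open>\<beta> 3 4\<close>, while 20 + 7 *
    \<open>\<beta> 3 4\<close> has to be a multiple of 5.\<close>
  have "L \<noteq> 2"
  proof
    assume L: "L = 2"
    have "7 * M = 4 * \<beta> 2 4 + 1" using e4[unfolded L] by simp
    then have M: "M = 3" and "\<beta> 2 4 = 5" using M by presburger+
    then have *: "18 + 3 * neighbours g3 3 = 4 * \<beta> 3 4" "20 + 7 * \<beta> 3 4 = 5 * \<beta> 2 5"
      using e5[unfolded L] e6[unfolded L] b14[unfolded L] by simp_all
    have "neighbours g3 3 \<le> 6" using n33[OF g3] M by simp
    with *(1) have "\<beta> 3 4 = 6 \<or> \<beta> 3 4 = 9" by presburger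
    with *(2) show False by presburger
  qed
  then have L: "L = 4" using L24 by simp
  have "48 + M = 4 * \<beta> 2 4 + 13" using e4[unfolded L] by simp
  with M have M15: "M = 5 \<or> M = 1 \<and> \<beta> 2 4 = 9" by presburger
  \<comment> \<open>\<open>M = 1\<close> would need a value of \<open>\<beta> 3 4\<close> between 3
    and 6 for which 88 + \<open>\<beta> 3 4\<close> is a multiple of 5.\<close>
  have "M = 5"
  proof (rule ccontr)
    assume "M \<noteq> 5"
    then have M: "M = 1" "\<beta> 2 4 = 9" using M15 by auto
    have *: "12 + neighbours g3 3 = 4 * \<beta> 3 4" "88 + \<beta> 3 4 = 5 * \<beta> 2 5"
      using e5[unfolded L M] e6[unfolded L M] b14[unfolded L] by simp_all
    have "neighbours g3 3 \<le> 12" using n33[OF g3] M by simp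
    then have "3 \<le> \<beta> 3 4" "\<beta> 3 4 \<le> 6" using *(1) by linarith+
    with *(2) show False by presburger
  qed
  with L show "\<beta> 2 3 = 4" "\<beta> 3 3 = 5" by (simp_all add: L_def M_def)
  show "d g \<le> 3" if gv: "g \<in> vectors m"
  proof (rule ccontr)
    assume "\<not> d g \<le> 3"
    then have "4 \<le> d g" by simp
    then obtain h where h: "h \<in> vectors m" "d h = 4" using d_intermediate[OF gv] by blast
    then obtain q where q: "q < m" "d (vadd h {q}) = 3" using d_descend[of h 3] by auto
    \<comment> \<open>From class 3 all 3 * 5 = 15 directions lead down to class 2, so none is left
      for class 4.\<close>
    then have "neighbours (vadd h {q}) 4 = 0" using n33[of "vadd h {q}"] h \<open>M = 5\<close> by simp
    then show False using q h by (auto simp: neighbours_eq_0)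
  qed
qed

text \<open>These are the weights of length 16 seen through the parity extension: extending
  \<open>g\<close> to odd weight and the codewords to even weight relative to it turns distances 0
  and 1 into 1, and 2 and 3 into 3. The total is again 5 * (1 + 15) + 105 + 455 = 640.\<close>

lemma card_15:
  assumes m: "m = 15" and \<delta>: "\<delta> = 5"
  shows "card C = 256"
proof -
  have "5 * (dist_count C 0 g + dist_count C 1 g) + dist_count C 2 g + dist_count C 3 g = 5" if g: "g \<in> vectors m" for g
  proof -
    have "d g = 0 \<or> d g = 1 \<or> d g = 2 \<or> d g = 3" using outer_distribution_15(3)[OF m \<delta> g] by linarith
    moreover have "dist_count C 3 g = 4" if "d g = 2" using that outer_distribution_15(1)[OF m \<delta>] dist_count_eq_\<beta>[OF g] by simp
    moreover have "dist_count C 3 g = 5" if "d g = 3" using that outer_distribution_15(2)[OF m \<delta>] dist_count_eq_\<beta>[OF g] by simp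
    ultimately show ?thesis
      using dist_count_unique[OF g] dist_count_zero[OF g, of 0] dist_count_zero[OF g, of 1] dist_count_zero[OF g, of 2] dist_count_zero[OF g, of 3]
        dist_count_below[of 0 g] dist_count_below[of 1 g] dist_count_below[of 2 g] \<delta> by (elim disjE) simp_all
  qed
  then have "(\<Sum>g\<in>vectors m. 5 * (dist_count C 0 g + dist_count C 1 g) + dist_count C 2 g + dist_count C 3 g) = 5 * 2 ^ 15"
    using card_vectors[of m] m by simp
  then have "5 * ((m choose 0) * card C + (m choose 1) * card C) + (m choose 2) * card C + (m choose 3) * card C = 5 * 2 ^ 15"
    unfolding sum.distrib sum_wd[OF C] sum_distrib_left[symmetric] .
  moreover have "15 choose 2 = (105::nat)" "15 choose 3 = (455::nat)" by code_simp+
  ultimately show ?thesis using m by simp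
qed

end

section \<open>Even (16,256,6) codes containing zero\<close>

locale nr_code =
  fixes D :: "nat set set"
  assumes D: "D \<subseteq> vectors 16" and zero: "{} \<in> D"
    and even_card: "x \<in> D \<Longrightarrow> even (card x)" and card_D: "card D = 256"
    and dist: "\<lbrakk>x \<in> D; y \<in> D; x \<noteq> y\<rbrakk> \<Longrightarrow> 6 \<le> hdist x y"

sublocale nr_code \<subseteq> distance_code 16 D 6
  using D zero dist by unfold_locales auto

context nr_code begin

lemma in_vectors: "x \<in> D \<Longrightarrow> x \<in> vectors 16"
  using D by blast

lemma finite_codeword: "x \<in> D \<Longrightarrow> finite x"
  using in_vectors finite_vector by blast

lemma translate:
  assumes c: "c \<in> D"
  shows "nr_code (vadd c ` D)"
proof
  show "vadd c ` D \<subseteq> vectors 16" using in_vectors c by auto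
  show "{} \<in> vadd c ` D" using c by (metis imageI vadd_self)
  show "card (vadd c ` D) = 256" using card_D by (simp add: card_image)
  show "even (card x)" if "x \<in> vadd c ` D" for x
    using that even_hdist[of c 16] even_card c in_vectors by (auto simp: hdist_def)
  show "6 \<le> hdist x y" if "x \<in> vadd c ` D" "y \<in> vadd c ` D" "x \<noteq> y" for x y
  proof -
    obtain x' y' where "x' \<in> D" "y' \<in> D" "x = vadd c x'" "y = vadd c y'" using \<open>x \<in> _\<close> \<open>y \<in> _\<close> by blast
    then show ?thesis using dist[of x' y'] \<open>x \<noteq> y\<close> by (auto simp only: hdist_vadd)
  qed
qed

lemma permute:
  assumes \<sigma>: "\<sigma> permutes {..<16}"
  shows "nr_code ((`) \<sigma> ` D)"
proof
  have inj: "inj \<sigma>" using \<sigma> by (rule permutes_inj)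
  have card: "card (\<sigma> ` x) = card x" for x using inj by (meson card_image inj_on_subset subset_UNIV)
  have hd: "hdist (\<sigma> ` x) (\<sigma> ` y) = hdist x y" for x y
    using inj by (simp add: hdist_def card flip: image_vadd)
  show "(`) \<sigma> ` D \<subseteq> vectors 16"
    using D permutes_image[OF \<sigma>] by (fastforce simp: vectors_def)
  show "{} \<in> (`) \<sigma> ` D" using zero by force
  show "card ((`) \<sigma> ` D) = 256"
    using card_D inj by (subst card_image) (auto simp: inj_on_def inj_image_eq_iff)
  show "even (card x)" if "x \<in> (`) \<sigma> ` D" for x
    using that even_card by (auto simp: card)
  show "6 \<le> hdist x y" if "x \<in> (`) \<sigma> ` D" "y \<in> (`) \<sigma> ` D" "x \<noteq> y" for x y
  proof -
    obtain x' y' where "x' \<in> D" "y' \<in> D" "x = \<sigma> ` x'" "y = \<sigma> ` y'" using \<open>x \<in> _\<close> \<open>y \<in> _\<close> by blast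
    then show ?thesis using dist[of x' y'] \<open>x \<noteq> y\<close> by (auto simp only: hd)
  qed
qed

lemma dist_count_2_le: "g \<in> vectors 16 \<Longrightarrow> dist_count D 2 g \<le> 1"
proof -
  assume g: "g \<in> vectors 16"
  consider "d g < 2" | "d g = 2" | "2 < d g" by linarith
  then show ?thesis
    by cases (use dist_count_unique[OF g] dist_count_zero[OF g, of 2] dist_count_below[of 2 g] in simp_all)
qed

text \<open>The inequality "at most 5" holds pointwise, and summation over all odd vectors gives equality.\<close>

lemma odd_vector:
  assumes g: "g \<in> vectors 16" and odd: "odd (card g)"
  shows "5 * dist_count D 1 g + dist_count D 3 g = 5"
proof -
  have le: "5 * dist_count D 1 g + dist_count D 3 g \<le> 5 * of_bool (odd (card g))" if g: "g \<in> vectors 16" for g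
  proof (cases "odd (card g)")
    case False
    have "hdist g c \<noteq> k" if "c \<in> D" "odd k" for c k
      using even_hdist[OF g in_vectors[OF that(1)]] even_card[OF that(1)] False that(2) by auto
    then have "{c \<in> D. hdist g c = 1} = {}" "{c \<in> D. hdist g c = 3} = {}" by auto
    then show ?thesis using False unfolding dist_count_def by (simp only: card.empty)
  next
    case True
    \<comment> \<open>Each of the 16 neighbours of \<open>g\<close> has at most one codeword at
      distance 2. Integrality then rounds 16 / 3 down to 5.\<close>
    have "(\<Sum>p<16. dist_count D (Suc 1) (vadd g {p})) = (1 + 2) * dist_count D (1 + 2) g + (16 - 1) * dist_count D 1 g"
      by (rule dist_count_neighbours[OF D g])
    also have "1 + 2 = (3::nat)" by simp
    also have "16 - 1 = (15::nat)" by simp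
    finally have "3 * dist_count D 3 g + 15 * dist_count D 1 g = (\<Sum>p<16. dist_count D (Suc 1) (vadd g {p}))" by (rule sym)
    also have "\<dots> \<le> (\<Sum>p<16::nat. 1)"
    proof (rule sum_mono)
      fix p :: nat assume "p \<in> {..<16}"
      then have "vadd g {p} \<in> vectors 16" using g by simp
      then show "dist_count D (Suc 1) (vadd g {p}) \<le> 1" using dist_count_2_le by (metis Suc_1)
    qed
    also have "\<dots> = 16" by (simp only: sum_constant card_lessThan mult_1_right of_nat_id)
    finally have "3 * dist_count D 3 g + 15 * dist_count D 1 g \<le> 16" .
    then show ?thesis using True by simp
  qed
  have "(\<Sum>g\<in>vectors 16. 5 * dist_count D 1 g + dist_count D 3 g) = 5 * 2 ^ 15"
  proof -
    have "(\<Sum>g\<in>vectors 16. 5 * dist_count D 1 g + dist_count D 3 g) = 5 * ((16 choose 1) * 256) + (16 choose 3) * 256"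
      unfolding sum.distrib sum_distrib_left[symmetric] sum_wd[OF D] card_D ..
    moreover have "16 choose 3 = (560::nat)" by code_simp
    ultimately show ?thesis by simp
  qed
  also have "\<dots> = (\<Sum>g\<in>vectors 16. 5 * of_bool (odd (card g)))"
    using card_odd_vectors[of 15] by (simp add: Int_def flip: sum_distrib_left)
  finally have "5 * dist_count D 1 g + dist_count D 3 g = 5 * of_bool (odd (card g))"
    by (rule sum_mono_inv[OF _ le g]) auto
  then show ?thesis using odd by simp
qed

lemma card_inter:
  assumes "x \<in> D" "y \<in> D" "x \<noteq> y"
  shows "2 * card (x \<inter> y) + 6 \<le> card x + card y"
  using card_vadd[of x y] dist[OF assms] finite_codeword assms by (simp add: hdist_def)

lemma card_ge_6: "x \<in> D \<Longrightarrow> x \<noteq> {} \<Longrightarrow> 6 \<le> card x"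
  using dist[OF zero, of x] by auto

lemma hdist_codeword:
  assumes "c \<in> D" "v \<in> vectors 16"
  shows "hdist v c + 2 * card (v \<inter> c) = card v + card c" "card (v \<inter> c) \<le> card v"
    "card (v \<inter> c) = card v \<longleftrightarrow> v \<subseteq> c"
proof -
  have fin: "finite v" using assms by simp
  show "hdist v c + 2 * card (v \<inter> c) = card v + card c"
    using card_vadd[of v c] assms finite_codeword fin by (simp add: hdist_def)
  show "card (v \<inter> c) \<le> card v" using fin by (simp add: card_mono)
  show "card (v \<inter> c) = card v \<longleftrightarrow> v \<subseteq> c"
  proof
    assume "card (v \<inter> c) = card v"
    then have "v \<inter> c = v" by (intro card_subset_eq[OF fin]) auto
    then show "v \<subseteq> c" by blast
  qed (simp add: Int_absorb2)
qed

section \<open>Words of weight 6 and quads\<close>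

definition sixes :: "nat set \<Rightarrow> nat set set" where
  "sixes t = {c \<in> D. card c = 6 \<and> t \<subseteq> c}"

lemma finite_sixes [simp]: "finite (sixes t)"
  using finite_C by (simp add: sixes_def)

text \<open>Being at distance at least 6, two words of weight 6 share at most three points.\<close>

lemma sixes_unique:
  assumes "c \<in> sixes w" "c' \<in> sixes w" "4 \<le> card w"
  shows "c = c'"
proof (rule ccontr)
  assume "c \<noteq> c'"
  then have "2 * card (c \<inter> c') + 6 \<le> 12" using card_inter[of c c'] assms by (auto simp: sixes_def)
  moreover have "card w \<le> card (c \<inter> c')"
    using assms finite_codeword by (intro card_mono) (auto simp: sixes_def)
  ultimately show False using assms(3) by simp
qed

text \<open>As \<open>t\<close> has distance 3 from the code, it has five codewords at distance 3.
  One of them is zero, and the others are the words of weight 6 containing \<open>t\<close>.\<close>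

lemma card_sixes:
  assumes t: "t \<in> vectors 16" "card t = 3"
  shows "card (sixes t) = 4"
proof -
  have dt: "d t = 3" using d_eq[OF t(1) zero] t(2) by simp
  have "dist_count D 3 t = 5" using odd_vector[OF t(1)] dist_count_below[of 1 t] t(2) dt by simp
  moreover have "{c \<in> D. hdist t c = 3} = insert {} (sixes t)"
  proof (rule set_eqI)
    fix c
    show "c \<in> {c \<in> D. hdist t c = 3} \<longleftrightarrow> c \<in> insert {} (sixes t)"
    proof (cases "c \<in> D \<and> c \<noteq> {}")
      case True
      then have "6 \<le> card c" by (simp add: card_ge_6)
      then have "hdist t c = 3 \<longleftrightarrow> card c = 6 \<and> card (t \<inter> c) = card t"
        using hdist_codeword[of c t] True t by auto
      then show ?thesis using True hdist_codeword(3)[of c t] t by (auto simp: sixes_def)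
    next
      case False
      then show ?thesis using zero t by (auto simp: sixes_def)
    qed
  qed
  moreover have "{} \<notin> sixes t" by (simp add: sixes_def)
  ultimately show ?thesis by (simp add: dist_count_def)
qed

definition quads :: "nat set set" where
  "quads = {q \<in> vectors 16. card q = 4 \<and> sixes q = {}}"

lemma quads_finite: "q \<in> quads \<Longrightarrow> finite q"
  by (auto simp: quads_def)

text \<open>The four words of weight 6 through \<open>t\<close> meet pairwise in \<open>t\<close>
  only, so they cover 12 of the 13 points outside \<open>t\<close>. The uncovered point is the one
  that completes \<open>t\<close> to a quad.\<close>

lemma fourth_ex1:
  assumes t: "t \<in> vectors 16" "card t = 3"
  shows "\<exists>!x. x \<notin> t \<and> insert x t \<in> quads"
proof -
  define U where "U = (\<Union>c\<in>sixes t. c - t)"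
  have ft: "finite t" using t by simp
  have "card U = (\<Sum>c\<in>sixes t. card (c - t))"
    unfolding U_def
  proof (rule card_UN_disjoint)
    show "\<forall>c\<in>sixes t. finite (c - t)" using finite_codeword by (auto simp: sixes_def)
    show "\<forall>c\<in>sixes t. \<forall>c'\<in>sixes t. c \<noteq> c' \<longrightarrow> (c - t) \<inter> (c' - t) = {}"
    proof (intro ballI impI)
      fix c c' assume c: "c \<in> sixes t" "c' \<in> sixes t" "c \<noteq> c'"
      have "x \<notin> (c - t) \<inter> (c' - t)" for x
      proof
        assume x: "x \<in> (c - t) \<inter> (c' - t)"
        then have "c \<in> sixes (insert x t)" "c' \<in> sixes (insert x t)" using c by (auto simp: sixes_def)
        moreover have "4 \<le> card (insert x t)" using x ft t by simp
        ultimately show False using sixes_unique c by blast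
      qed
      then show "(c - t) \<inter> (c' - t) = {}" by blast
    qed
  qed simp
  also have "\<dots> = (\<Sum>c\<in>sixes t. 3)"
    by (intro sum.cong refl) (use t ft in \<open>auto simp: sixes_def card_Diff_subset\<close>)
  also have "\<dots> = 12" using card_sixes[OF t] by simp
  finally have cU: "card U = 12" .
  have U: "U \<subseteq> {..<16} - t"
    using in_vectors by (fastforce simp: U_def sixes_def vectors_def)
  have "card ({..<16} - t - U) = 1"
    using U cU t ft by (simp add: card_Diff_subset finite_subset[OF U] vectors_iff)
  then obtain x where x: "{..<16} - t - U = {x}" by (rule card_1_singletonE)
  have "y \<notin> t \<and> insert y t \<in> quads \<longleftrightarrow> y \<in> {..<16} - t - U" for y
    using t ft by (auto simp: quads_def U_def sixes_def)
  then show ?thesis unfolding x by auto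
qed

definition fourth :: "nat set \<Rightarrow> nat" where
  "fourth t = (THE x. x \<notin> t \<and> insert x t \<in> quads)"

lemma fourth:
  assumes t: "t \<in> vectors 16" "card t = 3"
  shows "fourth t \<notin> t" "insert (fourth t) t \<in> quads" "fourth t < 16"
    "x \<notin> t \<Longrightarrow> insert x t \<in> quads \<Longrightarrow> fourth t = x"
proof -
  show *: "fourth t \<notin> t" "insert (fourth t) t \<in> quads"
    using theI'[OF fourth_ex1[OF t]] by (simp_all add: fourth_def)
  show "fourth t < 16" using *(2) by (simp add: quads_def)
  show "x \<notin> t \<Longrightarrow> insert x t \<in> quads \<Longrightarrow> fourth t = x"
    using fourth_ex1[OF t] * by blast
qed

lemma quad_fourth:
  assumes "q \<in> quads" "t \<subseteq> q" "card t = 3"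
  shows "q = insert (fourth t) t" "t \<in> vectors 16"
proof -
  have q: "q \<in> vectors 16" "card q = 4" "finite q" using assms(1) quads_finite[OF assms(1)] by (simp_all add: quads_def)
  show t: "t \<in> vectors 16" using assms(2) q(1) by (auto simp: vectors_def)
  have "card (q - t) = 1" using assms q by (simp add: card_Diff_subset finite_subset)
  then obtain x where x: "q - t = {x}" by (rule card_1_singletonE)
  then have "q = insert x t" "x \<notin> t" using assms(2) by auto
  then show "q = insert (fourth t) t" using fourth(4)[OF t assms(3)] assms(1) by auto
qed

section \<open>Words of weight 8\<close>

definition eights :: "nat set set" where
  "eights = {b \<in> D. card b = 8}"

lemma eights_finite: "b \<in> eights \<Longrightarrow> finite b"
  using finite_codeword by (simp add: eights_def)

text \<open>The 5-set \<open>v\<close> has no codeword at distance 1, hence five at distance 3.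
  Those of weight 6 meet \<open>v\<close> in distinct 4-sets other than \<open>q\<close>; there are
  only four such sets, so one of the five codewords has weight 8.\<close>

lemma quad_insert_eight:
  assumes q: "q \<in> quads" and p: "p < 16" "p \<notin> q"
  obtains b where "b \<in> eights" "insert p q \<subseteq> b"
proof -
  define v where "v = insert p q"
  have v: "v \<in> vectors 16" "card v = 5" "finite v" "q \<subseteq> v"
    using q p quads_finite[OF q] by (auto simp: v_def quads_def)
  have not_sub: "\<not> v \<subseteq> c" if "c \<in> D" "card c = 6" for c
    using that q v by (auto simp: quads_def sixes_def)
  have "hdist v c \<noteq> 1" if c: "c \<in> D" for c
  proof
    assume "hdist v c = 1"
    then have *: "1 + 2 * card (v \<inter> c) = 5 + card c" using hdist_codeword(1)[OF c v(1)] v(2) by simp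
    then have "c \<noteq> {}" by auto
    then have "card c = 6" "card (v \<inter> c) = 5"
      using * card_ge_6[OF c] hdist_codeword(2)[OF c v(1)] v(2) by auto
    then show False using not_sub[OF c] hdist_codeword(3)[OF c v(1)] v(2) by auto
  qed
  then have "{c \<in> D. hdist v c = 1} = {}" by blast
  then have "dist_count D 1 v = 0" unfolding dist_count_def by (simp only: card.empty)
  then have five: "card {c \<in> D. hdist v c = 3} = 5"
    using odd_vector[OF v(1)] v(2) by (simp add: dist_count_def)
  let ?F = "{w. w \<subseteq> v \<and> card w = 4} - {q}"
  have cF: "finite ?F" "card ?F = 4"
    using n_subsets[OF v(3), of 4] v q by (auto simp: quads_def binomial_eq_0 numeral_eq_Suc)
  have "\<exists>b\<in>D. hdist v b = 3 \<and> card b = 8"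
  proof (rule ccontr)
    assume no8: "\<not> ?thesis"
    have c6: "card c = 6 \<and> card (v \<inter> c) = 4" if c: "c \<in> D" "hdist v c = 3" for c
    proof -
      have *: "3 + 2 * card (v \<inter> c) = 5 + card c" using hdist_codeword(1)[OF c(1) v(1)] c v(2) by simp
      then have "c \<noteq> {}" by auto
      then show ?thesis
        using * card_ge_6[OF c(1)] hdist_codeword(2)[OF c(1) v(1)] v(2) no8 c even_card[OF c(1)] by fastforce
    qed
    have "inj_on (\<lambda>c. v \<inter> c) {c \<in> D. hdist v c = 3}"
    proof (rule inj_onI)
      fix c c' assume c: "c \<in> {c \<in> D. hdist v c = 3}" "c' \<in> {c \<in> D. hdist v c = 3}" "v \<inter> c = v \<inter> c'"
      then have "c \<in> sixes (v \<inter> c)" "c' \<in> sixes (v \<inter> c)" using c6 by (auto simp: sixes_def)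
      then show "c = c'" using sixes_unique c6 c(1) by auto
    qed
    moreover have "(\<lambda>c. v \<inter> c) ` {c \<in> D. hdist v c = 3} \<subseteq> ?F"
      using c6 q by (auto simp: quads_def sixes_def)
    ultimately have "card {c \<in> D. hdist v c = 3} \<le> card ?F" using cF(1) by (meson card_inj_on_le)
    then show False using five cF by simp
  qed
  then obtain b where b: "b \<in> D" "hdist v b = 3" "card b = 8" by blast
  then have "card (v \<inter> b) = card v" using hdist_codeword(1)[OF b(1) v(1)] v(2) by simp
  then have "v \<subseteq> b" using hdist_codeword(3)[OF b(1) v(1)] by simp
  then show thesis using that[of b] b by (simp add: eights_def v_def)
qed

text \<open>Otherwise the five 4-subsets of \<open>v\<close> lie in five different words of weight
  6, which together with \<open>b\<close> make six codewords at distance 3 from \<open>v\<close>,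
  one too many.\<close>

lemma quad_in_eight:
  assumes b: "b \<in> eights" and v: "v \<subseteq> b" "card v = 5"
  obtains q where "q \<in> quads" "q \<subseteq> v"
proof (rule ccontr)
  assume "\<not> thesis"
  then have noq: "q \<notin> quads" if "q \<subseteq> v" for q using that \<open>\<And>q. \<lbrakk>q \<in> quads; q \<subseteq> v\<rbrakk> \<Longrightarrow> thesis\<close> by blast
  have bD: "b \<in> D" "card b = 8" using b by (auto simp: eights_def)
  have vv: "v \<in> vectors 16" using v in_vectors[OF bD(1)] by (auto simp: vectors_def)
  then have fv: "finite v" by simp
  have "v \<inter> b = v" using v by blast
  then have hb: "hdist v b = 3" using hdist_codeword(1)[OF bD(1) vv] bD v by simp
  let ?S = "{c \<in> D. hdist v c = 3}"
  have fS: "finite ?S" using finite_C by simp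
  have "0 < dist_count D 3 v" unfolding dist_count_def using hb bD fS by (auto simp: card_gt_0_iff)
  then have "dist_count D 1 v = 0" "dist_count D 3 v = 5"
    using odd_vector[OF vv] v(2) by simp_all presburger+
  then have w: "dist_count D 1 v = 0" "card ?S = 5" by (simp_all add: dist_count_def)
  have no1: "hdist v c \<noteq> 1" if "c \<in> D" for c
    using w(1) that finite_C by (auto simp: dist_count_def)
  have "\<exists>c. c \<in> sixes w" if "w \<subseteq> v" "card w = 4" for w
    using noq[OF that(1)] that vv by (auto simp: quads_def vectors_def)
  then obtain c where c: "\<And>w. w \<subseteq> v \<Longrightarrow> card w = 4 \<Longrightarrow> c w \<in> sixes w" by metis
  let ?F = "{w. w \<subseteq> v \<and> card w = 4}"
  have int: "v \<inter> c w = w" "hdist v (c w) = 3" "c w \<in> D" "card (c w) = 6" if "w \<in> ?F" for w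
  proof -
    have cw: "c w \<in> D" "card (c w) = 6" "w \<subseteq> c w" using c that by (auto simp: sixes_def)
    have "card w \<le> card (v \<inter> c w)" using that cw fv by (intro card_mono) auto
    moreover have "card (v \<inter> c w) \<noteq> 5" using hdist_codeword(1)[OF cw(1) vv] no1[OF cw(1)] cw v(2) by auto
    ultimately have 4: "card (v \<inter> c w) = 4" using hdist_codeword(2)[OF cw(1) vv] v(2) that by auto
    then show "hdist v (c w) = 3" using hdist_codeword(1)[OF cw(1) vv] cw v(2) by auto
    show "v \<inter> c w = w" using 4 that cw fv by (intro card_subset_eq[symmetric]) auto
    show "c w \<in> D" "card (c w) = 6" using cw by auto
  qed
  have "inj_on c ?F" by (rule inj_onI) (metis int(1))
  then have "card (c ` ?F) = 5" using n_subsets[OF fv, of 4] v(2) by (simp add: card_image numeral_eq_Suc)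
  moreover have "b \<notin> c ` ?F" using int(4) bD(2) by force
  moreover have "finite (c ` ?F)" using fv by simp
  ultimately have "card (insert b (c ` ?F)) = 6" by simp
  moreover have "insert b (c ` ?F) \<subseteq> ?S" using int(2,3) bD(1) hb by blast
  ultimately show False using w(2) card_mono[OF fS, of "insert b (c ` ?F)"] by simp
qed

end

lemma even_inter_vadd:
  assumes "finite q"
  shows "even (card (q \<inter> vadd x y)) \<longleftrightarrow> (even (card (q \<inter> x)) \<longleftrightarrow> even (card (q \<inter> y)))"
proof -
  have "q \<inter> vadd x y = vadd (q \<inter> x) (q \<inter> y)" by auto
  moreover have "card (vadd (q \<inter> x) (q \<inter> y)) + 2 * card ((q \<inter> x) \<inter> (q \<inter> y)) = card (q \<inter> x) + card (q \<inter> y)"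
    using assms by (intro card_vadd) auto
  ultimately show ?thesis by presburger
qed

lemma compl_eq_vadd: "y \<in> vectors m \<Longrightarrow> vadd {..<m} y = {..<m} - y"
  by (auto simp: vectors_def vadd_def)

lemma card_inter_four:
  assumes "w \<noteq> x" "w \<noteq> u" "w \<noteq> v" "x \<noteq> u" "x \<noteq> v" "u \<noteq> v"
  shows "card ({w, x, u, v} \<inter> y) = of_bool (w \<in> y) + of_bool (x \<in> y) + of_bool (u \<in> y) + of_bool (v \<in> y)"
  using assms by (simp add: Int_insert_left)

lemma card_supersets_within:
  assumes "finite b" "q \<subseteq> b"
  shows "card {v. q \<subseteq> v \<and> v \<subseteq> b \<and> card v = Suc (card q)} = card b - card q"
proof -
  have fq: "finite q" using assms by (rule finite_subset[rotated])
  have "{v. q \<subseteq> v \<and> v \<subseteq> b \<and> card v = Suc (card q)} = (\<lambda>x. insert x q) ` (b - q)"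
  proof (rule set_eqI, rule iffI)
    fix v assume "v \<in> {v. q \<subseteq> v \<and> v \<subseteq> b \<and> card v = Suc (card q)}"
    then have v: "q \<subseteq> v" "v \<subseteq> b" "card v = Suc (card q)" by auto
    have "card (v - q) = 1" using v fq by (simp add: card_Diff_subset)
    then obtain x where "v - q = {x}" by (rule card_1_singletonE)
    then have "v = insert x q" "x \<in> b - q" using v by auto
    then show "v \<in> (\<lambda>x. insert x q) ` (b - q)" by blast
  next
    fix v assume "v \<in> (\<lambda>x. insert x q) ` (b - q)"
    then show "v \<in> {v. q \<subseteq> v \<and> v \<subseteq> b \<and> card v = Suc (card q)}" using assms fq by auto
  qed
  moreover have "inj_on (\<lambda>x. insert x q) (b - q)" by (rule inj_onI) blast
  ultimately show ?thesis using assms fq by (simp add: card_image card_Diff_subset)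
qed

context nr_code begin

text \<open>Every 5-subset of a word b of weight 8 contains a quad, so b contains at least 56/4 quads; each
  of the 56 triples in b lies in at most one of them, hence in exactly one.\<close>

lemma fourth_in_eight:
  assumes b: "b \<in> eights" and t: "t \<subseteq> b" "card t = 3"
  shows "fourth t \<in> b"
proof -
  have bD: "b \<in> D" "card b = 8" "finite b" using b eights_finite[OF b] by (simp_all add: eights_def)
  have sub: "w \<in> vectors 16" if "w \<subseteq> b" for w
    using that in_vectors[OF bD(1)] by (auto simp: vectors_def)
  define Q where "Q = {q \<in> quads. q \<subseteq> b}"
  define F where "F = {v. v \<subseteq> b \<and> card v = 5}"
  define T where "T = {t. t \<subseteq> b \<and> card t = 3}"
  have fin: "finite Q" "finite F" "finite T"
    using bD(3) by (auto simp: Q_def F_def T_def intro: finite_subset[of _ "Pow b"])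
  have choose: "8 choose 5 = (56::nat)" "8 choose 3 = (56::nat)" "4 choose 3 = (4::nat)" by code_simp+
  have cF: "card F = 56" "card T = 56"
    unfolding F_def T_def using n_subsets[OF bD(3)] bD(2) choose by simp_all
  have q4: "card q = 4" "q \<subseteq> b" "finite q" if "q \<in> Q" for q
    using that bD(3) by (auto simp: Q_def quads_def dest: finite_subset)
  have "(\<Sum>v\<in>F. card {q \<in> Q. q \<subseteq> v}) = 4 * card Q"
  proof (rule sum_multicount[OF fin(2,1)], rule ballI)
    fix q assume q: "q \<in> Q"
    have "{v \<in> F. q \<subseteq> v} = {v. q \<subseteq> v \<and> v \<subseteq> b \<and> card v = Suc (card q)}"
      using q4[OF q] by (auto simp: F_def)
    then show "card {v \<in> F. q \<subseteq> v} = 4" using card_supersets_within[OF bD(3) q4(2)[OF q]] q4[OF q] bD(2) by simp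
  qed
  moreover have "(\<Sum>v\<in>F. card {q \<in> Q. q \<subseteq> v}) \<ge> (\<Sum>v\<in>F. 1)"
  proof (rule sum_mono)
    fix v assume "v \<in> F"
    then obtain q where "q \<in> quads" "q \<subseteq> v" "v \<subseteq> b" using quad_in_eight[OF b] by (auto simp: F_def)
    then have "{q \<in> Q. q \<subseteq> v} \<noteq> {}" by (auto simp: Q_def)
    moreover have "finite {q \<in> Q. q \<subseteq> v}" using fin(1) by simp
    ultimately show "1 \<le> card {q \<in> Q. q \<subseteq> v}" by (metis One_nat_def Suc_leI card_gt_0_iff)
  qed
  ultimately have lower: "56 \<le> 4 * card Q" using cF by simp
  have le1: "card {q \<in> Q. t \<subseteq> q} \<le> 1" if "t \<in> T" for t
  proof -
    have "{q \<in> Q. t \<subseteq> q} \<subseteq> {insert (fourth t) t}"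
      using quad_fourth that by (auto simp: Q_def T_def)
    then show ?thesis using card_mono[of "{insert (fourth t) t}"] by simp
  qed
  have upper: "(\<Sum>t\<in>T. card {q \<in> Q. t \<subseteq> q}) = 4 * card Q"
  proof (rule sum_multicount[OF fin(3,1)], rule ballI)
    fix q assume q: "q \<in> Q"
    have "{t \<in> T. t \<subseteq> q} = {t. t \<subseteq> q \<and> card t = 3}"
      using q4[OF q] by (auto simp: T_def)
    then show "card {t \<in> T. t \<subseteq> q} = 4" using n_subsets[OF q4(3)[OF q]] q4[OF q] choose by simp
  qed
  have "(\<Sum>t\<in>T. card {q \<in> Q. t \<subseteq> q}) \<le> (\<Sum>t\<in>T. 1)" using le1 by (rule sum_mono)
  then have "(\<Sum>t\<in>T. card {q \<in> Q. t \<subseteq> q}) = (\<Sum>t\<in>T. 1)" using upper lower cF(2) by simp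
  then have "card {q \<in> Q. t \<subseteq> q} = 1"
    by (rule sum_mono_inv[OF _ le1]) (use t fin(3) in \<open>auto simp: T_def\<close>)
  then obtain q where "{q \<in> Q. t \<subseteq> q} = {q}" by (rule card_1_singletonE)
  then have "q \<in> quads" "q \<subseteq> b" "t \<subseteq> q" by (auto simp: Q_def)
  then show ?thesis using quad_fourth(1)[of q t] t(2) by auto
qed

section \<open>The Reed-Muller subcode\<close>

text \<open>As a dual, \<open>R\<close> is closed under addition at once; that it lies in
  \<open>D\<close> is what has to be proved.\<close>

definition R :: "nat set set" where
  "R = {y \<in> vectors 16. \<forall>q\<in>quads. even (card (q \<inter> y))}"

lemma R_vectors: "y \<in> R \<Longrightarrow> y \<in> vectors 16"
  by (simp add: R_def)

lemma R_vadd: "x \<in> R \<Longrightarrow> y \<in> R \<Longrightarrow> vadd x y \<in> R"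
  unfolding R_def by (auto simp: even_inter_vadd[OF quads_finite] simp del: in_vadd)

lemma full_in_R: "{..<16} \<in> R"
proof -
  have "q \<inter> {..<16} = q" "card q = 4" if "q \<in> quads" for q
    using that by (auto simp: quads_def vectors_def)
  then show ?thesis by (simp add: R_def vectors_def)
qed

lemma fourth_pair:
  assumes "a < 16" "p < 16" "a \<noteq> p" and x: "x < 16" "x \<noteq> a" "x \<noteq> p"
  shows "fourth {a, p, x} < 16" "fourth {a, p, x} \<noteq> a" "fourth {a, p, x} \<noteq> p" "fourth {a, p, x} \<noteq> x"
    "{a, p, x, fourth {a, p, x}} \<in> quads" "fourth {a, p, fourth {a, p, x}} = x"
proof -
  have t: "{a, p, x} \<in> vectors 16" "card {a, p, x} = 3" using assms by auto
  note f = fourth[OF t]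
  show *: "fourth {a, p, x} < 16" "fourth {a, p, x} \<noteq> a" "fourth {a, p, x} \<noteq> p" "fourth {a, p, x} \<noteq> x"
    using f(1,3) by auto
  show q: "{a, p, x, fourth {a, p, x}} \<in> quads" using f(2) by (simp add: insert_commute)
  have t': "{a, p, fourth {a, p, x}} \<in> vectors 16" "card {a, p, fourth {a, p, x}} = 3"
    using assms * by auto
  show "fourth {a, p, fourth {a, p, x}} = x"
    by (rule fourth(4)[OF t']) (use q * x in \<open>auto simp: insert_commute\<close>)
qed

text \<open>For a in y and p outside y, the map sending x to the fourth point of the quad through a, p, x
  exchanges y - {a} and the complement of y with p removed.\<close>

lemma R_card:
  assumes y: "y \<in> R" "y \<noteq> {}" "y \<noteq> {..<16}"
  shows "card y = 8"
proof -
  have yv: "y \<subseteq> {..<16}" using R_vectors[OF y(1)] by (simp add: vectors_def)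
  then have fy: "finite y" by (rule finite_subset) simp
  obtain a where a: "a \<in> y" using y(2) by blast
  obtain p where p: "p < 16" "p \<notin> y" using y(3) yv by auto
  have a16: "a < 16" "a \<noteq> p" using a p yv by auto
  let ?f = "\<lambda>x. fourth {a, p, x}"
  have swap: "x \<in> y \<longleftrightarrow> ?f x \<notin> y" if "x < 16" "x \<noteq> a" "x \<noteq> p" for x
  proof -
    note f = fourth_pair[OF a16(1) p(1) a16(2) that]
    have "even (card ({a, p, x, ?f x} \<inter> y))" using y(1) f(5) by (simp add: R_def)
    moreover have "card ({a, p, x, ?f x} \<inter> y)
        = of_bool (a \<in> y) + of_bool (p \<in> y) + of_bool (x \<in> y) + of_bool (?f x \<in> y)"
      using a16 that f by (intro card_inter_four) auto
    ultimately show ?thesis using a p by (auto simp: of_bool_def split: if_splits)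
  qed
  have "bij_betw ?f (y - {a}) ({..<16} - y - {p})"
  proof (rule bij_betw_byWitness[where f' = ?f])
    have 1: "x < 16 \<and> x \<noteq> a \<and> x \<noteq> p" if "x \<in> y - {a} \<or> x \<in> {..<16} - y - {p}" for x
      using that a p yv by auto
    show "\<forall>x\<in>y - {a}. ?f (?f x) = x" "\<forall>x\<in>{..<16} - y - {p}. ?f (?f x) = x"
      using 1 fourth_pair(6)[OF a16(1) p(1) a16(2)] by blast+
    show "?f ` (y - {a}) \<subseteq> {..<16} - y - {p}"
    proof (rule image_subsetI)
      fix x assume x: "x \<in> y - {a}"
      then have x': "x < 16" "x \<noteq> a" "x \<noteq> p" using 1[of x] by blast+
      show "?f x \<in> {..<16} - y - {p}"
        using swap[OF x'] fourth_pair(1,3)[OF a16(1) p(1) a16(2) x'] x by simp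
    qed
    show "?f ` ({..<16} - y - {p}) \<subseteq> y - {a}"
    proof (rule image_subsetI)
      fix x assume x: "x \<in> {..<16} - y - {p}"
      then have x': "x < 16" "x \<noteq> a" "x \<noteq> p" using 1[of x] by blast+
      show "?f x \<in> y - {a}"
        using swap[OF x'] fourth_pair(2)[OF a16(1) p(1) a16(2) x'] x by simp
    qed
  qed
  then have "card (y - {a}) = card ({..<16} - y - {p})" by (rule bij_betw_same_card)
  then have "card y - 1 = 16 - card y - 1" using a p yv fy by (simp add: card_Diff_subset)
  moreover have "0 < card y" using a fy by (auto simp: card_gt_0_iff)
  moreover have "card y < 16" using yv y(3) psubset_card_mono[of "{..<16::nat}" y] by simp
  ultimately show ?thesis by linarith
qed

text \<open>Three common points of a quad and \<open>b\<close> are excluded by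
  \<open>fourth_in_eight\<close>. If a quad \<open>q\<close> meets \<open>b\<close> in
  \<open>a\<close> alone and contains \<open>p\<close> outside \<open>b\<close>, completing {a, p,
  z} for the seven other points \<open>z\<close> of \<open>b\<close> is an injection into the seven
  points outside \<open>b\<close> other than \<open>p\<close>. It is onto, so it hits a third point
  of \<open>q\<close>, and the preimage is a second point of \<open>q\<close> in
  \<open>b\<close>.\<close>

lemma eights_in_R:
  assumes b: "b \<in> eights"
  shows "b \<in> R"
proof -
  have bD: "b \<in> D" "card b = 8" "finite b" using b eights_finite[OF b] by (simp_all add: eights_def)
  have bv: "b \<in> vectors 16" "b \<subseteq> {..<16}" using in_vectors[OF bD(1)] by (simp_all add: vectors_def)
  have "even (card (q \<inter> b))" if q: "q \<in> quads" for q
  proof (rule ccontr)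
    assume odd: "odd (card (q \<inter> b))"
    have q4: "card q = 4" "finite q" "q \<subseteq> {..<16}" using q quads_finite[OF q] by (simp_all add: quads_def vectors_def)
    have "card (q \<inter> b) \<le> 4" using q4 by (metis card_mono inf_le1)
    then have "card (q \<inter> b) = 1 \<or> card (q \<inter> b) = 3" using odd by presburger
    then show False
    proof
      assume 3: "card (q \<inter> b) = 3"
      then have "fourth (q \<inter> b) \<in> b" "q = insert (fourth (q \<inter> b)) (q \<inter> b)"
        using fourth_in_eight[OF b, of "q \<inter> b"] quad_fourth(1)[OF q, of "q \<inter> b"] by auto
      then have "q \<subseteq> insert (fourth (q \<inter> b)) (q \<inter> b)" "insert (fourth (q \<inter> b)) (q \<inter> b) \<subseteq> b"
        by (blast intro: equalityD1)+
      then have "q \<subseteq> b" by (rule subset_trans)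
      then have "q \<inter> b = q" by blast
      then show False using 3 q4(1) by simp
    next
      assume "card (q \<inter> b) = 1"
      then obtain a where a: "q \<inter> b = {a}" by (rule card_1_singletonE)
      have "card (q - {a}) = 3" using a q4 by (subst card_Diff_subset) auto
      then have "q - {a} \<noteq> {}" by (metis card.empty zero_neq_numeral)
      then obtain p where "p \<in> q - {a}" by blast
      then have p: "p \<in> q" "p \<notin> b" "p < 16" "p \<noteq> a" using a q4 by auto
      obtain x where x: "x \<in> q" "x \<noteq> a" "x \<noteq> p"
      proof -
        have "\<not> q \<subseteq> {a, p}" using card_mono[of "{a, p}" q] q4 p(4) by auto
        then show thesis using that by blast
      qed
      have ax: "a < 16" "x < 16" "x \<notin> b" "a \<in> b" "a \<noteq> p" using a x q4 p by auto
      let ?f = "\<lambda>x. fourth {a, p, x}"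
      note fp = fourth_pair[OF ax(1) p(3) ax(5)]
      have out: "?f z \<notin> b" if z: "z \<in> b" "z \<noteq> a" for z
      proof
        assume "?f z \<in> b"
        moreover have z': "z < 16" "z \<noteq> p" using z bv p by auto
        moreover note f = fp[OF z'(1) z(2) z'(2)]
        ultimately have "{a, z, ?f z} \<subseteq> b" "card {a, z, ?f z} = 3" using z ax by auto
        then have "fourth {a, z, ?f z} \<in> b" by (rule fourth_in_eight[OF b])
        moreover have "fourth {a, z, ?f z} = p"
          by (rule fourth(4)) (use f z z' ax p in \<open>auto simp: insert_commute\<close>)
        ultimately show False using p by simp
      qed
      have inj: "inj_on ?f (b - {a})"
      proof (rule inj_onI)
        fix y z assume yz: "y \<in> b - {a}" "z \<in> b - {a}" "?f y = ?f z"
        then have y: "y < 16" "y \<noteq> a" "y \<noteq> p" and z: "z < 16" "z \<noteq> a" "z \<noteq> p" using bv p by auto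
        have "?f (?f y) = ?f (?f z)" using yz(3) by simp
        then show "y = z" by (simp only: fp(6)[OF y] fp(6)[OF z])
      qed
      have "?f ` (b - {a}) = {..<16} - b - {p}"
      proof (rule card_subset_eq)
        have "?f z < 16 \<and> ?f z \<noteq> p" if "z \<in> b" "z \<noteq> a" for z
        proof -
          have "z < 16" "z \<noteq> p" using that bv p by auto
          then show ?thesis using fp(1,3) that by blast
        qed
        then show "?f ` (b - {a}) \<subseteq> {..<16} - b - {p}" using out by auto
        show "card (?f ` (b - {a})) = card ({..<16} - b - {p})"
          using inj bD bv p ax by (simp add: card_image card_Diff_subset)
      qed simp
      moreover have "x \<in> {..<16} - b - {p}" using ax x by simp
      ultimately obtain z where z: "z \<in> b" "z \<noteq> a" "x = ?f z" by auto
      then have z': "z < 16" "z \<noteq> p" using bv p by auto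
      have t: "{a, p, x} \<subseteq> q" "card {a, p, x} = 3" using x p a ax by auto
      have "q = insert (?f x) {a, p, x}" by (rule quad_fourth(1)[OF q t])
      moreover have "?f x = z" using z fp(6)[OF z'(1) z(2) z'(2)] by simp
      ultimately have "z \<in> q" by auto
      then show False using z a by auto
    qed
  qed
  then show ?thesis using bv by (simp add: R_def)
qed

text \<open>A quad inside \<open>y\<close> and a further point of \<open>y\<close> lie in some
  codeword \<open>b\<close> of weight 8. The sum of \<open>b\<close> and \<open>y\<close> is in
  \<open>R\<close> and has weight at most 6, so it vanishes.\<close>

lemma R_eight_in_D:
  assumes y: "y \<in> R" "card y = 8"
  shows "y \<in> D"
proof -
  have yv: "y \<in> vectors 16" "y \<subseteq> {..<16}" using R_vectors[OF y(1)] by (simp_all add: vectors_def)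
  have fy: "finite y" using y(2) by (metis card.infinite zero_neq_numeral)
  obtain t where t: "t \<subseteq> y" "card t = 3" using obtain_subset_with_card_n[of 3 y] y(2) by auto
  have tv: "t \<in> vectors 16" using t yv by (auto simp: vectors_def)
  define q where "q = insert (fourth t) t"
  have q: "q \<in> quads" "t \<subseteq> q" using fourth(2)[OF tv t(2)] by (auto simp: q_def)
  have q4: "card q = 4" "finite q" using q quads_finite[OF q(1)] by (simp_all add: quads_def)
  have "q \<subseteq> y"
  proof (rule ccontr)
    assume "\<not> q \<subseteq> y"
    then have "q \<inter> y = t" using t by (auto simp: q_def)
    then show False using y(1) q(1) t(2) by (auto simp: R_def)
  qed
  then have "\<not> y \<subseteq> q" using q4 y(2) by auto
  then obtain p where p: "p \<in> y" "p \<notin> q" by blast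
  then have "p < 16" using yv by auto
  then obtain b where b: "b \<in> eights" "insert p q \<subseteq> b" using quad_insert_eight[OF q(1) _ p(2)] by blast
  have bb: "card b = 8" "finite b" "b \<in> D" using b(1) eights_finite[OF b(1)] by (simp_all add: eights_def)
  have "5 \<le> card (b \<inter> y)"
    using card_mono[of "b \<inter> y" "insert p q"] b(2) p \<open>q \<subseteq> y\<close> q4 fy by auto
  then have "card (vadd b y) \<le> 6" using card_vadd[OF bb(2) fy] bb y by simp
  moreover have "vadd b y \<in> R" using R_vadd[OF eights_in_R[OF b(1)] y(1)] .
  ultimately have "vadd b y = {}" using R_card[of "vadd b y"] by fastforce
  then show ?thesis using bb by simp
qed

lemma quad_exists:
  assumes "t \<in> vectors 16" "card t = 3"
  obtains q where "q \<in> quads" "t \<subseteq> q"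
  using fourth(2)[OF assms] by blast

lemma eight_exists: obtains b where "b \<in> eights"
proof -
  have "{0, 1, 2} \<in> vectors 16" "card {0, 1, 2::nat} = 3" by auto
  then obtain q where q: "q \<in> quads" by (rule quad_exists)
  then have "card q = 4" by (simp add: quads_def)
  then have "\<not> {..<16} \<subseteq> q" using card_mono[of q "{..<16::nat}"] quads_finite[OF q] by auto
  then obtain p where "p < 16" "p \<notin> q" by blast
  then show thesis using quad_insert_eight[OF q] that by blast
qed

text \<open>After translation by \<open>b\<close> of weight 8, \<open>b\<close> is again a codeword
  of weight 8. Its complement lies in the \<open>R\<close> of the translate and has weight 8, so it
  is a codeword there; translating back gives the all-one vector.\<close>

lemma full_in_D: "{..<16} \<in> D"
proof -
  obtain b where b: "b \<in> eights" by (rule eight_exists)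
  have bD: "b \<in> D" "card b = 8" using b by (simp_all add: eights_def)
  have bv: "b \<in> vectors 16" "b \<subseteq> {..<16}" using in_vectors[OF bD(1)] by (simp_all add: vectors_def)
  interpret T: nr_code "vadd b ` D" by (rule translate[OF bD(1)])
  have "b \<in> vadd b ` D" using zero by (metis image_eqI vadd_empty(1))
  then have "b \<in> T.R" using T.eights_in_R bD(2) by (simp add: T.eights_def)
  then have "vadd {..<16} b \<in> T.R" by (rule T.R_vadd[OF T.full_in_R])
  moreover have "card (vadd {..<16} b) = 8"
    using bv bD(2) by (simp add: compl_eq_vadd card_Diff_subset finite_subset[OF bv(2)])
  ultimately have "vadd {..<16} b \<in> vadd b ` D" by (rule T.R_eight_in_D)
  then obtain c where c: "c \<in> D" "vadd {..<16} b = vadd b c" by blast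
  have "vadd (vadd {..<16} b) b = vadd (vadd b c) b" using c(2) by simp
  then show ?thesis using c(1) by simp
qed

lemma R_subset_D: "y \<in> R \<Longrightarrow> y \<in> D"
  using R_card[of y] R_eight_in_D[of y] zero full_in_D by blast

lemma R_card_dvd: "y \<in> R \<Longrightarrow> 4 dvd card y"
  using R_card[of y] by (cases "y = {} \<or> y = {..<16}") auto

lemma card_le_10: "c \<in> D \<Longrightarrow> c \<noteq> {..<16} \<Longrightarrow> card c \<le> 10"
proof -
  assume c: "c \<in> D" "c \<noteq> {..<16}"
  then have "c \<subseteq> {..<16}" using in_vectors[OF c(1)] by (simp add: vectors_def)
  then have "{..<16} \<inter> c = c" by blast
  then show "card c \<le> 10" using card_inter[OF full_in_D c(1)] c(2) by auto
qed

text \<open>The weights in \<open>D\<close> are among 0, 6, 8, 10 and 16. This description of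
  \<open>R\<close> by weights is what carries over to translated and permuted codes.\<close>

lemma R_iff: "c \<in> D \<Longrightarrow> c \<in> R \<longleftrightarrow> 4 dvd card c"
proof
  assume c: "c \<in> D" "4 dvd card c"
  show "c \<in> R"
  proof (cases "c = {} \<or> c = {..<16}")
    case True
    then show ?thesis using full_in_R by (auto simp: R_def)
  next
    case False
    then have "6 \<le> card c" "card c \<le> 10" using card_ge_6 card_le_10 c by auto
    then have "card c = 8" using c(2) by presburger
    then show ?thesis using eights_in_R c(1) by (simp add: eights_def)
  qed
qed (rule R_card_dvd)

section \<open>Duality between \<open>R\<close> and \<open>D\<close>\<close>

lemma R_orthogonal:
  assumes y: "y \<in> R" and c: "c \<in> D"
  shows "even (card (c \<inter> y))"
proof (rule ccontr)
  assume odd: "odd (card (c \<inter> y))"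
  have yD: "y \<in> D" using R_subset_D[OF y] .
  have sum: "card (vadd c y) + 2 * card (c \<inter> y) = card c + card y"
    using finite_codeword c yD by (intro card_vadd) auto
  have y4: "4 dvd card y" by (rule R_card_dvd[OF y])
  \<comment> \<open>With an odd intersection, adding \<open>y\<close> changes the weight by 2 modulo
    4. If \<open>c\<close> is in \<open>R\<close>, the sum is a word of \<open>R\<close> whose
    weight is not divisible by 4. Otherwise the sum has weight divisible by 4 and lies, like
    \<open>y\<close>, in the \<open>R\<close> of the translate by \<open>y\<close>; then so does
    \<open>c\<close>, whose weight is not divisible by 4.\<close>
  show False
  proof (cases "4 dvd card c")
    case True
    then have "vadd c y \<in> R" using R_iff[OF c] y by (intro R_vadd) auto
    then have "4 dvd card (vadd c y)" by (rule R_card_dvd)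
    then show False using sum True y4 odd by presburger
  next
    case False
    interpret T: nr_code "vadd y ` D" by (rule translate[OF yD])
    have "4 dvd card (vadd c y)" using sum False y4 odd even_card[OF c] by presburger
    moreover have "vadd c y \<in> vadd y ` D" using c by (metis imageI vadd_commute)
    ultimately have "vadd c y \<in> T.R" using T.R_iff by blast
    moreover have "y \<in> vadd y ` D" using zero by (metis image_eqI vadd_empty(1))
    then have "y \<in> T.R" using T.R_iff y4 by blast
    ultimately have "vadd (vadd c y) y \<in> T.R" by (rule T.R_vadd)
    then have "4 dvd card c" using T.R_card_dvd by simp
    then show False using False by simp
  qed
qed

text \<open>The complement of a quad q containing a triple t is partitioned by the four words of weight 6
  through t. Each part has the same intersection parity with y.\<close>

lemma orthogonal_in_R:
  assumes y: "y \<in> vectors 16" and orth: "\<And>c. c \<in> D \<Longrightarrow> even (card (c \<inter> y))"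
  shows "y \<in> R"
proof -
  have ys: "y \<subseteq> {..<16}" "finite y" using y by (simp_all add: vectors_def finite_subset)
  have "even (card (q \<inter> y))" if q: "q \<in> quads" for q
  proof -
    have q4: "card q = 4" "finite q" using q quads_finite[OF q] by (simp_all add: quads_def)
    obtain t where t: "t \<subseteq> q" "card t = 3" using obtain_subset_with_card_n[of 3 q] q4 by auto
    have tv: "t \<in> vectors 16" "finite t" using quad_fourth(2)[OF q t] by auto
    have qe: "q = insert (fourth t) t" by (rule quad_fourth(1)[OF q t])
    have "card {c \<in> sixes t. x \<in> c} = 1" if x: "x \<in> y - q" for x
    proof -
      have xt: "x \<notin> t" "insert x t \<in> vectors 16" using x t ys tv by auto
      have card4: "card (insert x t) = 4" using xt tv t by simp
      have eq: "{c \<in> sixes t. x \<in> c} = sixes (insert x t)" by (auto simp: sixes_def)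
      have "insert x t \<notin> quads"
      proof
        assume "insert x t \<in> quads"
        then have "fourth t = x" using fourth(4)[OF tv(1) t(2) xt(1)] by simp
        then show False using x qe by auto
      qed
      then obtain c where "c \<in> sixes (insert x t)" using xt card4 by (auto simp: quads_def)
      then have "sixes (insert x t) = {c}" using sixes_unique card4 by fastforce
      then show ?thesis unfolding eq by simp
    qed
    then have "(\<Sum>c\<in>sixes t. card {x \<in> y - q. x \<in> c}) = 1 * card (y - q)"
      using ys by (intro sum_multicount) auto
    moreover have "even (card {x \<in> y - q. x \<in> c} + card (y \<inter> t))" if c: "c \<in> sixes t" for c
    proof -
      have cD: "c \<in> D" "t \<subseteq> c" using c by (auto simp: sixes_def)
      have "fourth t \<notin> c" using c q qe by (auto simp: quads_def sixes_def)
      then have "{x \<in> y - q. x \<in> c} \<union> (y \<inter> t) = c \<inter> y" "{x \<in> y - q. x \<in> c} \<inter> (y \<inter> t) = {}"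
        using cD qe by auto
      then have "card {x \<in> y - q. x \<in> c} + card (y \<inter> t) = card (c \<inter> y)"
        using ys card_Un_disjoint[of "{x \<in> y - q. x \<in> c}" "y \<inter> t"] by simp
      then show ?thesis using orth[OF cD(1)] by simp
    qed
    then have "even (\<Sum>c\<in>sixes t. card {x \<in> y - q. x \<in> c} + card (y \<inter> t))"
      by (intro dvd_sum) auto
    ultimately have "even (card (y - q) + 4 * card (y \<inter> t))"
      using card_sixes[OF tv(1) t(2)] by (simp add: sum.distrib)
    then have "even (card (y - q))" by simp
    moreover have "card y = card (y - q) + card (q \<inter> y)"
      using ys(2) by (metis add.commute card_Int_Diff inf_commute)
    moreover have "{..<16} \<inter> y = y" using ys by auto
    then have "even (card y)" using orth[OF full_in_D] by simp
    ultimately show ?thesis by simp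
  qed
  then show ?thesis using y by (simp add: R_def)
qed

text \<open>By \<open>orthogonal_in_R\<close> it is enough to be orthogonal to all of
  \<open>D\<close>. The translate contains \<open>c\<close> and all sums of \<open>c\<close> with
  codewords, so orthogonality to it implies orthogonality to \<open>D\<close>.\<close>

lemma R_translate_subset:
  assumes c: "c \<in> D"
  shows "nr_code.R (vadd c ` D) \<subseteq> R"
proof
  interpret T: nr_code "vadd c ` D" by (rule translate[OF c])
  fix y assume y: "y \<in> T.R"
  then have "y \<in> vectors 16" by (rule T.R_vectors)
  then have fy: "finite y" "y \<in> vectors 16" by simp_all
  have cy: "even (card (y \<inter> c))"
  proof -
    have "c \<in> vadd c ` D" using zero by (metis image_eqI vadd_empty(1))
    then show ?thesis using T.R_orthogonal[OF y] by (simp add: Int_commute)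
  qed
  show "y \<in> R"
  proof (rule orthogonal_in_R[OF fy(2)])
    fix e assume "e \<in> D"
    then have "vadd c e \<in> vadd c ` D" by (rule imageI)
    from T.R_orthogonal[OF y this] have "even (card (y \<inter> vadd c e))" by (subst Int_commute)
    then show "even (card (e \<inter> y))" using even_inter_vadd[OF fy(1), of c e] cy by (simp add: Int_commute[of e])
  qed
qed

text \<open>Translating twice by \<open>c\<close> returns to \<open>D\<close>, so
  \<open>R_translate_subset\<close>, applied to the translate, reads
  \<open>R \<subseteq> T.R\<close>. The words of \<open>T.R\<close> are codewords of the
  translate.\<close>

lemma D_vadd_R:
  assumes c: "c \<in> D" and y: "y \<in> R"
  shows "vadd c y \<in> D"
proof -
  interpret T: nr_code "vadd c ` D" by (rule translate[OF c])
  have "c \<in> vadd c ` D" using zero by (metis image_eqI vadd_empty(1))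
  then have "nr_code.R (vadd c ` vadd c ` D) \<subseteq> T.R" by (rule T.R_translate_subset)
  then have "y \<in> T.R" using y by auto
  then have "y \<in> vadd c ` D" by (rule T.R_subset_D)
  then obtain e where "e \<in> D" "y = vadd c e" by blast
  then show ?thesis by simp
qed

lemma R_permute:
  assumes \<sigma>: "\<sigma> permutes {..<16}" and y: "y \<in> R"
  shows "\<sigma> ` y \<in> nr_code.R ((`) \<sigma> ` D)"
proof -
  interpret T: nr_code "(`) \<sigma> ` D" by (rule permute[OF \<sigma>])
  have "card (\<sigma> ` y) = card y"
    using permutes_inj[OF \<sigma>] by (meson card_image inj_on_subset subset_UNIV)
  then show ?thesis using T.R_iff[of "\<sigma> ` y"] R_subset_D[OF y] R_card_dvd[OF y] by auto
qed

text \<open>In affine terms \<open>w\<close> spans a hyperplane, which is a word \<open>b\<close> of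
  weight 8. It contains no fifth point of \<open>c\<close>, since five points of \<open>b\<close>
  include a quad and no quad lies inside \<open>c\<close>. The complement of \<open>b\<close> is the
  required word.\<close>

lemma separating_R:
  assumes c: "c \<in> D" "card c = 6" and w: "w \<subseteq> c" "card w = 4" and p: "p \<in> c" "p \<notin> w"
  obtains y where "y \<in> R" "p \<in> y" "y \<inter> w = {}"
proof -
  have cv: "c \<subseteq> {..<16}" "finite c" using in_vectors[OF c(1)] by (simp_all add: vectors_def finite_subset)
  have noquad: "q \<notin> quads" if "q \<subseteq> c" for q
    using that c by (auto simp: quads_def sixes_def)
  have fw: "finite w" using w(1) cv(2) by (rule finite_subset)
  have "3 \<le> card w" using w by simp
  then obtain t where t: "t \<subseteq> w" "card t = 3" and ft: "finite t"
    by (rule obtain_subset_with_card_n)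
  have tv: "t \<in> vectors 16" using t w cv by (auto simp: vectors_def)
  have "card (w - t) = 1" using t w ft by (simp add: card_Diff_subset)
  then obtain s where s: "w - t = {s}" by (rule card_1_singletonE)
  then have ws: "w = insert s t" "s \<notin> t" using t by auto
  have s16: "s < 16" using ws w cv by auto
  define q where "q = insert (fourth t) t"
  have q: "q \<in> quads" using fourth(2)[OF tv t(2)] by (simp add: q_def)
  have "s \<noteq> fourth t" using q noquad[OF w(1)] ws by (auto simp: q_def)
  then have "s \<notin> q" using ws by (simp add: q_def)
  then obtain b where b: "b \<in> eights" "insert s q \<subseteq> b" using quad_insert_eight[OF q s16] by blast
  have wb: "w \<subseteq> b" using b(2) ws by (auto simp: q_def)
  have "p \<notin> b"
  proof
    assume "p \<in> b"
    then have "insert p w \<subseteq> b" "card (insert p w) = 5" using wb p fw w by auto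
    then obtain q' where "q' \<in> quads" "q' \<subseteq> insert p w" by (rule quad_in_eight[OF b(1)])
    then show False using noquad[of q'] p w by auto
  qed
  show thesis
  proof (rule that)
    show "vadd {..<16} b \<in> R" using full_in_R eights_in_R[OF b(1)] by (rule R_vadd)
    show "p \<in> vadd {..<16} b" using \<open>p \<notin> b\<close> p cv by auto
    have "x \<in> b \<and> x \<in> {..<16}" if "x \<in> w" for x using that wb w(1) cv(1) by blast
    then show "vadd {..<16} b \<inter> w = {}" by auto
  qed
qed

text \<open>As seen by every function in \<open>R\<close>, the fourth point is the affine sum of the
  other three.\<close>

lemma fourth_point:
  assumes "x < 16" "y < 16" "z < 16" "x \<noteq> y" "x \<noteq> z" "y \<noteq> z"
  obtains f where "f < 16" "{x, y, z, f} \<in> quads" "\<And>b. b \<in> R \<Longrightarrow> f \<in> b \<longleftrightarrow> (x \<in> b) \<noteq> ((y \<in> b) \<noteq> (z \<in> b))"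
proof -
  note f = fourth_pair[OF assms(1,2,4,3) assms(5,6)[symmetric]]
  show thesis
  proof (rule that[OF f(1,5)])
    fix b assume "b \<in> R"
    then have "even (card ({x, y, z, fourth {x, y, z}} \<inter> b))" using f(5) by (simp add: R_def)
    moreover have "card ({x, y, z, fourth {x, y, z}} \<inter> b)
        = of_bool (x \<in> b) + of_bool (y \<in> b) + of_bool (z \<in> b) + of_bool (fourth {x, y, z} \<in> b)"
      using f assms by (intro card_inter_four) auto
    ultimately show "fourth {x, y, z} \<in> b \<longleftrightarrow> (x \<in> b) \<noteq> ((y \<in> b) \<noteq> (z \<in> b))"
      by (auto simp: of_bool_def split: if_splits)
  qed
qed

end

section \<open>Affine frames\<close>

text \<open>The coordinate functions of the 4-space, where \<open>j\<close> stands for the point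
  with the binary digits of \<open>j\<close>.\<close>

definition H :: "nat \<Rightarrow> nat set" where
  "H i = {j \<in> {..<16}. odd (j div 2 ^ i)}"

text \<open>In binary digits the six points of the base word are the origin, the four unit vectors
  and their sum.\<close>

locale framed_code = nr_code +
  assumes H: "i < 4 \<Longrightarrow> H i \<in> R" and base: "{0, 1, 2, 4, 8, 15} \<in> D"

text \<open>The words separating \<open>p1\<close>, ..., \<open>p4\<close> from the rest of the
  frame serve as coordinate functions with origin \<open>p0\<close>. Affine sums realise all 16
  digit patterns, so reading off the digits is a bijection. Orthogonality of the word of weight 6 to
  each coordinate function forces \<open>p5\<close> to get all digits 1.\<close>

lemma (in nr_code) frame:
  assumes c: "{p0, p1, p2, p3, p4, p5} \<in> D" and dist: "distinct [p0, p1, p2, p3, p4, p5]"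
  obtains \<phi> where "\<phi> permutes {..<16}" "framed_code ((`) \<phi> ` D)"
    "\<phi> p0 = 0" "\<phi> p1 = 1" "\<phi> p2 = 2"
    "\<forall>x. {p0, p1, p2, x} \<in> quads \<longrightarrow> \<phi> x = 3"
proof -
  let ?c = "{p0, p1, p2, p3, p4, p5}"
  have card: "card ?c = 6" using dist by simp
  have p16: "p0 < 16" "p1 < 16" "p2 < 16" "p3 < 16" "p4 < 16" "p5 < 16"
    using in_vectors[OF c] by (auto simp: vectors_def)
  obtain b0 where b0: "b0 \<in> R" "p1 \<in> b0" "b0 \<inter> {p0, p2, p3, p4} = {}"
    by (rule separating_R[OF c card, of "{p0, p2, p3, p4}" p1]) (use dist in auto)
  obtain b1 where b1: "b1 \<in> R" "p2 \<in> b1" "b1 \<inter> {p0, p1, p3, p4} = {}"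
    by (rule separating_R[OF c card, of "{p0, p1, p3, p4}" p2]) (use dist in auto)
  obtain b2 where b2: "b2 \<in> R" "p3 \<in> b2" "b2 \<inter> {p0, p1, p2, p4} = {}"
    by (rule separating_R[OF c card, of "{p0, p1, p2, p4}" p3]) (use dist in auto)
  obtain b3 where b3: "b3 \<in> R" "p4 \<in> b3" "b3 \<inter> {p0, p1, p2, p3} = {}"
    by (rule separating_R[OF c card, of "{p0, p1, p2, p3}" p4]) (use dist in auto)
  define \<psi> :: "nat \<Rightarrow> nat" where
    "\<psi> x = of_bool (x \<in> b0) + 2 * of_bool (x \<in> b1) + 4 * of_bool (x \<in> b2) + 8 * of_bool (x \<in> b3)" for x
  define \<phi> where "\<phi> x = (if x < 16 then \<psi> x else x)" for x
  have bits: "odd (\<psi> x) \<longleftrightarrow> x \<in> b0" "odd (\<psi> x div 2) \<longleftrightarrow> x \<in> b1"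
    "odd (\<psi> x div 4) \<longleftrightarrow> x \<in> b2" "odd (\<psi> x div 8) \<longleftrightarrow> x \<in> b3" "\<psi> x < 16" for x
    by (cases "x \<in> b0"; cases "x \<in> b1"; cases "x \<in> b2"; cases "x \<in> b3"; simp add: \<psi>_def)+
  have psi: "\<psi> p0 = 0" "\<psi> p1 = 1" "\<psi> p2 = 2" "\<psi> p3 = 4" "\<psi> p4 = 8"
    using b0 b1 b2 b3 by (auto simp: \<psi>_def)
  have sum3: "\<exists>f<16. f \<in> b0 = ((x \<in> b0) \<noteq> ((y \<in> b0) \<noteq> (z \<in> b0))) \<and>
       f \<in> b1 = ((x \<in> b1) \<noteq> ((y \<in> b1) \<noteq> (z \<in> b1))) \<and>
       f \<in> b2 = ((x \<in> b2) \<noteq> ((y \<in> b2) \<noteq> (z \<in> b2))) \<and>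
       f \<in> b3 = ((x \<in> b3) \<noteq> ((y \<in> b3) \<noteq> (z \<in> b3)))"
    if lt: "x < 16" "y < 16" "z < 16" and neq: "\<psi> x \<noteq> \<psi> y" "\<psi> x \<noteq> \<psi> z" "\<psi> y \<noteq> \<psi> z" for x y z
  proof -
    have "x \<noteq> y" "x \<noteq> z" "y \<noteq> z" using neq by auto
    then obtain f where "f < 16" "\<And>b. b \<in> R \<Longrightarrow> f \<in> b \<longleftrightarrow> (x \<in> b) \<noteq> ((y \<in> b) \<noteq> (z \<in> b))"
      by (rule fourth_point[OF lt]) blast+
    then show ?thesis using b0(1) b1(1) b2(1) b3(1) by blast
  qed
  have m: "p0 \<notin> b0" "p0 \<notin> b1" "p0 \<notin> b2" "p0 \<notin> b3"
    "p1 \<in> b0" "p1 \<notin> b1" "p1 \<notin> b2" "p1 \<notin> b3" "p2 \<notin> b0" "p2 \<in> b1" "p2 \<notin> b2" "p2 \<notin> b3"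
    "p3 \<notin> b0" "p3 \<notin> b1" "p3 \<in> b2" "p3 \<notin> b3" "p4 \<notin> b0" "p4 \<notin> b1" "p4 \<notin> b2" "p4 \<in> b3"
    using b0 b1 b2 b3 by auto
  \<comment> \<open>Each of these points is named after its future label, the exclusive or of three
    labels already realised: 3 from 0, 1, 2, then 7 from 1, 2, 4, and at the end 15 from 3, 4,
    8.\<close>
  obtain e3 where e3: "e3 < 16" "e3 \<in> b0" "e3 \<in> b1" "e3 \<notin> b2" "e3 \<notin> b3"
    using sum3[OF p16(1,2,3)] psi m by auto
  obtain e5 where e5: "e5 < 16" "e5 \<in> b0" "e5 \<notin> b1" "e5 \<in> b2" "e5 \<notin> b3"
    using sum3[OF p16(1,2,4)] psi m by auto
  obtain e9 where e9: "e9 < 16" "e9 \<in> b0" "e9 \<notin> b1" "e9 \<notin> b2" "e9 \<in> b3"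
    using sum3[OF p16(1,2,5)] psi m by auto
  obtain e6 where e6: "e6 < 16" "e6 \<notin> b0" "e6 \<in> b1" "e6 \<in> b2" "e6 \<notin> b3"
    using sum3[OF p16(1,3,4)] psi m by auto
  obtain e10 where e10: "e10 < 16" "e10 \<notin> b0" "e10 \<in> b1" "e10 \<notin> b2" "e10 \<in> b3"
    using sum3[OF p16(1,3,5)] psi m by auto
  obtain e12 where e12: "e12 < 16" "e12 \<notin> b0" "e12 \<notin> b1" "e12 \<in> b2" "e12 \<in> b3"
    using sum3[OF p16(1,4,5)] psi m by auto
  obtain e7 where e7: "e7 < 16" "e7 \<in> b0" "e7 \<in> b1" "e7 \<in> b2" "e7 \<notin> b3"
    using sum3[OF p16(2,3,4)] psi m by auto
  obtain e11 where e11: "e11 < 16" "e11 \<in> b0" "e11 \<in> b1" "e11 \<notin> b2" "e11 \<in> b3"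
    using sum3[OF p16(2,3,5)] psi m by auto
  obtain e13 where e13: "e13 < 16" "e13 \<in> b0" "e13 \<notin> b1" "e13 \<in> b2" "e13 \<in> b3"
    using sum3[OF p16(2,4,5)] psi m by auto
  obtain e14 where e14: "e14 < 16" "e14 \<notin> b0" "e14 \<in> b1" "e14 \<in> b2" "e14 \<in> b3"
    using sum3[OF p16(3,4,5)] psi m by auto
  have "\<psi> e3 = 3" using e3 by (simp add: \<psi>_def)
  then obtain e15 where e15: "e15 < 16" "e15 \<in> b0" "e15 \<in> b1" "e15 \<in> b2" "e15 \<in> b3"
    using sum3[OF e3(1) p16(4,5)] e3 psi m by auto
  have vals: "\<phi> e3 = 3" "\<phi> e5 = 5" "\<phi> e6 = 6" "\<phi> e7 = 7" "\<phi> e9 = 9" "\<phi> e10 = 10" "\<phi> e11 = 11" "\<phi> e12 = 12" "\<phi> e13 = 13" "\<phi> e14 = 14" "\<phi> e15 = 15"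
    "\<phi> p0 = 0" "\<phi> p1 = 1" "\<phi> p2 = 2" "\<phi> p3 = 4" "\<phi> p4 = 8"
    using p16 psi e3 e5 e6 e7 e9 e10 e11 e12 e13 e14 e15 by (simp_all add: \<phi>_def) (simp_all add: \<psi>_def)
  have "{..<16} \<subseteq> \<phi> ` {..<16}"
  proof
    fix k :: nat assume "k \<in> {..<16}"
    then have "k < 16" by simp
    then have "k \<in> {0,1,2,3,4,5,6,7,8,9,10,11,12,13,14,15}"
      unfolding insert_iff empty_iff by presburger
    moreover have "\<phi> ` {p0,p1,p2,e3,p3,e5,e6,e7,p4,e9,e10,e11,e12,e13,e14,e15} =
        {0,1,2,3,4,5,6,7,8,9,10,11,12,13,14,15}"
      by (simp only: image_insert image_empty vals)
    ultimately have "k \<in> \<phi> ` {p0,p1,p2,e3,p3,e5,e6,e7,p4,e9,e10,e11,e12,e13,e14,e15}" by simp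
    moreover have "{p0,p1,p2,e3,p3,e5,e6,e7,p4,e9,e10,e11,e12,e13,e14,e15} \<subseteq> {..<16}"
      using p16 e3 e5 e6 e7 e9 e10 e11 e12 e13 e14 e15 by simp
    ultimately show "k \<in> \<phi> ` {..<16}" by blast
  qed
  then have inj: "inj_on \<phi> {..<16}" by (rule finite_surj_inj[rotated]) simp
  have img: "\<phi> ` {..<16} = {..<16}"
    by (rule endo_inj_surj[OF _ _ inj]) (use bits(5) in \<open>auto simp: \<phi>_def\<close>)
  have perm: "\<phi> permutes {..<16}"
    by (rule bij_imp_permutes) (use inj img in \<open>auto simp: bij_betw_def \<phi>_def\<close>)
  interpret T: nr_code "(`) \<phi> ` D" by (rule permute[OF perm])
  have imgb: "\<phi> ` b = {j \<in> {..<16}. P j}" if bR: "b \<in> R" and bP: "\<And>x. P (\<psi> x) \<longleftrightarrow> x \<in> b" for b P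
  proof (rule set_eqI)
    fix j
    have b: "b \<subseteq> {..<16}" using R_vectors[OF bR] by (simp add: vectors_def)
    show "j \<in> \<phi> ` b \<longleftrightarrow> j \<in> {j \<in> {..<16}. P j}"
    proof
      assume "j \<in> \<phi> ` b"
      then obtain x where "x \<in> b" "j = \<phi> x" by blast
      then show "j \<in> {j \<in> {..<16}. P j}" using b bits(5) bP[of x] by (auto simp: \<phi>_def)
    next
      assume j: "j \<in> {j \<in> {..<16}. P j}"
      then obtain x where x: "x < 16" "j = \<phi> x" using img by blast
      then have "j = \<psi> x" by (simp add: \<phi>_def)
      then show "j \<in> \<phi> ` b" using j bP[of x] x by blast
    qed
  qed
  have H: "\<phi> ` b0 = H 0" "\<phi> ` b1 = H 1" "\<phi> ` b2 = H 2" "\<phi> ` b3 = H 3"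
    using imgb[OF b0(1), of odd] imgb[OF b1(1), of "\<lambda>j. odd (j div 2)"]
      imgb[OF b2(1), of "\<lambda>j. odd (j div 4)"] imgb[OF b3(1), of "\<lambda>j. odd (j div 8)"] bits
    by (simp_all add: H_def)
  have p5: "p5 \<in> b" if "b \<in> R" "card (b \<inter> {p0, p1, p2, p3, p4}) = 1" for b
  proof (rule ccontr)
    assume "p5 \<notin> b"
    then have "?c \<inter> b = b \<inter> {p0, p1, p2, p3, p4}" by auto
    then show False using R_orthogonal[OF that(1) c] that(2) by simp
  qed
  have one: "b0 \<inter> {p0, p1, p2, p3, p4} = {p1}" "b1 \<inter> {p0, p1, p2, p3, p4} = {p2}"
    "b2 \<inter> {p0, p1, p2, p3, p4} = {p3}" "b3 \<inter> {p0, p1, p2, p3, p4} = {p4}"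
    using b0 b1 b2 b3 by auto
  have "p5 \<in> b0" "p5 \<in> b1" "p5 \<in> b2" "p5 \<in> b3"
    using p5[OF b0(1)] p5[OF b1(1)] p5[OF b2(1)] p5[OF b3(1)] one by simp_all
  then have "\<psi> p5 = 15" by (simp add: \<psi>_def)
  then have phi: "\<phi> p0 = 0" "\<phi> p1 = 1" "\<phi> p2 = 2" "\<phi> p3 = 4" "\<phi> p4 = 8" "\<phi> p5 = 15"
    using psi p16 by (simp_all add: \<phi>_def)
  have "framed_code ((`) \<phi> ` D)"
  proof
    fix i :: nat assume "i < 4"
    then have "i \<in> {0, 1, 2, 3}" by auto
    then obtain b where "b \<in> R" "\<phi> ` b = H i" using H b0(1) b1(1) b2(1) b3(1) by auto
    then show "H i \<in> T.R" using R_permute[OF perm] by metis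
  next
    have "\<phi> ` ?c \<in> (`) \<phi> ` D" using c by (rule imageI)
    then show "{0, 1, 2, 4, 8, 15} \<in> (`) \<phi> ` D" using phi by simp
  qed
  \<comment> \<open>The fourth point of a quad is an affine sum, and the exclusive or of 0, 1 and 2
    is 3.\<close>
  moreover have "\<phi> x = 3" if q: "{p0, p1, p2, x} \<in> quads" for x
  proof -
    have x: "x < 16" using q by (simp add: quads_def)
    have "card {p0, p1, p2, x} = 4" using q by (simp add: quads_def)
    then have ne: "p0 \<noteq> x" "p1 \<noteq> x" "p2 \<noteq> x" using dist by (auto simp: card_insert_if split: if_splits)
    have "x \<in> b \<longleftrightarrow> (p0 \<in> b) \<noteq> ((p1 \<in> b) \<noteq> (p2 \<in> b))" if b: "b \<in> R" for b
    proof -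
      have "even (card ({p0, p1, p2, x} \<inter> b))" using b q by (simp add: R_def)
      moreover have "card ({p0, p1, p2, x} \<inter> b)
          = of_bool (p0 \<in> b) + of_bool (p1 \<in> b) + of_bool (p2 \<in> b) + of_bool (x \<in> b)"
        using dist ne by (intro card_inter_four) auto
      ultimately show ?thesis by (auto simp: of_bool_def split: if_splits)
    qed
    then have "x \<in> b0" "x \<in> b1" "x \<notin> b2" "x \<notin> b3" using b0(1) b1(1) b2(1) b3(1) m by blast+
    then show "\<phi> x = 3" using x by (simp add: \<phi>_def \<psi>_def)
  qed
  ultimately show thesis using that perm phi by blast
qed

section \<open>Classification by quadratic forms\<close>

type_synonym bits = "bool \<times> bool \<times> bool \<times> bool \<times> bool \<times> bool"

text \<open>The bits are the coefficients of x0 x1, x0 x2, x1 x2, x0 x3, x1 x3, x2 x3, i.e. the edges of a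
  graph on four vertices. The value is the set of all j whose binary digits are not annihilated
  by the quadratic form.\<close>

fun graph :: "bits \<Rightarrow> nat set" where
  "graph (a, b, c, d, e, f) = set (map fst (filter snd
    [(3, a), (5, b), (6, c), (9, d), (10, e), (12, f), (7, a \<noteq> (b \<noteq> c)), (11, a \<noteq> (d \<noteq> e)),
     (13, b \<noteq> (d \<noteq> f)), (14, c \<noteq> (e \<noteq> f)), (15, a \<noteq> (b \<noteq> (c \<noteq> (d \<noteq> (e \<noteq> f)))))]))"

fun bxor :: "bits \<Rightarrow> bits \<Rightarrow> bits" where
  "bxor (a, b, c, d, e, f) (a', b', c', d', e', f') =
     (a \<noteq> a', b \<noteq> b', c \<noteq> c', d \<noteq> d', e \<noteq> e', f \<noteq> f')"

definition zero_bits :: bits where "zero_bits = (False, False, False, False, False, False)"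
definition one_bits :: bits where "one_bits = (True, True, True, True, True, True)"

text \<open>Six of the twelve Hamiltonian paths; their complements are the other six. Together with
  the empty and the complete graph they form a Kerdock set: eight alternating forms whose pairwise
  differences are nonsingular.\<close>

definition paths :: "bits list" where
  "paths = [(False, False, True, True, False, True), (False, True, False, True, True, False),
    (False, True, True, False, True, False), (True, False, False, False, True, True),
    (True, False, True, True, False, False), (True, True, False, False, False, True)]"

text \<open>The effect on the coefficients of exchanging the variables x2 and x3.\<close>

fun swap_bits :: "bits \<Rightarrow> bits" where
  "swap_bits (a, b, c, d, e, f) = (a, d, e, b, c, f)"

definition swapped_paths :: "bits list" where "swapped_paths = map swap_bits paths"

lemma in_graph:
  "i \<in> graph (a, b, c, d, e, f) \<longleftrightarrow>
    i = 3 \<and> a \<or> i = 5 \<and> b \<or> i = 6 \<and> c \<or> i = 9 \<and> d \<or> i = 10 \<and> e \<or> i = 12 \<and> f \<or>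
    i = 7 \<and> (a \<noteq> (b \<noteq> c)) \<or> i = 11 \<and> (a \<noteq> (d \<noteq> e)) \<or> i = 13 \<and> (b \<noteq> (d \<noteq> f)) \<or>
    i = 14 \<and> (c \<noteq> (e \<noteq> f)) \<or> i = 15 \<and> (a \<noteq> (b \<noteq> (c \<noteq> (d \<noteq> (e \<noteq> f)))))"
  by auto

lemma graph_vadd: "vadd (graph s) (graph t) = graph (bxor s t)"
proof (cases s; cases t; hypsubst, rule set_eqI)
  fix i and a b c d e f a' b' c' d' e' f' :: bool
  show "i \<in> vadd (graph (a, b, c, d, e, f)) (graph (a', b', c', d', e', f')) \<longleftrightarrow>
    i \<in> graph (bxor (a, b, c, d, e, f) (a', b', c', d', e', f'))"
  proof (cases "i \<in> {3, 5, 6, 9, 10, 12, 7, 11, 13, 14, 15}")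
    case True
    then show ?thesis
      unfolding in_vadd bxor.simps in_graph by (elim insertE emptyE) (simp_all, argo+)
  next
    case False
    then show ?thesis unfolding in_vadd bxor.simps in_graph by simp
  qed
qed

text \<open>A weight congruent to 2 modulo 4 means that the form is nonsingular. The graphs which are
  nonsingular together with their complements are the 12 Hamiltonian paths of the complete
  graph.\<close>

lemma paths_enum:
  "\<forall>s. card (graph s) mod 4 = 2 \<and> card (graph (bxor s one_bits)) mod 4 = 2 \<longrightarrow>
    s \<in> set paths \<union> set swapped_paths"
  by code_simp

lemma paths_disjoint: "set paths \<inter> set swapped_paths = {}"
  by code_simp

text \<open>Forms from the two classes can coexist in a code only as complementary pairs.\<close>

lemma paths_cross:
  "\<forall>s\<in>set paths. \<forall>t\<in>set swapped_paths. card (graph (bxor s t)) mod 4 = 2 \<longrightarrow>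
    (s, t) \<in> set (zip paths (map (bxor one_bits) paths))"
  by code_simp

section \<open>Spans and cosets of the affine words\<close>

fun span :: "nat set list \<Rightarrow> nat set set" where
  "span [] = {{}}"
| "span (r # rs) = span rs \<union> vadd r ` span rs"

lemma card_span: "finite (span rs) \<and> card (span rs) \<le> 2 ^ length rs"
proof (induction rs)
  case (Cons r rs)
  then have "card (span (r # rs)) \<le> card (span rs) + card (vadd r ` span rs)"
    by (simp add: card_Un_le)
  also have "\<dots> \<le> 2 ^ length (r # rs)" using Cons by (simp add: card_image)
  finally show ?case using Cons by simp
qed simp

lemma span_subset:
  assumes "{} \<in> S" "\<And>x y. x \<in> S \<Longrightarrow> y \<in> S \<Longrightarrow> vadd x y \<in> S" "set rs \<subseteq> S"
  shows "span rs \<subseteq> S"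
  using assms(3) by (induction rs) (use assms(1,2) in auto)

lemma span_if: "y \<in> span rs \<Longrightarrow> vadd (if P then r else {}) y \<in> span (r # rs)"
  by auto

definition affine_words :: "nat set set" where
  "affine_words = span [{..<16}, H 0, H 1, H 2, H 3]"

definition std_code :: "bits set \<Rightarrow> nat set set" where
  "std_code S = (\<Union>s\<in>S. vadd (graph s) ` affine_words)"

lemma card_affine_words: "finite affine_words" "card affine_words \<le> 32"
  using card_span[of "[{..<16}, H 0, H 1, H 2, H 3]"] by (simp_all add: affine_words_def)

text \<open>Against 256 = 8 * 32 words in \<open>D\<close>, these bounds turn an inclusion of
  \<open>D\<close> in at most eight cosets into an equality, and show that fewer than eight cannot
  hold \<open>D\<close>.\<close>

lemma card_std_code:
  assumes "finite S"
  shows "finite (std_code S)" "card (std_code S) \<le> card S * 32"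
proof -
  show "finite (std_code S)" using assms card_affine_words by (simp add: std_code_def)
  have "card (std_code S) \<le> (\<Sum>s\<in>S. card (vadd (graph s) ` affine_words))"
    unfolding std_code_def by (rule card_UN_le[OF assms])
  also have "\<dots> \<le> (\<Sum>s\<in>S. 32)"
    using card_affine_words by (intro sum_mono) (simp add: card_image)
  finally show "card (std_code S) \<le> card S * 32" by simp
qed

text \<open>For an explicit list the fold unfolds to a propositional equation between
  memberships.\<close>

lemma even_card_inter_list:
  "distinct xs \<Longrightarrow> even (card (set xs \<inter> y)) \<longleftrightarrow> foldr (\<lambda>x e. (x \<in> y) \<noteq> e) xs True"
  by (induction xs) (auto simp: Int_insert_left)

lemma graph_eq_empty: "\<forall>s. graph s = {} \<longrightarrow> s = zero_bits"
  by code_simp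

lemma bxor_simps [simp]: "bxor s s = zero_bits" "bxor s zero_bits = s" "bxor s (bxor s t) = t"
  by (cases s; cases t; auto simp: zero_bits_def)+

lemma bxor_eq_zero: "bxor s t = zero_bits \<longleftrightarrow> s = t"
  by (cases s; cases t; auto simp: zero_bits_def)

text \<open>The parity checks for \<open>normalized_graph\<close>: for each binary digit the points
  where it vanishes, and the points with an odd sum of the lowest three digits.\<close>

lemma H_words:
  "vadd {..<16} (H 0) = set [0, 2, 4, 6, 8, 10, 12, 14]"
  "vadd {..<16} (H 1) = set [0, 1, 4, 5, 8, 9, 12, 13]"
  "vadd {..<16} (H 2) = set [0, 1, 2, 3, 8, 9, 10, 11]"
  "vadd {..<16} (H 3) = set [0, 1, 2, 3, 4, 5, 6, 7]"
  "vadd (H 0) (vadd (H 1) (H 2)) = set [1, 2, 4, 7, 9, 10, 12, 15]"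
  unfolding H_def vadd_def by code_simp+

lemma complement_base: "vadd {..<16} {0, 1, 2, 4, 8, 15} = graph one_bits"
  unfolding vadd_def one_bits_def by code_simp

section \<open>Words of a framed code modulo the affine words\<close>

context framed_code begin

lemma affine_words_R: "affine_words \<subseteq> R"
  unfolding affine_words_def
proof (rule span_subset)
  show "{} \<in> R" by (simp add: R_def)
  show "set [{..<16}, H 0, H 1, H 2, H 3] \<subseteq> R" using full_in_R H by simp
qed (rule R_vadd)

lemma normalize:
  assumes x: "x \<in> D"
  obtains r where "r \<in> affine_words" "vadd x r \<inter> {0, 1, 2, 4, 8} = {}"
proof -
  \<comment> \<open>The affine function agreeing with \<open>x\<close> at the origin and the unit
    vectors: the value at 0 is the constant term, and the differences to it are the linear
    coefficients.\<close>
  define r where "r = vadd (if 0 \<in> x then {..<16} else {})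
    (vadd (if (1 \<in> x) \<noteq> (0 \<in> x) then H 0 else {}) (vadd (if (2 \<in> x) \<noteq> (0 \<in> x) then H 1 else {})
    (vadd (if (4 \<in> x) \<noteq> (0 \<in> x) then H 2 else {}) (vadd (if (8 \<in> x) \<noteq> (0 \<in> x) then H 3 else {}) {}))))"
  have "r \<in> affine_words"
    unfolding r_def affine_words_def by (intro span_if) simp
  moreover have "i \<in> x \<longleftrightarrow> i \<in> r" if "i \<in> {0, 1, 2, 4, 8}" for i
  proof -
    have if_mem: "i \<in> (if P then z else {}) \<longleftrightarrow> P \<and> i \<in> z" for P i and z :: "nat set" by simp
    show ?thesis
      using that unfolding r_def in_vadd if_mem by (elim insertE emptyE) (cases "0 \<in> x"; simp add: H_def)+
  qed
  then have "vadd x r \<inter> {0, 1, 2, 4, 8} = {}" by (auto simp del: insert_iff)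
  ultimately show thesis by (rule that)
qed

text \<open>Orthogonality to the affine functions means degree at most two, and vanishing at the
  origin and the unit vectors removes the affine part. The coefficients are the values at the points
  with two digits 1, namely 3, 5, 6, 9, 10 and 12.\<close>

lemma normalized_graph:
  assumes y: "y \<in> D" "y \<inter> {0, 1, 2, 4, 8} = {}"
  obtains s where "y = graph s"
proof -
  have orth: "foldr (\<lambda>x e. (x \<in> y) \<noteq> e) xs True" if "set xs \<in> R" "distinct xs" for xs
    using even_card_inter_list[OF that(2), of y] R_orthogonal[OF that(1) y(1)] by (simp add: Int_commute)
  have R: "set [0, 2, 4, 6, 8, 10, 12, 14] \<in> R" "set [0, 1, 4, 5, 8, 9, 12, 13] \<in> R"
    "set [0, 1, 2, 3, 8, 9, 10, 11] \<in> R" "set [0, 1, 2, 3, 4, 5, 6, 7] \<in> R"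
    "set [1, 2, 4, 7, 9, 10, 12, 15] \<in> R"
    unfolding H_words[symmetric] using full_in_R H by (intro R_vadd; simp)+
  have n: "0 \<notin> y" "1 \<notin> y" "2 \<notin> y" "4 \<notin> y" "8 \<notin> y" using y(2) by auto
  have p: "14 \<in> y \<longleftrightarrow> (6 \<in> y) \<noteq> ((10 \<in> y) \<noteq> (12 \<in> y))"
    "13 \<in> y \<longleftrightarrow> (5 \<in> y) \<noteq> ((9 \<in> y) \<noteq> (12 \<in> y))"
    "11 \<in> y \<longleftrightarrow> (3 \<in> y) \<noteq> ((9 \<in> y) \<noteq> (10 \<in> y))"
    "7 \<in> y \<longleftrightarrow> (3 \<in> y) \<noteq> ((5 \<in> y) \<noteq> (6 \<in> y))"
    using orth[OF R(1)] orth[OF R(2)] orth[OF R(3)] orth[OF R(4)] n by auto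
  have p15: "15 \<in> y \<longleftrightarrow> (3 \<in> y) \<noteq> ((5 \<in> y) \<noteq> ((6 \<in> y) \<noteq> ((9 \<in> y) \<noteq> ((10 \<in> y) \<noteq> (12 \<in> y)))))"
    using orth[OF R(5)] n p(4)
    by (cases "3 \<in> y"; cases "5 \<in> y"; cases "6 \<in> y"; cases "9 \<in> y"; cases "10 \<in> y"; simp)
  let ?L = "{3, 5, 6, 7, 9, 10, 11, 12, 13, 14, 15}"
  let ?s = "(3 \<in> y, 5 \<in> y, 6 \<in> y, 9 \<in> y, 10 \<in> y, 12 \<in> y)"
  have L: "y \<subseteq> ?L"
  proof
    fix i assume i: "i \<in> y"
    then have "i < 16" using in_vectors[OF y(1)] by (auto simp: vectors_def)
    moreover have "i \<notin> {0, 1, 2, 4, 8}" using y(2) i by blast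
    ultimately show "i \<in> ?L" unfolding insert_iff empty_iff by presburger
  qed
  have "i \<in> y \<longleftrightarrow> i \<in> graph ?s" for i
  proof (cases "i \<in> ?L")
    case True
    then show ?thesis unfolding in_graph using p p15 by (elim insertE emptyE) simp_all
  next
    case False
    then have "i \<notin> y" using L by blast
    moreover have "i \<notin> graph ?s" using False unfolding in_graph by auto
    ultimately show ?thesis by simp
  qed
  then have "y = graph ?s" by blast
  then show thesis by (rule that)
qed

text \<open>A nonzero form in \<open>R\<close> would have weight 8, and its complement would contain
  the points 0, 1, 2, 4, 8. By \<open>quad_in_eight\<close> these contain a quad, yet they lie in
  the base word of weight 6.\<close>

lemma graph_in_R:
  assumes "graph s \<in> R"
  shows "s = zero_bits"
proof (rule ccontr)
  assume "s \<noteq> zero_bits"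
  then have ne: "graph s \<noteq> {}" using graph_eq_empty by blast
  obtain a b c d e f where s: "s = (a, b, c, d, e, f)" by (cases s)
  have out: "0 \<notin> graph s" "1 \<notin> graph s" "2 \<notin> graph s" "4 \<notin> graph s" "8 \<notin> graph s"
    unfolding s in_graph by simp_all
  have "0 \<in> {..<16::nat}" by simp
  then have "graph s \<noteq> {..<16}" using out(1) by metis
  then have 8: "card (graph s) = 8" using R_card[OF assms ne] by simp
  have sub: "graph s \<subseteq> {..<16}" using R_vectors[OF assms] by (simp add: vectors_def)
  let ?b = "vadd {..<16} (graph s)"
  have "?b \<in> R" using full_in_R assms by (rule R_vadd)
  moreover have "card ?b = 8"
    using 8 sub R_vectors[OF assms] by (simp add: compl_eq_vadd card_Diff_subset finite_subset)
  ultimately have "?b \<in> eights" using R_subset_D by (simp add: eights_def)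
  moreover have "{0, 1, 2, 4, 8} \<subseteq> ?b" using out by simp
  ultimately obtain q where "q \<in> quads" "q \<subseteq> {0, 1, 2, 4, 8}" by (rule quad_in_eight) simp
  then have "{0, 1, 2, 4, 8, 15} \<notin> sixes q" by (auto simp: quads_def)
  then show False using base \<open>q \<subseteq> _\<close> by (auto simp: sixes_def)
qed

text \<open>In the translate by \<open>graph s\<close>, words of weight divisible by 4 lie in the
  translated \<open>R\<close>, hence in \<open>R\<close>, which contains no nonzero form.\<close>

lemma graph_difference:
  assumes "graph s \<in> D" "graph t \<in> D" "s \<noteq> t"
  shows "card (graph (bxor s t)) mod 4 = 2"
proof -
  interpret T: nr_code "vadd (graph s) ` D" by (rule translate[OF assms(1)])
  have u: "graph (bxor s t) \<in> vadd (graph s) ` D"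
    unfolding graph_vadd[symmetric] using assms(2) by (rule imageI)
  have "graph (bxor s t) \<notin> T.R"
    using R_translate_subset[OF assms(1)] graph_in_R assms(3) bxor_eq_zero by blast
  then have "\<not> 4 dvd card (graph (bxor s t))" using T.R_iff[OF u] by simp
  then show ?thesis using T.even_card[OF u] by presburger
qed

text \<open>The case to exclude is a mixture of the two classes of paths. Every path and every
  swapped path in \<open>N\<close> are complementary, so a mixed \<open>N\<close> has at most four
  elements, whereas 256 codewords require eight.\<close>

lemma classification:
  "D = std_code ({zero_bits, one_bits} \<union> set paths) \<or> D = std_code ({zero_bits, one_bits} \<union> set swapped_paths)"
proof -
  define N where "N = {s. graph s \<in> D}"
  have DN: "D \<subseteq> std_code S" if S: "N \<subseteq> S" for S
  proof
    fix x assume x: "x \<in> D"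
    obtain r where r: "r \<in> affine_words" "vadd x r \<inter> {0, 1, 2, 4, 8} = {}" by (rule normalize[OF x])
    then have "vadd x r \<in> D" using D_vadd_R[OF x] affine_words_R by blast
    then obtain s where s: "vadd x r = graph s" using normalized_graph r(2) by blast
    then have "s \<in> S" using S \<open>vadd x r \<in> D\<close> by (auto simp: N_def)
    moreover have "x = vadd (graph s) r" using s by (metis vadd_cancel'(1))
    ultimately show "x \<in> std_code S" using r(1) by (auto simp: std_code_def)
  qed
  have eq: "D = std_code S" if "N \<subseteq> S" "finite S" "card S \<le> 8" for S
    using card_std_code[OF that(2)] that(3) DN[OF that(1)] card_D by (intro card_seteq) auto
  have big: "8 \<le> card S" if "N \<subseteq> S" "finite S" for S
  proof -
    have "256 \<le> card (std_code S)"
      using card_mono[OF card_std_code(1)[OF that(2)] DN[OF that(1)]] card_D by simp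
    then show ?thesis using card_std_code(2)[OF that(2)] by simp
  qed
  have g0: "graph zero_bits = {}" unfolding zero_bits_def by simp
  have zero_N: "zero_bits \<in> N" using zero by (simp add: N_def g0)
  have one_N: "one_bits \<in> N"
    unfolding N_def using D_vadd_R[OF base full_in_R] complement_base by (simp add: vadd_commute)
  have sub: "s = zero_bits \<or> s = one_bits \<or> s \<in> set paths \<or> s \<in> set swapped_paths" if "s \<in> N" for s
  proof (rule ccontr)
    assume neg: "\<not> ?thesis"
    have gs: "graph s \<in> D" "graph zero_bits \<in> D" "graph one_bits \<in> D"
      using that zero_N one_N by (simp_all only: N_def mem_Collect_eq)
    have "card (graph (bxor s zero_bits)) mod 4 = 2" "card (graph (bxor s one_bits)) mod 4 = 2"
      using graph_difference gs neg by blast+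
    then show False using paths_enum neg by (metis Un_iff bxor_simps(2))
  qed
  have cross: "t = bxor one_bits s" if "s \<in> N \<inter> set paths" "t \<in> N \<inter> set swapped_paths" for s t
  proof -
    have "s \<noteq> t" using paths_disjoint that by blast
    then have "card (graph (bxor s t)) mod 4 = 2" using that graph_difference by (auto simp: N_def)
    then have "(s, t) \<in> set (zip paths (map (bxor one_bits) paths))" using paths_cross that by blast
    then show ?thesis by (auto simp: zip_map2 zip_same_conv_map)
  qed
  have card8: "card ({zero_bits, one_bits} \<union> set P) \<le> 8" if "length P = 6" for P
  proof -
    have "card ({zero_bits, one_bits} \<union> set P) \<le> card {zero_bits, one_bits} + card (set P)" by (rule card_Un_le)
    moreover have "card {zero_bits, one_bits} \<le> 2" by (simp add: card_insert_if)
    ultimately show ?thesis using card_length[of P] that by linarith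
  qed
  have len: "length paths = 6" "length swapped_paths = 6" by (simp_all add: paths_def swapped_paths_def)
  show ?thesis
  proof (cases "N \<inter> set swapped_paths = {}")
    case True
    then have "N \<subseteq> {zero_bits, one_bits} \<union> set paths" using sub by blast
    then show ?thesis using eq card8[OF len(1)] by blast
  next
    case False
    then obtain t where t: "t \<in> N \<inter> set swapped_paths" by blast
    show ?thesis
    proof (cases "N \<inter> set paths = {}")
      case True
      then have "N \<subseteq> {zero_bits, one_bits} \<union> set swapped_paths" using sub by blast
      then show ?thesis using eq card8[OF len(2)] by blast
    next
      case False
      then obtain s where s: "s \<in> N \<inter> set paths" by blast
      have "N \<subseteq> {zero_bits, one_bits, s, t}"
      proof
        fix u assume u: "u \<in> N"
        have "u = t" if "u \<in> set swapped_paths" using cross[OF s, of u] cross[OF s t] u that by simp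
        moreover have "u = s" if "u \<in> set paths"
          using cross[OF s t] cross[OF _ t, of u] u that by (metis IntI bxor_simps(3))
        ultimately show "u \<in> {zero_bits, one_bits, s, t}" using sub[OF u] by blast
      qed
      then have "8 \<le> card {zero_bits, one_bits, s, t}" by (rule big) simp
      moreover have "card {zero_bits, one_bits, s, t} \<le> 4"
        using card_length[of "[zero_bits, one_bits, s, t]"] by simp
      ultimately show ?thesis by simp
    qed
  qed
qed

end

section \<open>Homogeneity\<close>

text \<open>Exchanges the binary digits of place value 4 and 8. It fixes 0, 1, 2 and 3, so it can
  correct the class of the code in \<open>homogeneous\<close> without disturbing the prescribed
  labels.\<close>

definition coord_swap :: "nat \<Rightarrow> nat" where
  "coord_swap = transpose 4 8 \<circ> transpose 5 9 \<circ> transpose 6 10 \<circ> transpose 7 11"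

lemma coord_swap_permutes: "coord_swap permutes {..<16}"
  unfolding coord_swap_def by (intro permutes_compose permutes_swap_id) simp_all

lemma coord_swap_simps [simp]:
  "coord_swap 0 = 0" "coord_swap 1 = 1" "coord_swap (Suc 0) = 1" "coord_swap 2 = 2" "coord_swap 3 = 3"
  "coord_swap 4 = 8" "coord_swap 5 = 9" "coord_swap 6 = 10" "coord_swap 7 = 11"
  "coord_swap 8 = 4" "coord_swap 9 = 5" "coord_swap 10 = 6" "coord_swap 11 = 7"
  "coord_swap 12 = 12" "coord_swap 13 = 13" "coord_swap 14 = 14" "coord_swap 15 = 15"
  by (simp_all add: coord_swap_def transpose_def)

lemma coord_swap_graph: "\<forall>s. coord_swap ` graph s = graph (swap_bits s)"
  unfolding coord_swap_def transpose_def by code_simp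

lemma coord_swap_H: "coord_swap ` H 0 = H 0" "coord_swap ` H 1 = H 1" "coord_swap ` H 2 = H 3" "coord_swap ` H 3 = H 2"
  unfolding coord_swap_def transpose_def H_def by code_simp+

lemma span_vadd:
  "x \<in> span rs \<Longrightarrow> y \<in> span rs \<Longrightarrow> vadd x y \<in> span rs"
proof (induction rs arbitrary: x y)
  case (Cons r rs)
  have *: "z \<in> span (r # rs) \<longleftrightarrow> z \<in> span rs \<or> vadd r z \<in> span rs" for z
    by (auto simp: image_iff) (metis vadd_cancel)
  have "vadd r (vadd x y) = vadd (vadd r x) y" "vadd r (vadd x y) = vadd x (vadd r y)"
    "vadd x y = vadd (vadd r x) (vadd r y)" by auto
  then show ?case using Cons unfolding * by metis
qed simp

lemma empty_in_span [simp]: "{} \<in> span rs"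
  by (induction rs) auto

lemma in_span: "r \<in> set rs \<Longrightarrow> r \<in> span rs"
  by (induction rs) (auto simp: image_iff intro: bexI[of _ "{}"])

lemma span_mono: "set rs \<subseteq> span ss \<Longrightarrow> span rs \<subseteq> span ss"
  using span_vadd by (intro span_subset) auto

lemma foldr_in_span: "set xs \<subseteq> set rs \<Longrightarrow> foldr vadd xs {} \<in> span rs"
  by (induction xs) (auto intro: span_vadd in_span)

lemma image_span:
  assumes "\<And>x y. f (vadd x y) = vadd (f x) (f y)"
  shows "f ` span rs = span (map f rs)"
proof (induction rs)
  case Nil
  have "f {} = {}" using assms[of "{}" "{}"] by simp
  then show ?case by simp
next
  case (Cons r rs)
  have "f ` vadd r ` span rs = vadd (f r) ` f ` span rs" by (simp add: image_image assms)
  then show ?case using Cons by (simp add: image_Un)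
qed

lemma coord_swap_affine_words: "(`) coord_swap ` affine_words = affine_words"
proof -
  have inj: "inj coord_swap" using coord_swap_permutes by (rule permutes_inj)
  have "(`) coord_swap ` affine_words = span [{..<16}, H 0, H 1, H 3, H 2]"
    unfolding affine_words_def image_span[of "(`) coord_swap", OF image_vadd[OF inj]]
    by (simp add: coord_swap_H coord_swap_H(2)[unfolded One_nat_def] permutes_image[OF coord_swap_permutes])
  also have "\<dots> = affine_words"
    unfolding affine_words_def by (intro equalityI span_mono) (auto intro!: in_span)
  finally show ?thesis .
qed

abbreviation standard_code :: "nat set set" where
  "standard_code \<equiv> std_code ({zero_bits, one_bits} \<union> set paths)"

lemma coord_swap_std_code:
  "(`) coord_swap ` std_code ({zero_bits, one_bits} \<union> set swapped_paths) = standard_code"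
proof -
  have inj: "inj coord_swap" using coord_swap_permutes by (rule permutes_inj)
  have img: "(`) coord_swap ` vadd (graph s) ` affine_words = vadd (graph (swap_bits s)) ` affine_words" for s
  proof -
    have "(`) coord_swap ` vadd (graph s) ` affine_words
        = vadd (coord_swap ` graph s) ` (`) coord_swap ` affine_words"
      by (simp add: image_image image_vadd[OF inj])
    then show ?thesis by (simp only: coord_swap_graph[rule_format] coord_swap_affine_words)
  qed
  have "swap_bits ` ({zero_bits, one_bits} \<union> set swapped_paths) = {zero_bits, one_bits} \<union> set paths"
    by code_simp
  then show ?thesis
    unfolding std_code_def image_UN img by (metis (no_types, lifting) SUP_cong image_image)
qed

lemma (in nr_code) homogeneous:
  assumes p: "p0 < 16" "p1 < 16" "p2 < 16" "distinct [p0, p1, p2]"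
  obtains \<phi> where "\<phi> permutes {..<16}" "(`) \<phi> ` D = standard_code" "\<phi> p0 = 0" "\<phi> p1 = 1" "\<phi> p2 = 2"
    "\<forall>x. {p0, p1, p2, x} \<in> quads \<longrightarrow> \<phi> x = 3"
proof -
  have t: "{p0, p1, p2} \<in> vectors 16" "card {p0, p1, p2} = 3" using p by auto
  then have "sixes {p0, p1, p2} \<noteq> {}" using card_sixes[OF t] by force
  then obtain c where c: "c \<in> D" "card c = 6" "{p0, p1, p2} \<subseteq> c" by (auto simp: sixes_def)
  have "card (c - {p0, p1, p2}) = 3" using c t(2) by (simp add: card_Diff_subset)
  then obtain p3 p4 p5 where q: "c - {p0, p1, p2} = {p3, p4, p5}" and ne: "p3 \<noteq> p4" "p3 \<noteq> p5" "p4 \<noteq> p5"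
    unfolding card_3_iff by metis
  have "c = {p0, p1, p2} \<union> (c - {p0, p1, p2})" using c(3) by (simp only: Diff_partition)
  then have "c = {p0, p1, p2} \<union> {p3, p4, p5}" by (simp only: q)
  then have ce: "{p0, p1, p2, p3, p4, p5} \<in> D" using c(1) by (simp add: insert_commute)
  have "p3 \<in> c - {p0, p1, p2}" "p4 \<in> c - {p0, p1, p2}" "p5 \<in> c - {p0, p1, p2}" by (simp_all only: q insert_iff simp_thms)
  then have d: "distinct [p0, p1, p2, p3, p4, p5]" using p(4) ne by auto
  obtain \<phi> where \<phi>: "\<phi> permutes {..<16}" "framed_code ((`) \<phi> ` D)" "\<phi> p0 = 0" "\<phi> p1 = 1" "\<phi> p2 = 2"
    "\<forall>x. {p0, p1, p2, x} \<in> quads \<longrightarrow> \<phi> x = 3"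
    by (rule frame[OF ce d])
  show thesis
  proof (cases "(`) \<phi> ` D = standard_code")
    case True
    show thesis by (rule that[OF \<phi>(1) True \<phi>(3-6)])
  next
    case False
    then have B: "(`) \<phi> ` D = std_code ({zero_bits, one_bits} \<union> set swapped_paths)"
      using framed_code.classification[OF \<phi>(2)] by blast
    show thesis
    proof (rule that)
      show "coord_swap \<circ> \<phi> permutes {..<16}" using \<phi>(1) coord_swap_permutes by (rule permutes_compose)
      show "(`) (coord_swap \<circ> \<phi>) ` D = standard_code"
        unfolding coord_swap_std_code[symmetric] B[symmetric] by (simp add: image_image image_comp)
      show "\<forall>x. {p0, p1, p2, x} \<in> quads \<longrightarrow> (coord_swap \<circ> \<phi>) x = 3"
        using \<phi>(6) by simp
    qed (use \<phi> in simp_all)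
  qed
qed

section \<open>The Nordstrom-Robinson code\<close>

lemma xsum_insert:
  assumes "finite S" "r \<notin> S"
  shows "xsum (insert r S) = vadd r (xsum S)"
proof (rule set_eqI)
  fix i
  have "{s \<in> insert r S. i \<in> s} = (if i \<in> r then insert r {s \<in> S. i \<in> s} else {s \<in> S. i \<in> s})" by auto
  then show "i \<in> xsum (insert r S) \<longleftrightarrow> i \<in> vadd r (xsum S)" using assms by (simp add: xsum_def)
qed

text \<open>Connects subset sums over a set of rows with spans of lists, which allow induction.
  Distinctness makes subsets of the set correspond to selections from the list.\<close>

lemma span_eq_xsum: "distinct rs \<Longrightarrow> span rs = xsum ` Pow (set rs)"
proof (induction rs)
  case (Cons r rs)
  have "xsum ` Pow (set (r # rs)) = xsum ` Pow (set rs) \<union> (\<lambda>S. xsum (insert r S)) ` Pow (set rs)"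
    by (simp add: Pow_insert image_Un image_image)
  also have "(\<lambda>S. xsum (insert r S)) ` Pow (set rs) = (\<lambda>S. vadd r (xsum S)) ` Pow (set rs)"
  proof (rule image_cong[OF refl])
    fix S assume "S \<in> Pow (set rs)"
    then have S: "S \<subseteq> set rs" by simp
    then have "finite S" by (rule finite_subset) simp
    moreover have "r \<notin> S" using S Cons.prems by auto
    ultimately show "xsum (insert r S) = vadd r (xsum S)" by (rule xsum_insert)
  qed
  finally show ?case using Cons by (simp add: image_image)
qed (simp add: xsum_def)

definition golay_list :: "nat set list" where
  "golay_list = [{0, 1, 2, 3, 4, 5, 6, 7, 8, 9, 10, 11, 12, 13, 14, 15, 16, 17, 18, 19, 20, 21, 22,
      23}, {0, 1, 2, 3, 4, 5, 6, 7}, {0, 2, 4, 6, 8, 9, 10, 12}, {2, 4, 5, 6, 10, 11, 13, 14}, {0, 1, 5,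
      6, 8, 10, 11, 15}, {0, 3, 4, 6, 8, 11, 13, 16}, {1, 4, 5, 6, 8, 9, 13, 17}, {1, 3, 4, 6, 9, 10, 11,
      18}, {2, 3, 5, 6, 8, 9, 11, 19}, {0, 1, 2, 3, 4, 5, 8, 9, 10, 11, 13, 20}, {1, 2, 3, 6, 8, 10, 13,
      21}, {0, 3, 5, 6, 9, 10, 13, 22}]"

text \<open>A basis of the Golay code adapted to the octad {0..7}: the first seven words meet it in {i, 7},
  the others are disjoint from it. They are chosen with the images listed in nr_map_words.\<close>

definition pair_words :: "nat set list" where
  "pair_words = [{0, 7, 10, 14, 16, 18, 21, 23}, {1, 7, 11, 14, 16, 17, 19, 21}, {2, 7, 10, 11, 14,
      16, 20, 22}, {3, 7, 16, 18, 19, 20, 21, 22}, {4, 7, 10, 11, 14, 17, 18, 19, 20, 21, 22, 23}, {5, 7,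
      11, 16, 17, 18, 22, 23}, {6, 7, 10, 16, 17, 19, 20, 23}]"

definition disjoint_words :: "nat set list" where
  "disjoint_words = [{8, 9, 10, 11, 12, 13, 14, 15, 16, 17, 18, 19, 20, 21, 22, 23}, {9, 10, 11, 16,
      17, 18, 20, 21}, {10, 11, 12, 16, 19, 21, 22, 23}, {11, 14, 15, 16, 18, 19, 20, 23}, {13, 14, 16,
      17, 20, 21, 22, 23}]"

lemma map_foldr_in_span:
  assumes "\<forall>is\<in>set iss. \<forall>i\<in>set is. i < length B"
  shows "set (map (\<lambda>is. foldr vadd (map ((!) B) is) {}) iss) \<subseteq> span B"
proof -
  have "foldr vadd (map ((!) B) is) {} \<in> span B" if "is \<in> set iss" for "is"
    using assms that by (intro foldr_in_span) auto
  then show ?thesis by auto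
qed

lemma golay_eq_span: "golay = span (pair_words @ disjoint_words)"
proof -
  let ?B = "pair_words @ disjoint_words"
  have "golay_rows = set golay_list"
    unfolding golay_list_def golay_rows_def by code_simp
  moreover have "distinct golay_list" unfolding golay_list_def by code_simp
  ultimately have "golay = span golay_list" using span_eq_xsum by (simp add: golay_def)
  also have "\<dots> = span ?B"
  proof (intro equalityI span_mono)
    \<comment> \<open>The index lists here and below are the rows of the two change-of-basis
      matrices; evaluation confirms them.\<close>
    have "golay_list = map (\<lambda>is. foldr vadd (map ((!) ?B) is) {}) [[0, 1, 2, 3, 4, 5, 6, 7], [0,
        1, 2, 3, 4, 5, 6], [0, 2, 4, 6, 7, 10, 11], [2, 4, 5, 6, 11], [0, 1, 5, 6, 7, 8, 9, 11], [0, 3, 4,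
        6, 7, 8, 9, 10], [1, 4, 5, 6, 7, 9, 10], [1, 3, 4, 6, 8], [2, 3, 5, 6, 7, 9, 10, 11], [0, 1, 2, 3,
        4, 5, 7, 9, 10], [1, 2, 3, 6, 7, 8, 9, 10], [0, 3, 5, 6, 8, 11]]"
      unfolding golay_list_def pair_words_def disjoint_words_def vadd_def by code_simp
    moreover have "set (map (\<lambda>is. foldr vadd (map ((!) ?B) is) {}) [[0, 1, 2, 3, 4, 5, 6, 7],
        [0, 1, 2, 3, 4, 5, 6], [0, 2, 4, 6, 7, 10, 11], [2, 4, 5, 6, 11], [0, 1, 5, 6, 7, 8, 9, 11], [0, 3,
        4, 6, 7, 8, 9, 10], [1, 4, 5, 6, 7, 9, 10], [1, 3, 4, 6, 8], [2, 3, 5, 6, 7, 9, 10, 11], [0, 1, 2,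
        3, 4, 5, 7, 9, 10], [1, 2, 3, 6, 7, 8, 9, 10], [0, 3, 5, 6, 8, 11]]) \<subseteq> span ?B"
      by (rule map_foldr_in_span) (simp add: pair_words_def disjoint_words_def)
    ultimately show "set golay_list \<subseteq> span ?B" by (simp only:)
    have "?B = map (\<lambda>is. foldr vadd (map ((!) golay_list) is) {}) [[0, 2, 4, 6, 8, 9, 11], [1,
        3, 5, 6, 8, 10], [1, 3, 5, 9, 11], [1, 5, 7, 8, 9, 10, 11], [0, 2, 4, 5], [0, 2, 3, 4, 8, 9, 10],
        [0, 2, 3, 4, 7, 10, 11], [0, 1], [5, 6, 7, 9, 10], [0, 1, 3, 4, 6, 7, 9], [0, 1, 2, 6, 10, 11], [0,
        1, 2, 4, 7, 8]]"
      unfolding golay_list_def pair_words_def disjoint_words_def vadd_def by code_simp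
    moreover have "set (map (\<lambda>is. foldr vadd (map ((!) golay_list) is) {}) [[0, 2, 4, 6, 8, 9,
        11], [1, 3, 5, 6, 8, 10], [1, 3, 5, 9, 11], [1, 5, 7, 8, 9, 10, 11], [0, 2, 4, 5], [0, 2, 3, 4, 8,
        9, 10], [0, 2, 3, 4, 7, 10, 11], [0, 1], [5, 6, 7, 9, 10], [0, 1, 3, 4, 6, 7, 9], [0, 1, 2, 6, 10,
        11], [0, 1, 2, 4, 7, 8]]) \<subseteq> span golay_list"
      by (rule map_foldr_in_span) (simp add: golay_list_def)
    ultimately show "set ?B \<subseteq> span golay_list" by (simp only:)
  qed
  finally show ?thesis .
qed

lemma span_append: "x \<in> span (rs @ ss) \<longleftrightarrow> (\<exists>y\<in>span rs. \<exists>z\<in>span ss. x = vadd y z)"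
proof (induction rs arbitrary: x)
  case (Cons r rs)
  have mem: "x \<in> span (r # ts) \<longleftrightarrow> x \<in> span ts \<or> vadd r x \<in> span ts" for x ts
    by (auto simp: image_iff) (metis vadd_cancel)
  show ?case (is "?l \<longleftrightarrow> ?r")
  proof
    assume ?l
    then have "x \<in> span (rs @ ss) \<or> vadd r x \<in> span (rs @ ss)" using mem by simp
    then show ?r
    proof
      assume "vadd r x \<in> span (rs @ ss)"
      then obtain y z where "y \<in> span rs" "z \<in> span ss" "vadd r x = vadd y z" using Cons by blast
      then have "vadd r y \<in> span (r # rs)" "x = vadd (vadd r y) z"
        by (auto simp only: span.simps vadd_assoc vadd_cancel) (metis vadd_cancel vadd_assoc)+
      then show ?r using \<open>z \<in> span ss\<close> by blast
    qed (use Cons in auto)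
  next
    assume ?r
    then obtain y z where yz: "y \<in> span (r # rs)" "z \<in> span ss" "x = vadd y z" by blast
    then have "y \<in> span rs \<or> vadd r y \<in> span rs" using mem by blast
    moreover have "vadd r x = vadd (vadd r y) z" using yz(3) by (simp only: vadd_assoc)
    ultimately have "x \<in> span (rs @ ss) \<or> vadd r x \<in> span (rs @ ss)" using yz Cons by blast
    then show ?l using mem by simp
  qed
qed simp

lemma in_span_Cons: "x \<in> span (r # rs) \<longleftrightarrow> (\<exists>P. \<exists>y\<in>span rs. x = vadd (if P then r else {}) y)"
proof
  assume "x \<in> span (r # rs)"
  then consider "x \<in> span rs" | y where "y \<in> span rs" "x = vadd r y" by auto
  then show "\<exists>P. \<exists>y\<in>span rs. x = vadd (if P then r else {}) y"
  proof cases
    case 1 then show ?thesis by (intro exI[of _ False] bexI[of _ x]) simp_all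
  next
    case 2 then show ?thesis by (intro exI[of _ True] bexI[of _ y]) simp_all
  qed
qed auto

text \<open>A point i \<le> 6 occurs in no pair word except \<open>pair_words ! i\<close>, so the
  points of \<open>x\<close> below 7 are the coefficients of \<open>x\<close>.\<close>

lemma pair_word_cases:
  assumes x: "x \<in> span pair_words"
  shows "x \<inter> {0..7} = {} \<Longrightarrow> x = {}"
    and "i \<in> {0..6} \<Longrightarrow> x \<inter> {0..7} = {i, 7} \<Longrightarrow> x = pair_words ! i"
proof -
  obtain e0 e1 e2 e3 e4 e5 e6 where e: "x = vadd (if e0 then pair_words ! 0 else {})
    (vadd (if e1 then pair_words ! 1 else {}) (vadd (if e2 then pair_words ! 2 else {})
    (vadd (if e3 then pair_words ! 3 else {}) (vadd (if e4 then pair_words ! 4 else {})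
    (vadd (if e5 then pair_words ! 5 else {}) (vadd (if e6 then pair_words ! 6 else {}) {}))))))"
  proof -
    have "pair_words = [pair_words ! 0, pair_words ! 1, pair_words ! 2, pair_words ! 3,
        pair_words ! 4, pair_words ! 5, pair_words ! 6]"
      by (simp add: pair_words_def)
    then have "x \<in> span [pair_words ! 0, pair_words ! 1, pair_words ! 2, pair_words ! 3,
        pair_words ! 4, pair_words ! 5, pair_words ! 6]"
      using x by simp
    then obtain c0 y0 where 0: "y0 \<in> span [pair_words ! 1, pair_words ! 2, pair_words ! 3,
        pair_words ! 4, pair_words ! 5, pair_words ! 6]" "x = vadd (if c0 then pair_words ! 0 else {}) y0"
      using in_span_Cons by blast
    from 0(1) obtain c1 y1 where 1: "y1 \<in> span [pair_words ! 2, pair_words ! 3,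
        pair_words ! 4, pair_words ! 5, pair_words ! 6]" "y0 = vadd (if c1 then pair_words ! 1 else {}) y1"
      using in_span_Cons by blast
    from 1(1) obtain c2 y2 where 2: "y2 \<in> span [pair_words ! 3, pair_words ! 4, pair_words ! 5, pair_words ! 6]"
      "y1 = vadd (if c2 then pair_words ! 2 else {}) y2" using in_span_Cons by blast
    from 2(1) obtain c3 y3 where 3: "y3 \<in> span [pair_words ! 4, pair_words ! 5, pair_words ! 6]"
      "y2 = vadd (if c3 then pair_words ! 3 else {}) y3" using in_span_Cons by blast
    from 3(1) obtain c4 y4 where 4: "y4 \<in> span [pair_words ! 5, pair_words ! 6]"
      "y3 = vadd (if c4 then pair_words ! 4 else {}) y4" using in_span_Cons by blast
    from 4(1) obtain c5 y5 where 5: "y5 \<in> span [pair_words ! 6]"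
      "y4 = vadd (if c5 then pair_words ! 5 else {}) y5" using in_span_Cons by blast
    from 5(1) obtain c6 y6 where 6: "y6 \<in> span []"
      "y5 = vadd (if c6 then pair_words ! 6 else {}) y6" using in_span_Cons by blast
    have "y6 = {}" using 6(1) by simp
    from that[OF 0(2)[unfolded 1(2) 2(2) 3(2) 4(2) 5(2) 6(2) this]] show thesis .
  qed
  have if_mem: "i \<in> (if P then z else {}) \<longleftrightarrow> P \<and> i \<in> z" for P i and z :: "nat set" by simp
  have m: "0 \<in> x \<longleftrightarrow> e0" "1 \<in> x \<longleftrightarrow> e1" "2 \<in> x \<longleftrightarrow> e2" "3 \<in> x \<longleftrightarrow> e3" "4 \<in> x \<longleftrightarrow> e4"
    "5 \<in> x \<longleftrightarrow> e5" "6 \<in> x \<longleftrightarrow> e6"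
    unfolding e in_vadd if_mem by (simp_all add: pair_words_def)
  have range: "j \<in> x \<longleftrightarrow> j \<in> x \<inter> {0..7}" if "j \<le> 6" for j using that by auto
  show "x = {}" if "x \<inter> {0..7} = {}"
  proof -
    have "\<not> e0" "\<not> e1" "\<not> e2" "\<not> e3" "\<not> e4" "\<not> e5" "\<not> e6"
      using m range[of 0] range[of 1] range[of 2] range[of 3] range[of 4] range[of 5] range[of 6]
      unfolding that by simp_all
    then show ?thesis using e by simp
  qed
  show "x = pair_words ! i" if i: "i \<in> {0..6}" and xi: "x \<inter> {0..7} = {i, 7}"
  proof -
    have E: "e0 \<longleftrightarrow> i = 0" "e1 \<longleftrightarrow> i = 1" "e2 \<longleftrightarrow> i = 2" "e3 \<longleftrightarrow> i = 3" "e4 \<longleftrightarrow> i = 4" "e5 \<longleftrightarrow> i = 5" "e6 \<longleftrightarrow> i = 6"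
      using m range[of 0] range[of 1] range[of 2] range[of 3] range[of 4] range[of 5] range[of 6]
      unfolding xi by auto
    have "i = 0 \<or> i = 1 \<or> i = 2 \<or> i = 3 \<or> i = 4 \<or> i = 5 \<or> i = 6" using i by auto
    then show ?thesis unfolding e E by (elim disjE) simp_all
  qed
qed

text \<open>The disjoint words vanish on the octad, so the condition in \<open>NR_B\<close> concerns
  only the part spanned by the pair words, for which eight choices remain.\<close>

lemma NR_B_eq: "NR_B = (\<Union>g\<in>set ({} # pair_words). vadd g ` span disjoint_words)"
proof -
  have dis: "z \<inter> {0..7} = {}" if "z \<in> span disjoint_words" for z
  proof -
    have "span disjoint_words \<subseteq> {z. z \<inter> {0..7} = {}}"
    proof (rule span_subset)
      fix x y :: "nat set" assume "x \<in> {z. z \<inter> {0..7} = {}}" "y \<in> {z. z \<inter> {0..7} = {}}"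
      then show "vadd x y \<in> {z. z \<inter> {0..7} = {}}" unfolding vadd_def by blast
    qed (simp_all add: disjoint_words_def)
    then show ?thesis using that by blast
  qed
  have int: "vadd y z \<inter> {0..7} = y \<inter> {0..7}" if "z \<in> span disjoint_words" for y z
    using dis[OF that] by auto
  have pair: "pair_words ! i \<inter> {0..7} = {i, 7} \<and> pair_words ! i \<in> set pair_words" if "i \<in> {0..6}" for i
  proof -
    have "i = 0 \<or> i = 1 \<or> i = 2 \<or> i = 3 \<or> i = 4 \<or> i = 5 \<or> i = 6" using that by auto
    then show ?thesis by (elim disjE) (simp_all add: pair_words_def)
  qed
  have len: "length pair_words = 7" by (simp add: pair_words_def)
  show ?thesis
  proof (intro equalityI subsetI)
    fix a assume "a \<in> NR_B"
    then have a: "a \<in> golay" "a \<inter> {0..7} = {} \<or> (\<exists>i\<in>{0..6}. a \<inter> {0..7} = {i, 7})"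
      by (auto simp: NR_B_def)
    obtain y z where yz: "y \<in> span pair_words" "z \<in> span disjoint_words" "a = vadd y z"
      using a(1) unfolding golay_eq_span span_append by blast
    have "y = {} \<or> y \<in> set pair_words"
      using a(2) pair_word_cases[OF yz(1)] pair unfolding yz(3) int[OF yz(2)] by metis
    then show "a \<in> (\<Union>g\<in>set ({} # pair_words). vadd g ` span disjoint_words)" using yz by auto
  next
    fix a assume "a \<in> (\<Union>g\<in>set ({} # pair_words). vadd g ` span disjoint_words)"
    then obtain g z where g: "g \<in> set ({} # pair_words)" and z: "z \<in> span disjoint_words" "a = vadd g z" by blast
    have gz: "g = {} \<or> g \<in> set pair_words" "z \<in> span disjoint_words" "a = vadd g z" using g z by simp_all
    have "g \<in> span pair_words" using gz(1) in_span by auto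
    then have "a \<in> golay" unfolding golay_eq_span span_append using gz by blast
    moreover have "g \<inter> {0..7} = {} \<or> (\<exists>i\<in>{0..6}. g \<inter> {0..7} = {i, 7})"
    proof -
      have "\<exists>i\<in>{0..6}. g = pair_words ! i" if "g \<in> set pair_words"
        using that len by (auto simp: in_set_conv_nth)
      then show ?thesis using gz(1) pair by blast
    qed
    ultimately show "a \<in> NR_B" unfolding NR_B_def mem_Collect_eq gz(3) int[OF gz(2)] by blast
  qed
qed

text \<open>Found by computer from an affine frame of NR that starts at coordinate 0; fixing 0 makes it
  compatible with puncturing.\<close>

definition nr_perm :: "nat \<Rightarrow> nat" where
  "nr_perm j = (if j < 16 then [0, 1, 3, 7, 2, 8, 12, 4, 15, 9, 5, 6, 13, 11, 10, 14] ! j else j)"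

lemma nr_perm_permutes: "nr_perm permutes {..<16}"
proof -
  have "{..<16} \<subseteq> nr_perm ` {..<16}" unfolding nr_perm_def by code_simp
  then have inj: "inj_on nr_perm {..<16}" by (rule finite_surj_inj[rotated]) simp
  have "nr_perm ` {..<16} \<subseteq> {..<16}" unfolding nr_perm_def by code_simp
  then have "nr_perm ` {..<16} = {..<16}" by (rule endo_inj_surj[OF finite_lessThan _ inj])
  then show ?thesis using inj by (intro bij_imp_permutes) (auto simp: bij_betw_def nr_perm_def)
qed

lemma nr_perm_0: "nr_perm 0 = 0"
  by (simp add: nr_perm_def)

definition nr_map :: "nat set \<Rightarrow> nat set" where
  "nr_map a = nr_perm ` (\<lambda>j. j - 8) ` (a \<inter> {8..23})"

lemma nr_map_vadd: "nr_map (vadd a b) = vadd (nr_map a) (nr_map b)"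
proof -
  have "(\<lambda>j. j - 8) ` (a \<inter> {8..23}) = {i. i < 16 \<and> i + 8 \<in> a}" for a :: "nat set"
  proof (rule set_eqI, rule iffI)
    fix i assume "i \<in> {i. i < 16 \<and> i + 8 \<in> a}"
    then show "i \<in> (\<lambda>j. j - 8) ` (a \<inter> {8..23})" by (intro image_eqI[of _ _ "i + 8"]) auto
  qed auto
  then have "(\<lambda>j. j - 8) ` (vadd a b \<inter> {8..23})
      = vadd ((\<lambda>j. j - 8) ` (a \<inter> {8..23})) ((\<lambda>j. j - 8) ` (b \<inter> {8..23}))" by auto
  then show ?thesis
    unfolding nr_map_def by (simp only: image_vadd[OF permutes_inj[OF nr_perm_permutes]])
qed

text \<open>The Golay words disjoint from the octad become the affine words; zero and the pair words
  become the eight forms of the Kerdock set.\<close>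

lemma nr_map_words:
  "map nr_map disjoint_words = [{..<16}, H 0, H 1, H 2, H 3]"
  "map nr_map ({} # pair_words) = map graph [zero_bits, (True, True, False, False, False, True),
      (False, False, True, True, False, True), (True, False, False, False, True, True), (False, True,
      True, False, True, False), (True, True, True, True, True, True), (False, True, False, True, True,
      False), (True, False, True, True, False, False)]"
  unfolding nr_map_def nr_perm_def disjoint_words_def pair_words_def H_def zero_bits_def by code_simp+

lemma nr_perm_NR: "(`) nr_perm ` NR = standard_code"
proof -
  have "(`) nr_perm ` NR = nr_map ` NR_B" by (simp add: NR_def nr_map_def image_image)
  also have "\<dots> = (\<Union>g\<in>set ({} # pair_words). nr_map ` vadd g ` span disjoint_words)"
    unfolding NR_B_eq by (rule image_UN)
  also have "\<dots> = (\<Union>g\<in>set ({} # pair_words). vadd (nr_map g) ` affine_words)"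
  proof (rule SUP_cong[OF refl])
    fix g
    have "nr_map ` vadd g ` span disjoint_words = vadd (nr_map g) ` nr_map ` span disjoint_words"
      by (simp add: image_image nr_map_vadd)
    then show "nr_map ` vadd g ` span disjoint_words = vadd (nr_map g) ` affine_words"
      by (simp only: image_span[of nr_map, OF nr_map_vadd] nr_map_words(1) affine_words_def)
  qed
  also have "\<dots> = (\<Union>w\<in>set (map nr_map ({} # pair_words)). vadd w ` affine_words)"
    by (simp only: set_map) simp
  also have "\<dots> = (\<Union>s\<in>set [zero_bits, (True, True, False, False, False, True), (False,
      False, True, True, False, True), (True, False, False, False, True, True), (False, True, True, False,
      True, False), (True, True, True, True, True, True), (False, True, False, True, True, False), (True,
      False, True, True, False, False)]. vadd (graph s) ` affine_words)"
    unfolding nr_map_words(2) by (simp only: set_map) simp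
  also have "set [zero_bits, (True, True, False, False, False, True), (False, False, True, True,
      False, True), (True, False, False, False, True, True), (False, True, True, False, True, False),
      (True, True, True, True, True, True), (False, True, False, True, True, False), (True, False, True,
      True, False, False)] = {zero_bits, one_bits} \<union> set paths" by code_simp
  finally show ?thesis by (simp only: std_code_def)
qed

section \<open>Automorphisms and complete transitivity\<close>

lemma AutI: "\<sigma> permutes {..<m} \<Longrightarrow> a \<in> vectors m \<Longrightarrow> (\<lambda>x. vadd (\<sigma> ` x) a) \<in> Aut m"
  unfolding Aut_def by blast

lemma Aut_permutation: "\<sigma> permutes {..<m} \<Longrightarrow> (`) \<sigma> \<in> Aut m"
  using AutI[of \<sigma> m "{}"] by simp

lemma permutes_vectors: "\<sigma> permutes {..<m} \<Longrightarrow> x \<in> vectors m \<Longrightarrow> \<sigma> ` x \<in> vectors m"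
  using permutes_image[of \<sigma> "{..<m}"] unfolding vectors_iff by blast

lemma Aut_vectors: "f \<in> Aut m \<Longrightarrow> x \<in> vectors m \<Longrightarrow> f x \<in> vectors m"
  unfolding Aut_def using permutes_vectors by auto

lemma Aut_hdist:
  assumes "f \<in> Aut m"
  shows "hdist (f x) (f y) = hdist x y"
proof -
  obtain \<sigma> a where \<sigma>: "\<sigma> permutes {..<m}" and f: "f = (\<lambda>x. vadd (\<sigma> ` x) a)"
    using assms unfolding Aut_def by blast
  have inj: "inj \<sigma>" using \<sigma> by (rule permutes_inj)
  have "vadd (f x) (f y) = \<sigma> ` vadd x y" unfolding f image_vadd[OF inj] by auto
  then show ?thesis using inj by (simp add: hdist_def card_image inj_on_subset)
qed

lemma Aut_id: "id \<in> Aut m"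
  using Aut_permutation[OF permutes_id] by (simp only: image_id)

lemma Aut_comp:
  assumes "f \<in> Aut m" "g \<in> Aut m"
  shows "f \<circ> g \<in> Aut m"
proof -
  obtain \<sigma> a where f: "\<sigma> permutes {..<m}" "a \<in> vectors m" "f = (\<lambda>x. vadd (\<sigma> ` x) a)"
    using assms(1) unfolding Aut_def by blast
  obtain \<tau> b where g: "\<tau> permutes {..<m}" "b \<in> vectors m" "g = (\<lambda>x. vadd (\<tau> ` x) b)"
    using assms(2) unfolding Aut_def by blast
  have "f \<circ> g = (\<lambda>x. vadd ((\<sigma> \<circ> \<tau>) ` x) (vadd (\<sigma> ` b) a))"
    unfolding f(3) g(3) by (simp add: fun_eq_iff image_vadd[OF permutes_inj[OF f(1)]] image_image vadd_assoc)
  then show ?thesis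
    using AutI[OF permutes_compose[OF g(1) f(1)]] permutes_vectors[OF f(1) g(2)] f(2) by simp
qed

lemma Aut_inverse:
  assumes "f \<in> Aut m"
  obtains g where "g \<in> Aut m" "f \<circ> g = id" "g \<circ> f = id"
proof -
  obtain \<sigma> a where f: "\<sigma> permutes {..<m}" "a \<in> vectors m" "f = (\<lambda>x. vadd (\<sigma> ` x) a)"
    using assms unfolding Aut_def by blast
  let ?i = "inv \<sigma>"
  have i: "?i permutes {..<m}" using f(1) by (rule permutes_inv)
  let ?g = "\<lambda>x. vadd (?i ` x) (?i ` a)"
  have "?g \<in> Aut m" using AutI[OF i permutes_vectors[OF i f(2)]] .
  moreover have "f \<circ> ?g = id" unfolding f(3)
    by (simp add: fun_eq_iff image_vadd[OF permutes_inj[OF f(1)]] image_image permutes_inverses[OF f(1)])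
  moreover have "?g \<circ> f = id" unfolding f(3)
    by (simp add: fun_eq_iff image_vadd[OF permutes_inj[OF i]] image_image permutes_inverses[OF f(1)])
  ultimately show thesis by (rule that)
qed

lemma equivalent_codesI:
  assumes "f \<in> Aut m" "f ` C = S" "h \<in> Aut m" "h ` C' = S"
  shows "equivalent_codes m C C'"
proof -
  obtain k where k: "k \<in> Aut m" "k \<circ> h = id" using Aut_inverse[OF assms(3)] by blast
  have "(k \<circ> f) ` C = (k \<circ> h) ` C'" by (simp only: image_comp[symmetric] assms(2,4))
  then have "(k \<circ> f) ` C = C'" by (simp only: k(2) id_apply image_id)
  then show ?thesis unfolding equivalent_codes_def using Aut_comp[OF k(1) assms(1)] by (rule bexI)
qed

text \<open>\<open>S\<close> with the position \<open>V i\<close> is a normal form for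
  \<open>C\<close> with a vector at distance i. If \<open>f\<close> and \<open>f'\<close> bring
  \<open>g\<close> and \<open>g'\<close> of the same class to it, then \<open>f\<close> followed by
  the inverse of \<open>f'\<close> stabilises \<open>C\<close> and moves \<open>g\<close> to
  \<open>g'\<close>. So the full stabiliser of \<open>C\<close> serves as the group.\<close>

lemma (in code) completely_transitiveI:
  assumes ex: "\<And>g. g \<in> vectors m \<Longrightarrow> \<exists>f\<in>Aut m. f ` C = S \<and> f g = V (d g)"
  shows "completely_transitive m C"
proof -
  define X where "X = {f \<in> Aut m. f ` C = C}"
  have "is_subgroup_Aut m X"
    unfolding is_subgroup_Aut_def
  proof (intro conjI ballI)
    show "X \<subseteq> Aut m" "id \<in> X" using Aut_id by (auto simp: X_def)
    show "f \<circ> g \<in> X" if "f \<in> X" "g \<in> X" for f g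
    proof -
      have "(f \<circ> g) ` C = f ` g ` C" by (rule image_comp[symmetric])
      then show ?thesis using that Aut_comp by (auto simp only: X_def mem_Collect_eq)
    qed
    show "\<exists>g\<in>X. f \<circ> g = id \<and> g \<circ> f = id" if "f \<in> X" for f
    proof -
      have f: "f \<in> Aut m" "f ` C = C" using that by (simp_all add: X_def)
      obtain g where g: "g \<in> Aut m" "f \<circ> g = id" "g \<circ> f = id" by (rule Aut_inverse[OF f(1)])
      have "g ` C = (g \<circ> f) ` C" by (simp only: image_comp[symmetric] f(2))
      then show ?thesis using g by (auto simp: X_def)
    qed
  qed
  moreover have "\<exists>g. dist_part m C i = orbit_of X g" if i: "i \<le> covering_radius m C" for i
  proof -
    \<comment> \<open>The covering radius is attained, so every class up to it has a
      representative.\<close>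
    have "covering_radius m C \<in> d ` vectors m"
      unfolding covering_radius_def by (rule Max_in) (auto intro: empty_vectors)
    then obtain g0 where "g0 \<in> vectors m" "i \<le> d g0" using i by auto
    then obtain g where g: "g \<in> vectors m" "d g = i" by (rule d_intermediate)
    obtain f where f: "f \<in> Aut m" "f ` C = S" "f g = V i" using ex[OF g(1)] g(2) by blast
    have "dist_part m C i = orbit_of X g"
    proof (intro equalityI subsetI)
      fix g' assume "g' \<in> dist_part m C i"
      then have g': "g' \<in> vectors m" "d g' = i" by (simp_all add: dist_part_def)
      obtain f' where f': "f' \<in> Aut m" "f' ` C = S" "f' g' = V i" using ex[OF g'(1)] g'(2) by blast
      obtain h where h: "h \<in> Aut m" "h \<circ> f' = id" by (rule Aut_inverse[OF f'(1)])
      have "(h \<circ> f) ` C = (h \<circ> f') ` C" by (simp only: image_comp[symmetric] f(2) f'(2))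
      then have "h \<circ> f \<in> X" using Aut_comp[OF h(1) f(1)] h(2) by (simp add: X_def)
      moreover have "(h \<circ> f) g = (h \<circ> f') g'" by (simp add: f(3) f'(3))
      then have "(h \<circ> f) g = g'" using h(2) by simp
      ultimately show "g' \<in> orbit_of X g" unfolding orbit_of_def by blast
    next
      fix g' assume "g' \<in> orbit_of X g"
      then obtain k where k: "k \<in> Aut m" "k ` C = C" "g' = k g" by (auto simp: orbit_of_def X_def)
      have "dist_code (k g) (k ` C) = d g" using Aut_hdist[OF k(1)] by (rule dist_code_image)
      then show "g' \<in> dist_part m C i" using k g Aut_vectors by (simp add: dist_part_def)
    qed
    then show ?thesis by blast
  qed
  ultimately show ?thesis unfolding completely_transitive_def by blast
qed

section \<open>Normal form of a vector relative to the code\<close>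

context nr_code begin

text \<open>By \<open>odd_vector\<close> an odd vector has a codeword at distance 1 or 3, and an
  even vector has an odd neighbour.\<close>

lemma d_le_4:
  assumes g: "g \<in> vectors 16"
  shows "d g \<le> 4"
proof -
  have odd: "d g \<le> 3" if g: "g \<in> vectors 16" "odd (card g)" for g
  proof (rule ccontr)
    assume "\<not> d g \<le> 3"
    then have "dist_count D 1 g = 0" "dist_count D 3 g = 0" using dist_count_below by simp_all
    then show False using odd_vector[OF g] by simp
  qed
  show ?thesis
  proof (cases "odd (card g)")
    case False
    have "vadd g {0} \<in> vectors 16" using g by simp
    moreover have "odd (card (vadd g {0}))"
      using hdist_flip[OF g empty_vectors, of 0] False by (cases "0 \<in> g") (auto simp del: in_vadd, presburger)
    ultimately have "d (vadd g {0}) \<le> 3" by (rule odd)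
    then show ?thesis using d_flip(2)[OF g, of 0] by simp
  qed (use odd[OF g] in simp)
qed

text \<open>Padding with the remaining coordinates supplies three starting points even for a short
  list. A fourth entry gets label 3 because it completes a quad.\<close>

lemma homogeneous_list:
  assumes xs: "distinct xs" "set xs \<in> vectors 16" "length xs \<le> 4"
    and quad: "length xs = 4 \<Longrightarrow> set xs \<in> quads"
  obtains \<phi> where "\<phi> permutes {..<16}" "(`) \<phi> ` D = standard_code" "\<And>j. j < length xs \<Longrightarrow> \<phi> (xs ! j) = j"
proof -
  obtain ys where ys: "distinct ys" "set ys = {..<16} - set xs"
    using finite_distinct_list[of "{..<16} - set xs"] by auto
  define zs where "zs = xs @ ys"
  have zs: "distinct zs" "set zs = {..<16}" using xs ys by (auto simp: zs_def vectors_def)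
  then have len: "length zs = 16" by (metis card_lessThan distinct_card)
  then have "zs ! 0 \<in> set zs" "zs ! 1 \<in> set zs" "zs ! 2 \<in> set zs" by (auto intro: nth_mem)
  then have lt: "zs ! 0 < 16" "zs ! 1 < 16" "zs ! 2 < 16" unfolding zs(2) by simp_all
  have "distinct [zs ! 0, zs ! 1, zs ! 2]" using nth_eq_iff_index_eq[OF zs(1)] len by simp
  then obtain \<phi> where \<phi>: "\<phi> permutes {..<16}" "(`) \<phi> ` D = standard_code" "\<phi> (zs ! 0) = 0" "\<phi> (zs ! 1) = 1" "\<phi> (zs ! 2) = 2"
    "\<forall>x. {zs ! 0, zs ! 1, zs ! 2, x} \<in> quads \<longrightarrow> \<phi> x = 3"
    by (rule homogeneous[OF lt])
  show thesis
  proof (rule that[OF \<phi>(1,2)])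
    fix j assume j: "j < length xs"
    then have xz: "xs ! j = zs ! j" by (simp add: zs_def nth_append)
    have "j = 0 \<or> j = 1 \<or> j = 2 \<or> j = 3" using j xs(3) by linarith
    moreover have "\<phi> (zs ! 3) = 3" if "j = 3"
    proof -
      have l4: "length xs = 4" using that j xs(3) by simp
      then have "xs = [xs ! 0, xs ! 1, xs ! 2, xs ! 3]"
        by (intro nth_equalityI) (auto simp: less_Suc_eq numeral_eq_Suc)
      then have "set xs = {xs ! 0, xs ! 1, xs ! 2, xs ! 3}" by (metis list.set(1) list.set(2))
      then have "{zs ! 0, zs ! 1, zs ! 2, zs ! 3} \<in> quads"
        using quad[OF l4] l4 by (simp add: zs_def nth_append)
      then show ?thesis using \<phi>(6) by blast
    qed
    ultimately show "\<phi> (xs ! j) = j" unfolding xz using \<phi>(3-5) by auto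
  qed
qed

lemma quadsI:
  assumes "v \<in> vectors 16" "card v = 4" "\<And>c. c \<in> D \<Longrightarrow> hdist v c \<noteq> 2"
  shows "v \<in> quads"
proof -
  have "c \<notin> sixes v" for c
    using hdist_codeword[of c v] assms by (auto simp: sixes_def)
  then show ?thesis using assms by (auto simp: quads_def)
qed

text \<open>The hypothesis on \<open>d v\<close> says that zero is a nearest codeword. A 4-set of
  this kind has no codeword at distance 2 and is therefore a quad.\<close>

lemma prefix_image:
  assumes v: "v \<in> vectors 16" "d v = card v"
  obtains \<phi> where "\<phi> permutes {..<16}" "(`) \<phi> ` D = standard_code" "\<phi> ` v = {..<card v}"
proof -
  obtain xs where xs: "set xs = v" "distinct xs" using finite_distinct_list[of v] v(1) by auto
  then have len: "length xs = card v" by (metis distinct_card)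
  have "v \<in> quads" if "card v = 4"
    using that v d_le[of _ v] by (intro quadsI) fastforce+
  then obtain \<phi> where \<phi>: "\<phi> permutes {..<16}" "(`) \<phi> ` D = standard_code" "\<And>j. j < length xs \<Longrightarrow> \<phi> (xs ! j) = j"
    using homogeneous_list[of xs] xs len d_le_4[OF v(1)] v by auto
  have "\<phi> ` v = (\<lambda>j. \<phi> (xs ! j)) ` {..<length xs}"
    unfolding xs(1)[symmetric] by (simp add: nth_image[symmetric] image_image flip: lessThan_atLeast0)
      (metis image_image lessThan_atLeast0 nth_image order_refl take_all)
  also have "\<dots> = {..<card v}" using \<phi>(3) len by (simp add: image_cong)
  finally show thesis using that \<phi> by blast
qed

end

lemma (in distance_code) nr_code_translate_16:
  assumes m: "m = 16" and \<delta>: "\<delta> = 6" and card: "card C = 256"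
    and even: "\<And>c c'. c \<in> C \<Longrightarrow> c' \<in> C \<Longrightarrow> even (hdist c c')" and c: "c \<in> C"
  shows "nr_code (vadd c ` C)"
proof
  show "vadd c ` C \<subseteq> vectors 16" using C_vectors c m by auto
  show "{} \<in> vadd c ` C" using c by (metis imageI vadd_self)
  show "card (vadd c ` C) = 256" using card by (simp add: card_image)
  show "even (card x)" if "x \<in> vadd c ` C" for x
    using that even[OF c] by (auto simp: hdist_def)
  show "6 \<le> hdist x y" if "x \<in> vadd c ` C" "y \<in> vadd c ` C" "x \<noteq> y" for x y
  proof -
    obtain x' y' where "x' \<in> C" "y' \<in> C" "x = vadd c x'" "y = vadd c y'" using \<open>x \<in> _\<close> \<open>y \<in> _\<close> by blast
    then show ?thesis using min_distance[of x' y'] \<delta> \<open>x \<noteq> y\<close> by (auto simp only: hdist_vadd)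
  qed
qed

lemma (in distance_code) Aut_to_std_16:
  assumes m: "m = 16" and \<delta>: "\<delta> = 6" and card: "card C = 256"
    and even: "\<And>c c'. c \<in> C \<Longrightarrow> c' \<in> C \<Longrightarrow> even (hdist c c')" and g: "g \<in> vectors m"
  shows "\<exists>f\<in>Aut m. f ` C = standard_code \<and> f g = {..<d g}"
proof -
  obtain c where c: "c \<in> C" "hdist g c = d g" by (rule d_attained)
  interpret T: nr_code "vadd c ` C" by (rule nr_code_translate_16[OF m \<delta> card even c(1)])
  have cv: "c \<in> vectors m" using c C_vectors by blast
  have v: "vadd c g \<in> vectors 16" using cv g m by simp
  have dv: "T.d (vadd c g) = d g" by (rule dist_code_image) simp
  have cardv: "card (vadd c g) = d g" using c(2) by (simp add: hdist_def vadd_commute)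
  obtain \<phi> where \<phi>: "\<phi> permutes {..<16}" "(`) \<phi> ` vadd c ` C = standard_code" "\<phi> ` vadd c g = {..<card (vadd c g)}"
    using T.prefix_image[OF v] dv cardv by metis
  define f where "f = (\<lambda>x. vadd (\<phi> ` x) (\<phi> ` c))"
  have f: "f x = \<phi> ` vadd c x" for x
    unfolding f_def image_vadd[OF permutes_inj[OF \<phi>(1)]] by (rule vadd_commute)
  have "f \<in> Aut m" unfolding f_def using \<phi>(1) permutes_vectors[OF \<phi>(1)] cv m by (intro AutI) auto
  moreover have "f ` C = standard_code" unfolding \<phi>(2)[symmetric] by (simp add: f image_image)
  moreover have "f g = {..<d g}" unfolding f \<phi>(3) cardv ..
  ultimately show ?thesis by blast
qed

section \<open>Parity extension\<close>

text \<open>The parity bit is put at coordinate 0, the one that puncturing deletes.\<close>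

definition ext :: "nat set \<Rightarrow> nat set" where
  "ext x = Suc ` x \<union> (if odd (card x) then {0} else {})"

definition pun :: "nat set \<Rightarrow> nat set" where
  "pun a = (\<lambda>j. j - 1) ` (a - {0})"

lemma in_pun: "i \<in> pun a \<longleftrightarrow> Suc i \<in> a"
proof
  assume "Suc i \<in> a"
  then show "i \<in> pun a" unfolding pun_def by (intro image_eqI[of _ _ "Suc i"]) simp_all
next
  assume "i \<in> pun a"
  then obtain x where "x \<in> a" "x \<noteq> 0" "i = x - 1" unfolding pun_def by blast
  then show "Suc i \<in> a" by simp
qed

lemma pun_ext [simp]: "pun (ext x) = x"
  by (auto simp: in_pun ext_def)

lemma Suc_in_ext [simp]: "Suc i \<in> ext x \<longleftrightarrow> i \<in> x" "0 \<in> ext x \<longleftrightarrow> odd (card x)"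
  by (auto simp: ext_def)

lemma ext_vadd:
  assumes "x \<in> vectors m" "y \<in> vectors m"
  shows "ext (vadd x y) = vadd (ext x) (ext y)"
proof (rule set_eqI)
  fix i
  show "i \<in> ext (vadd x y) \<longleftrightarrow> i \<in> vadd (ext x) (ext y)"
    using even_hdist[OF assms] by (cases i) (auto simp: hdist_def)
qed

lemma ext_vectors: "x \<in> vectors 15 \<Longrightarrow> ext x \<in> vectors 16"
  by (auto simp: vectors_def ext_def)

lemma card_ext: "finite x \<Longrightarrow> card (ext x) = card x + of_bool (odd (card x))"
  by (simp add: ext_def card_image)

definition shift_perm :: "(nat \<Rightarrow> nat) \<Rightarrow> nat \<Rightarrow> nat" where
  "shift_perm \<phi> j = \<phi> (Suc j) - 1"

lemma shift_perm_permutes: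
  assumes \<phi>: "\<phi> permutes {..<Suc m}" "\<phi> 0 = 0"
  shows "shift_perm \<phi> permutes {..<m}"
proof (rule bij_imp_permutes)
  have pos: "\<phi> (Suc j) \<noteq> 0" for j
    using permutes_inj[OF \<phi>(1)] \<phi>(2) by (metis injD nat.distinct(1))
  have lt: "shift_perm \<phi> j < m" if "j < m" for j
    using permutes_in_image[OF \<phi>(1), of "Suc j"] pos[of j] that by (simp add: shift_perm_def)
  have inj: "inj_on (shift_perm \<phi>) {..<m}"
  proof (rule inj_onI)
    fix i j assume "shift_perm \<phi> i = shift_perm \<phi> j"
    then have "\<phi> (Suc i) = \<phi> (Suc j)" using pos[of i] pos[of j] by (simp add: shift_perm_def)
    then show "i = j" using permutes_inj[OF \<phi>(1)] by (metis injD nat.inject)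
  qed
  then show "bij_betw (shift_perm \<phi>) {..<m} {..<m}"
    unfolding bij_betw_def using endo_inj_surj[OF finite_lessThan _ inj] lt by auto
  show "shift_perm \<phi> j = j" if "j \<notin> {..<m}" for j
    using permutes_not_in[OF \<phi>(1), of "Suc j"] that by (simp add: shift_perm_def)
qed

lemma pun_image:
  assumes \<phi>: "\<phi> permutes {..<Suc m}" "\<phi> 0 = 0"
  shows "pun (\<phi> ` a) = shift_perm \<phi> ` pun a"
proof (rule set_eqI)
  fix i
  have inj: "inj \<phi>" using \<phi>(1) by (rule permutes_inj)
  have pos: "\<phi> (Suc j) \<noteq> 0" for j
    using inj \<phi>(2) by (metis injD nat.distinct(1))
  show "i \<in> pun (\<phi> ` a) \<longleftrightarrow> i \<in> shift_perm \<phi> ` pun a"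
  proof
    assume "i \<in> pun (\<phi> ` a)"
    then obtain k where k: "k \<in> a" "Suc i = \<phi> k" by (auto simp: in_pun)
    then obtain j where "k = Suc j" using \<phi>(2) by (cases k) auto
    with k have "Suc j \<in> a" "\<phi> (Suc j) = Suc i" by simp_all
    then show "i \<in> shift_perm \<phi> ` pun a"
      by (intro image_eqI[of _ _ j]) (simp_all add: shift_perm_def in_pun)
  next
    assume "i \<in> shift_perm \<phi> ` pun a"
    then obtain j where j: "Suc j \<in> a" "i = shift_perm \<phi> j" by (auto simp: in_pun)
    then have "Suc i = \<phi> (Suc j)" using pos[of j] by (simp add: shift_perm_def)
    then show "i \<in> pun (\<phi> ` a)" using j by (auto simp: in_pun)
  qed
qed

section \<open>Codes of length 15 through their extension\<close>

lemma (in distance_code) nr_code_ext: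
  assumes m: "m = 15" and \<delta>: "\<delta> = 5" and card: "card C = 256" and c: "c \<in> C"
  shows "nr_code (ext ` vadd c ` C)"
proof
  have v: "x \<in> vectors 15" if "x \<in> vadd c ` C" for x using that C_vectors c m by auto
  show "ext ` vadd c ` C \<subseteq> vectors 16" using v ext_vectors by blast
  have "{} \<in> vadd c ` C" using c by (metis imageI vadd_self)
  moreover have "ext {} = {}" by (simp add: ext_def)
  ultimately show "{} \<in> ext ` vadd c ` C" by (metis imageI)
  have "inj_on ext X" for X by (rule inj_on_inverseI[of _ pun]) simp
  then show "card (ext ` vadd c ` C) = 256" using card by (simp add: card_image)
  show "even (card x)" if "x \<in> ext ` vadd c ` C" for x
  proof -
    obtain y where y: "x = ext y" "y \<in> vadd c ` C" using \<open>x \<in> _\<close> by blast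
    then have "finite y" using v by (meson finite_vector)
    then show ?thesis by (simp add: y card_ext)
  qed
  show "6 \<le> hdist x y" if "x \<in> ext ` vadd c ` C" "y \<in> ext ` vadd c ` C" "x \<noteq> y" for x y
  proof -
    obtain x' y' where xy: "x' \<in> C" "y' \<in> C" "x = ext (vadd c x')" "y = ext (vadd c y')"
      using \<open>x \<in> _\<close> \<open>y \<in> _\<close> by blast
    then have "x' \<noteq> y'" using \<open>x \<noteq> y\<close> by blast
    then have 5: "5 \<le> hdist x' y'" using min_distance[OF xy(1,2)] \<delta> by simp
    have xv: "x' \<in> vectors 15" "y' \<in> vectors 15" "c \<in> vectors 15" using xy C_vectors c m by auto
    then have "vadd x y = ext (vadd (vadd c x') (vadd c y'))" unfolding xy by (subst ext_vadd[of _ 15]) auto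
    also have "vadd (vadd c x') (vadd c y') = vadd x' y'" by auto
    finally have "hdist x y = hdist x' y' + of_bool (odd (hdist x' y'))"
      using card_ext[of "vadd x' y'"] finite_vadd finite_vector xv unfolding hdist_def by metis
    then show ?thesis using 5 by (cases "hdist x' y' = 5") auto
  qed
qed

text \<open>The parity coordinate leads the list, so \<open>\<phi>\<close> fixes 0 and induces a
  permutation of the other 15 coordinates. It occupies one of the four places in the list, which
  leaves room for distances up to 3.\<close>

lemma (in distance_code) Aut_to_std_15:
  assumes m: "m = 15" and \<delta>: "\<delta> = 5" and card: "card C = 256" and le3: "d g \<le> 3" and g: "g \<in> vectors m"
  shows "\<exists>f\<in>Aut m. f ` C = pun ` standard_code \<and> f g = {..<d g}"
proof -
  obtain c where c: "c \<in> C" "hdist g c = d g" by (rule d_attained)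
  interpret T: nr_code "ext ` vadd c ` C" by (rule nr_code_ext[OF m \<delta> card c(1)])
  have cv: "c \<in> vectors m" using c C_vectors by blast
  define v where "v = vadd c g"
  have v: "v \<in> vectors 15" "finite v" using cv g m by (auto simp: v_def)
  have cardv: "card v = d g" using c(2) by (simp add: hdist_def vadd_commute v_def)
  obtain vs where vs: "set vs = v" "distinct vs" using finite_distinct_list[OF v(2)] by blast
  then have len: "length vs = card v" by (metis distinct_card)
  define xs where "xs = 0 # map Suc vs"
  have set_xs: "set xs = insert 0 (Suc ` v)" using vs by (simp add: xs_def)
  have xs: "distinct xs" "set xs \<in> vectors 16" "length xs \<le> 4"
    using vs len v le3 cardv unfolding set_xs by (auto simp: xs_def distinct_map vectors_def)
  \<comment> \<open>At distance 3 the list is the extension of the 3-set \<open>v\<close>. Extended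
    distances are even, so those of at least 3 become at least 4, and no codeword is at distance
    2.\<close>
  have quad: "set xs \<in> T.quads" if "length xs = 4"
  proof (rule T.quadsI[OF xs(2)])
    have v3: "card v = 3" using that len by (simp add: xs_def)
    show card4: "card (set xs) = 4" using that xs(1) by (metis distinct_card)
    fix e assume "e \<in> ext ` vadd c ` C"
    then obtain b where b: "b \<in> C" "e = ext (vadd c b)" by blast
    have bv: "b \<in> vectors m" using b C_vectors by blast
    have "3 \<le> hdist g b" using d_le[OF b(1), of g] v3 cardv by simp
    then have 3: "3 \<le> hdist v (vadd c b)" by (simp add: v_def)
    have "set xs = ext v" using v3 unfolding set_xs by (auto simp: ext_def)
    then have "vadd (set xs) e = ext (vadd v (vadd c b))"
      using v(1) cv bv m unfolding b by (subst ext_vadd[of _ 15]) auto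
    then have "hdist (set xs) e = hdist v (vadd c b) + of_bool (odd (hdist v (vadd c b)))"
      using card_ext[of "vadd v (vadd c b)"] v(2) cv bv finite_vadd finite_vector unfolding hdist_def by metis
    then show "hdist (set xs) e \<noteq> 2" using 3 by linarith
  qed
  obtain \<phi> where \<phi>: "\<phi> permutes {..<16}" "(`) \<phi> ` ext ` vadd c ` C = standard_code"
    "\<And>j. j < length xs \<Longrightarrow> \<phi> (xs ! j) = j"
    using T.homogeneous_list[OF xs quad] by blast
  have \<phi>0: "\<phi> 0 = 0" using \<phi>(3)[of 0] by (simp add: xs_def)
  have \<phi>': "\<phi> permutes {..<Suc m}" using \<phi>(1) m by simp
  define \<psi> where "\<psi> = shift_perm \<phi>"
  have \<psi>: "\<psi> permutes {..<m}" unfolding \<psi>_def using \<phi>' \<phi>0 by (rule shift_perm_permutes)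
  have pun: "\<psi> ` x = pun (\<phi> ` ext x)" for x
    unfolding \<psi>_def by (simp add: pun_image[OF \<phi>' \<phi>0])
  define f where "f = (\<lambda>x. vadd (\<psi> ` x) (\<psi> ` c))"
  have f: "f x = \<psi> ` vadd c x" for x
    unfolding f_def image_vadd[OF permutes_inj[OF \<psi>]] by (rule vadd_commute)
  have "f \<in> Aut m" unfolding f_def using \<psi> permutes_vectors[OF \<psi> cv] by (rule AutI)
  moreover have "f ` C = pun ` standard_code" unfolding \<phi>(2)[symmetric] by (simp add: f image_image pun)
  moreover have "f g = {..<d g}"
  proof -
    have "\<psi> (vs ! j) = j" if "j < card v" for j
      using \<phi>(3)[of "Suc j"] that len by (simp add: xs_def \<psi>_def shift_perm_def)
    then have "(\<lambda>j. \<psi> (vs ! j)) ` {..<card v} = {..<card v}" by (simp add: image_cong)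
    moreover have "v = (!) vs ` {..<card v}"
      using vs(1) len by (metis lessThan_atLeast0 nth_image order_refl take_all)
    ultimately have "\<psi> ` v = {..<card v}" by (metis image_image)
    then show ?thesis unfolding f v_def[symmetric] cardv .
  qed
  ultimately show ?thesis by blast
qed

lemma nr_perm_PN: "(`) (shift_perm nr_perm) ` PN = pun ` standard_code"
proof -
  have p: "nr_perm permutes {..<Suc 15}" using nr_perm_permutes by simp
  have "PN = pun ` NR" by (simp add: PN_def pun_def)
  then show ?thesis
    unfolding nr_perm_NR[symmetric] \<open>PN = _\<close> image_image by (simp only: pun_image[OF p nr_perm_0])
qed

theorem theorem1p1:
  fixes m \<delta> :: nat and C :: "nat set set"
  assumes "C \<subseteq> vectors m"
    and "completely_regular m C"
    and "has_min_distance C \<delta>"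
  shows "((m, \<delta>) = (16, 6) \<longrightarrow> equivalent_codes m C NR \<and> completely_transitive m C) \<and>
         ((m, \<delta>) = (15, 5) \<longrightarrow> equivalent_codes m C PN \<and> completely_transitive m C)"
proof -
  have md: "\<exists>a\<in>C. \<exists>b\<in>C. a \<noteq> b \<and> hdist a b = \<delta>"
    "\<And>a b. a \<in> C \<Longrightarrow> b \<in> C \<Longrightarrow> a \<noteq> b \<Longrightarrow> \<delta> \<le> hdist a b"
    using assms(3) unfolding has_min_distance_def by blast+
  interpret cr_code m C \<delta>
  proof
    show "C \<subseteq> vectors m" "completely_regular m C" by (fact assms)+
    show "C \<noteq> {}" using md(1) by blast
    show "\<exists>a\<in>C. \<exists>b\<in>C. a \<noteq> b \<and> hdist a b = \<delta>" by (rule md(1))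
  qed (rule md(2))
  obtain c where "c \<in> C" using nonempty by blast
  then have c: "c \<in> vectors m" by (rule C_vectors)
  have "equivalent_codes m C NR \<and> completely_transitive m C" if m: "m = 16" and \<delta>: "\<delta> = 6"
  proof -
    have std: "\<exists>f\<in>Aut m. f ` C = standard_code \<and> f g = {..<d g}" if "g \<in> vectors m" for g
      using Aut_to_std_16[OF m \<delta> card_16[OF m \<delta>] _ that] even_16[OF m \<delta>] by blast
    have "completely_transitive m C" using std by (rule completely_transitiveI)
    moreover obtain f where "f \<in> Aut m" "f ` C = standard_code" using std[OF c] by blast
    then have "equivalent_codes m C NR"
      using Aut_permutation[OF nr_perm_permutes] nr_perm_NR unfolding m by (rule equivalent_codesI)
    ultimately show ?thesis by blast
  qed
  moreover have "equivalent_codes m C PN \<and> completely_transitive m C" if m: "m = 15" and \<delta>: "\<delta> = 5"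
  proof -
    have std: "\<exists>f\<in>Aut m. f ` C = pun ` standard_code \<and> f g = {..<d g}" if "g \<in> vectors m" for g
      using Aut_to_std_15[OF m \<delta> card_15[OF m \<delta>] outer_distribution_15(3)[OF m \<delta> that] that] .
    have "completely_transitive m C" using std by (rule completely_transitiveI)
    have "shift_perm nr_perm permutes {..<m}"
      using shift_perm_permutes[of nr_perm 15] nr_perm_permutes nr_perm_0 m by simp
    then have h: "(`) (shift_perm nr_perm) \<in> Aut m" by (rule Aut_permutation)
    obtain f where "f \<in> Aut m" "f ` C = pun ` standard_code" using std[OF c] by blast
    then have "equivalent_codes m C PN" using h nr_perm_PN by (rule equivalent_codesI)
    with \<open>completely_transitive m C\<close> show ?thesis by blast
  qed
  ultimately show ?thesis by blast
qed

end
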